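(* Let $G$ be a connected graph. Then there is a function $\ell:E(G)\to\mathbb{R}_{>0}$ such that $|G|_\ell\approx MTOP(G)$ (that is, such that the identity on $G$ extends to a homeomorphism between $|G|_\ell$ and $MTOP(G)$) if and only if $MTOP(G)$ is metrizable.
   Context: A graph $G$ is viewed as a 1-complex: each edge is a homeomorphic copy of the real unit interval. Given $\ell:E(G)\to\mathbb{R}_{>0}$, fix for each edge $e$ a homeomorphism $\sigma_e:e\to[0,\ell(e)]$. A half-edge is a connected subset $f$ of an edge $e$; if its endpoints are $a,b$, its length is $|\sigma_e(a)-\sigma_e(b)|$. For points $x,y$ of $G$ let $d_\ell(x,y)=\inf\{\ell(P): P \text{ is an } x\text{--}y \text{ arc in the 1-complex } G\}$, where $\ell(P)$ is the sum of the lengths of the edges and maximal half-edges in $P$. Identifying any two vertices $x,x'$ with $d_\ell(x,x')=0$ yields a metric space $(\overline{G},d_\ell)$, and $|G|_\ell$ denotes its completion. A ray is a 1-way infinite path. Two rays are vertex-equivalent if no finite set of vertices separates them; the classes are the vertex-ends, and $\Omega(G)$ denotes the set of vertex-ends. $MTOP(G)$ is the space $G\cup\Omega(G)$ with the following topology: each edge is a copy of $[0,1]$ bearing the corresponding metric and topology (so open subsets of edge interiors are open); the basic open neighbourhoods of a vertex $v$ are the open stars of radius $\varepsilon$ centred at $v$, for $0<\varepsilon<1$; for a vertex-end $\omega$ the sets $C(S,\omega)\cup\Omega(S,\omega)\cup \mathring{E}_\varepsilon(S,\omega)$ are open, where $S\subseteq V(G)$ is finite, $C(S,\omega)$ is the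 unique component of $G-S$ containing a ray in $\omega$, $\Omega(S,\omega)$ is the set of vertex-ends having a ray in $C(S,\omega)$, and $\mathring{E}_\varepsilon(S,\omega)$ is the set of all inner points of $S$--$C(S,\omega)$ edges at distance less than $\varepsilon$ from their endpoint in $C(S,\omega)$.
   Formalization: The homeomorphisms σ_e are taken to be the affine ones for the given copy of [0,1] on each edge; for arbitrary σ_e the claim fails, e.g. on an infinite star where σ_e sends the midpoints of the edges ever closer to the centre. *)

theory Defs
  imports "HOL-Analysis.Analysis"
begin

section \<open>Graphs\<close>

record 'a ugraph =
  verts :: "'a set"
  edges :: "'a set set"

definition simple_graph :: "'a ugraph \<Rightarrow> bool" where
  "simple_graph G \<longleftrightarrow> (\<forall>e\<in>edges G. e \<subseteq> verts G \<and> card e = 2)"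

text \<open>Reachability in \<open>G - S\<close>.\<close>

definition reach :: "'a ugraph \<Rightarrow> 'a set \<Rightarrow> 'a \<Rightarrow> 'a \<Rightarrow> bool" where
  "reach G S u v \<longleftrightarrow> u \<in> verts G - S \<and> v \<in> verts G - S \<and>
     (\<lambda>x y. x \<notin> S \<and> y \<notin> S \<and> {x, y} \<in> edges G)\<^sup>*\<^sup>* u v"

definition connected_graph :: "'a ugraph \<Rightarrow> bool" where
  "connected_graph G \<longleftrightarrow> simple_graph G \<and> verts G \<noteq> {} \<and>
     (\<forall>u\<in>verts G. \<forall>v\<in>verts G. reach G {} u v)"

text \<open>Vertex sets of the components of \<open>G - S\<close>; the components are induced subgraphs.\<close>

definition components_minus :: "'a ugraph \<Rightarrow> 'a set \<Rightarrow> 'a set set" where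
  "components_minus G S = {{w. reach G S v w} | v. v \<in> verts G - S}"


section \<open>The 1-complex of a graph\<close>

text \<open>Points are given by barycentric coordinates: \<open>seg u v t\<close> is the point \<open>(1 - t) u + t v\<close>
  of the edge \<open>{u, v}\<close>. Thus \<open>seg u v\<close> and \<open>seg v u\<close> are the two parametrizations
  of that edge by the unit interval, and \<open>seg u v t = seg v u (1 - t)\<close>.\<close>

definition vertex :: "'a \<Rightarrow> 'a \<Rightarrow> real" where
  "vertex v = (\<lambda>w. if w = v then 1 else 0)"

definition seg :: "'a \<Rightarrow> 'a \<Rightarrow> real \<Rightarrow> 'a \<Rightarrow> real" where
  "seg u v t = (\<lambda>w. (1 - t) * vertex u w + t * vertex v w)"

definition edge_points :: "'a set \<Rightarrow> ('a \<Rightarrow> real) set" where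
  "edge_points e = {seg u v t | u v t. e = {u, v} \<and> t \<in> {0..1}}"

definition points :: "'a ugraph \<Rightarrow> ('a \<Rightarrow> real) set" where
  "points G = vertex ` verts G \<union> (\<Union>e\<in>edges G. edge_points e)"

definition complex_open :: "'a ugraph \<Rightarrow> ('a \<Rightarrow> real) set \<Rightarrow> bool" where
  "complex_open G U \<longleftrightarrow> U \<subseteq> points G \<and>
     (\<forall>u v. {u, v} \<in> edges G \<longrightarrow> openin (top_of_set {0..1}) {t \<in> {0..1}. seg u v t \<in> U})"

definition complex_topology :: "'a ugraph \<Rightarrow> ('a \<Rightarrow> real) topology" where
  "complex_topology G = topology (complex_open G)"

lemma istopology_complex_open: "istopology (complex_open G)"
  unfolding istopology_def
proof (intro conjI allI impI)
  fix S T assume S: "complex_open G S" and T: "complex_open G T"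
  have "{t \<in> {0..1}. seg u v t \<in> S \<inter> T} =
      {t \<in> {0..1}. seg u v t \<in> S} \<inter> {t \<in> {0..1}. seg u v t \<in> T}" for u v
    by auto
  with S T show "complex_open G (S \<inter> T)"
    unfolding complex_open_def by (auto simp del: Int_iff)
next
  fix K assume K: "\<forall>S\<in>K. complex_open G S"
  have "{t \<in> {0..1}. seg u v t \<in> \<Union>K} = (\<Union>S\<in>K. {t \<in> {0..1}. seg u v t \<in> S})" for u v
    by auto
  with K show "complex_open G (\<Union>K)"
    unfolding complex_open_def by (auto simp del: Union_iff)
qed

lemma openin_complex_topology: "openin (complex_topology G) U \<longleftrightarrow> complex_open G U"
  by (simp add: complex_topology_def istopology_complex_open)


section \<open>Edge lengths and the length metric\<close>

text \<open>The homeomorphism from \<open>e\<close> onto \<open>[0, len e]\<close>: the affine one, for the given copy of the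
  unit interval. (Homeomorphisms distorted without bound over the edges at a vertex of infinite
  degree could change the topology.) Its orientation is immaterial, since only absolute
  differences of its values are used.\<close>

definition edge_coord :: "('a set \<Rightarrow> real) \<Rightarrow> 'a set \<Rightarrow> ('a \<Rightarrow> real) \<Rightarrow> real" where
  "edge_coord len e p = len e * p (SOME v. v \<in> e)"

text \<open>The coordinates of a half-edge form an interval, whose diameter is the distance of the
  coordinates of the two endpoints.\<close>

definition half_edge_length :: "('a set \<Rightarrow> real) \<Rightarrow> 'a set \<Rightarrow> ('a \<Rightarrow> real) set \<Rightarrow> real" where
  "half_edge_length len e f = diameter (edge_coord len e ` f)"

text \<open>Trivial arcs are included, so that every point has distance 0 from itself.\<close>

definition is_arc :: "'p topology \<Rightarrow> 'p set \<Rightarrow> 'p \<Rightarrow> 'p \<Rightarrow> bool" where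
  "is_arc X P x y \<longleftrightarrow> P \<subseteq> topspace X \<and>
     (x = y \<and> P = {x} \<or>
      (\<exists>g. homeomorphic_map (top_of_set {0..1::real}) (subtopology X P) g \<and> g 0 = x \<and> g 1 = y))"

text \<open>The edges and maximal half-edges in \<open>P\<close>, each paired with the edge it lies in. Single points
  are left out: they have length 0, but \<open>P\<close> may meet infinitely many edges in an endpoint. An arc
  contains only finitely many of the others, so that its length is a finite sum.\<close>

definition maximal_half_edges ::
  "'a ugraph \<Rightarrow> ('a \<Rightarrow> real) set \<Rightarrow> ('a set \<times> ('a \<Rightarrow> real) set) set" where
  "maximal_half_edges G P = {(e, f). e \<in> edges G \<and>
     f \<in> connected_components_of (subtopology (complex_topology G) (P \<inter> edge_points e)) \<and>
     (\<nexists>p. f = {p})}"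

definition arc_length :: "'a ugraph \<Rightarrow> ('a set \<Rightarrow> real) \<Rightarrow> ('a \<Rightarrow> real) set \<Rightarrow> real" where
  "arc_length G len P = (\<Sum>(e, f)\<in>maximal_half_edges G P. half_edge_length len e f)"

text \<open>Outside of the intended carriers, distances are set to 0 here and below, since the library's
  locale \<open>Metric_space\<close> demands total functions that are symmetric and nonnegative everywhere.\<close>

definition length_dist ::
  "'a ugraph \<Rightarrow> ('a set \<Rightarrow> real) \<Rightarrow> ('a \<Rightarrow> real) \<Rightarrow> ('a \<Rightarrow> real) \<Rightarrow> real" where
  "length_dist G len x y =
     (if x \<in> points G \<and> y \<in> points G
      then Inf {arc_length G len P | P. is_arc (complex_topology G) P x y} else 0)"

text \<open>Identification of vertices at distance 0, giving the metric space \<open>(quotient_points, quotient_dist)\<close>.\<close>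

definition vertex_identification ::
  "'a ugraph \<Rightarrow> ('a set \<Rightarrow> real) \<Rightarrow> (('a \<Rightarrow> real) \<times> ('a \<Rightarrow> real)) set" where
  "vertex_identification G len = {(x, y). x \<in> points G \<and> y \<in> points G \<and>
     (x = y \<or> x \<in> vertex ` verts G \<and> y \<in> vertex ` verts G \<and> length_dist G len x y = 0)}"

definition quotient_points :: "'a ugraph \<Rightarrow> ('a set \<Rightarrow> real) \<Rightarrow> ('a \<Rightarrow> real) set set" where
  "quotient_points G len = points G // vertex_identification G len"

definition quotient_dist ::
  "'a ugraph \<Rightarrow> ('a set \<Rightarrow> real) \<Rightarrow> ('a \<Rightarrow> real) set \<Rightarrow> ('a \<Rightarrow> real) set \<Rightarrow> real" where
  "quotient_dist G len X Y = length_dist G len (SOME x. x \<in> X) (SOME y. y \<in> Y)"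


section \<open>Completion of a metric space by Cauchy sequences\<close>

definition cauchy_equiv :: "'p set \<Rightarrow> ('p \<Rightarrow> 'p \<Rightarrow> real) \<Rightarrow> ((nat \<Rightarrow> 'p) \<times> (nat \<Rightarrow> 'p)) set" where
  "cauchy_equiv M d = {(s, t). Metric_space.MCauchy M d s \<and> Metric_space.MCauchy M d t \<and>
     (\<lambda>n. d (s n) (t n)) \<longlonglongrightarrow> 0}"

definition completion_points :: "'p set \<Rightarrow> ('p \<Rightarrow> 'p \<Rightarrow> real) \<Rightarrow> (nat \<Rightarrow> 'p) set set" where
  "completion_points M d = {s. Metric_space.MCauchy M d s} // cauchy_equiv M d"

definition completion_dist ::
  "'p set \<Rightarrow> ('p \<Rightarrow> 'p \<Rightarrow> real) \<Rightarrow> (nat \<Rightarrow> 'p) set \<Rightarrow> (nat \<Rightarrow> 'p) set \<Rightarrow> real" where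
  "completion_dist M d A B =
     (if A \<in> completion_points M d \<and> B \<in> completion_points M d
      then lim (\<lambda>n. d ((SOME s. s \<in> A) n) ((SOME t. t \<in> B) n)) else 0)"

definition completion_topology :: "'p set \<Rightarrow> ('p \<Rightarrow> 'p \<Rightarrow> real) \<Rightarrow> (nat \<Rightarrow> 'p) set topology" where
  "completion_topology M d =
     Metric_space.mtopology (completion_points M d) (completion_dist M d)"

definition completion_embed :: "'p set \<Rightarrow> ('p \<Rightarrow> 'p \<Rightarrow> real) \<Rightarrow> 'p \<Rightarrow> (nat \<Rightarrow> 'p) set" where
  "completion_embed M d x = cauchy_equiv M d `` {\<lambda>n. x}"

text \<open>The space \<open>|G|\<close> for the edge lengths \<open>len\<close>, and the canonical map from \<open>G\<close> into it.\<close>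

definition length_space ::
  "'a ugraph \<Rightarrow> ('a set \<Rightarrow> real) \<Rightarrow> (nat \<Rightarrow> ('a \<Rightarrow> real) set) set topology" where
  "length_space G len = completion_topology (quotient_points G len) (quotient_dist G len)"

definition length_space_embed ::
  "'a ugraph \<Rightarrow> ('a set \<Rightarrow> real) \<Rightarrow> ('a \<Rightarrow> real) \<Rightarrow> (nat \<Rightarrow> ('a \<Rightarrow> real) set) set" where
  "length_space_embed G len x =
     completion_embed (quotient_points G len) (quotient_dist G len) (vertex_identification G len `` {x})"


section \<open>Vertex-ends and \<open>MTOP(G)\<close>\<close>

definition rays :: "'a ugraph \<Rightarrow> (nat \<Rightarrow> 'a) set" where
  "rays G = {r. inj r \<and> (\<forall>n. {r n, r (Suc n)} \<in> edges G)}"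

definition vertex_equiv :: "'a ugraph \<Rightarrow> ((nat \<Rightarrow> 'a) \<times> (nat \<Rightarrow> 'a)) set" where
  "vertex_equiv G = {(r, r'). r \<in> rays G \<and> r' \<in> rays G \<and>
     (\<forall>S. finite S \<and> S \<subseteq> verts G \<longrightarrow> (\<exists>m n. reach G S (r m) (r' n)))}"

definition vertex_ends :: "'a ugraph \<Rightarrow> (nat \<Rightarrow> 'a) set set" where
  "vertex_ends G = rays G // vertex_equiv G"

definition end_component :: "'a ugraph \<Rightarrow> 'a set \<Rightarrow> (nat \<Rightarrow> 'a) set \<Rightarrow> 'a set" where
  "end_component G S \<omega> = (THE C. C \<in> components_minus G S \<and> (\<exists>r\<in>\<omega>. range r \<subseteq> C))"

text \<open>In the space \<open>G \<union> \<Omega>(G)\<close>, the points of \<open>G\<close> are tagged by \<open>Inl\<close> and the vertex-ends by \<open>Inr\<close>.\<close>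

definition open_star :: "'a ugraph \<Rightarrow> 'a \<Rightarrow> real \<Rightarrow> ('a \<Rightarrow> real) set" where
  "open_star G v \<epsilon> = insert (vertex v) {seg v w t | w t. {v, w} \<in> edges G \<and> 0 \<le> t \<and> t < \<epsilon>}"

definition induced_points :: "'a ugraph \<Rightarrow> 'a set \<Rightarrow> ('a \<Rightarrow> real) set" where
  "induced_points G C = vertex ` C \<union> (\<Union>e\<in>{e \<in> edges G. e \<subseteq> C}. edge_points e)"

definition end_nbhd ::
  "'a ugraph \<Rightarrow> 'a set \<Rightarrow> (nat \<Rightarrow> 'a) set \<Rightarrow> real \<Rightarrow> (('a \<Rightarrow> real) + (nat \<Rightarrow> 'a) set) set" where
  "end_nbhd G S \<omega> \<epsilon> = (let C = end_component G S \<omega> in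
     (induced_points G C \<union>
      {seg c s t | c s t. c \<in> C \<and> s \<in> S \<and> {c, s} \<in> edges G \<and> 0 < t \<and> t < 1 \<and> t < \<epsilon>})
     <+> {\<omega>' \<in> vertex_ends G. \<exists>r\<in>\<omega>'. range r \<subseteq> C})"

definition MTOP :: "'a ugraph \<Rightarrow> (('a \<Rightarrow> real) + (nat \<Rightarrow> 'a) set) topology" where
  "MTOP G = topology_generated_by
     ({Inl ` seg u v ` T | u v T. {u, v} \<in> edges G \<and> open T \<and> T \<subseteq> {0<..<1}} \<union>
      {Inl ` open_star G v \<epsilon> | v \<epsilon>. v \<in> verts G \<and> 0 < \<epsilon> \<and> \<epsilon> < 1} \<union>
      {end_nbhd G S \<omega> \<epsilon> | S \<omega> \<epsilon>. finite S \<and> S \<subseteq> verts G \<and> \<omega> \<in> vertex_ends G \<and> 0 < \<epsilon>})"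

end

theory Submission
  imports Defs
begin

text \<open>Let \<open>MTOP(G)\<close> be metrizable. The set of ends is closed, hence a countable intersection of open sets, and so the
  vertex set is a countable union of \<^emph>\<open>dispersed\<close> sets, where a set of vertices is dispersed if every end can be
  separated from it by finitely many vertices (lemma \<open>metrizable_imp_countably_dispersed\<close>). By an argument that goes back
  to Jung's characterization of the graphs with normal spanning trees, this yields a \<^emph>\<open>normal partition\<close>: finite
  connected vertex sets that partition the graph and are arranged like the vertices of a normal spanning tree
  (\<open>normal_partition_exists\<close>). If \<open>W n\<close> denotes the union of the parts of height less than \<open>n\<close>, then each component
  \<open>C\<close> of \<open>G - W n\<close> contains just one part of height \<open>n\<close> and has finitely many neighbours. All edges of \<open>C\<close> at this
  part get the same length, chosen so small that the part has diameter at most \<open>(1/2)^n\<close>.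

  Two estimates show that these lengths work. The diameter of a component of \<open>G - W n\<close> is at most \<open>8 * (1/2)^n\<close>
  (\<open>L_component\<close>), which makes the basic neighbourhoods of an end small. Conversely, the lengths of the edges at a
  vertex are bounded away from 0, as there are only finitely many parts below it; hence so are the lengths of the
  edges that leave a component of \<open>G - S\<close>, for finite \<open>S\<close>. A set \<open>A\<close> of vertices whose leaving edges have length at
  least \<open>\<delta>\<close> gives a lower bound for distances: points are formal convex combinations of vertices,
  and \<open>\<delta> * mass A\<close>, where \<open>mass A p\<close> is the part of \<open>p\<close> that lies in \<open>A\<close>, does not increase distances
  (\<open>L_ge_mass\<close>). The sets that generate the topology of \<open>MTOP(G)\<close> are given by open conditions
  on such masses; so they are open for the length metric. Finally, a Cauchy sequence of
  points of \<open>G\<close> has convergent coordinates. If one of the limits is positive, then the sequence converges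
  to a point of the star of that vertex. If all limits are 0, then the sequence leaves every finite part, ends up in one
  component of \<open>G - W n\<close> for each \<open>n\<close>, and converges to the end that these components determine. Therefore the
  completion adds exactly the ends.

  In the other direction, \<open>|G|\<close> is metrizable as the completion of a metric space. Both directions need
  that the length distance is a pseudometric, although arcs of the 1-complex are arbitrary topological arcs. The key
  is that the length of an arc is the sum over all edges of the Lebesgue measure of its trace on
  the edge (\<open>arc_length_eq_trace_measure\<close>). This is subadditive, which gives the triangle inequality; and a
  function that changes along each edge by at most the length passed changes along an arc by at
  most the length of the arc (\<open>edge_contraction_le_arc_length\<close>), since the image of the arc is an interval covered by the
  images of its half-edges.\<close>

section \<open>The 1-complex in barycentric coordinates\<close>

lemma seg_apply: "seg u v t w = (1 - t) * (if w = u then 1 else 0) + t * (if w = v then 1 else 0)"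
  by (simp add: seg_def vertex_def)

lemma seg_commute: "seg u v t = seg v u (1 - t)"
  by (auto simp: seg_def)

lemma seg_0 [simp]: "seg u v 0 = vertex u" and seg_1 [simp]: "seg u v 1 = vertex v"
  by (auto simp: seg_def)

lemma edge_points_pair: "edge_points {u, v} = seg u v ` {0..1}"
proof
  show "edge_points {u, v} \<subseteq> seg u v ` {0..1}"
  proof
    fix p assume "p \<in> edge_points {u, v}"
    then obtain a b t where p: "p = seg a b t" "{u, v} = {a, b}" "t \<in> {0..1}"
      unfolding edge_points_def by auto
    then consider "a = u" "b = v" | "a = v" "b = u" by (auto simp: doubleton_eq_iff)
    then show "p \<in> seg u v ` {0..1}"
    proof cases
      case 2
      then have "p = seg u v (1 - t)" using p seg_commute[of v u t] by simp
      then show ?thesis using p by auto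
    qed (use p in auto)
  qed
qed (unfold edge_points_def, blast)

lemma edge_points_subset: "e \<in> edges G \<Longrightarrow> edge_points e \<subseteq> points G"
  by (auto simp: points_def)

lemma seg_in_points: "{u, v} \<in> edges G \<Longrightarrow> t \<in> {0..1} \<Longrightarrow> seg u v t \<in> points G"
  using edge_points_subset[of "{u, v}" G] by (auto simp: edge_points_pair)

lemma vertex_in_points: "v \<in> verts G \<Longrightarrow> vertex v \<in> points G"
  by (simp add: points_def)

lemma topspace_complex [simp]: "topspace (complex_topology G) = points G"
proof -
  have "complex_open G (points G)"
    unfolding complex_open_def
  proof (intro conjI allI impI)
    fix u v assume "{u, v} \<in> edges G"
    then have "{t \<in> {0..1}. seg u v t \<in> points G} = {0..1}" using seg_in_points[of u v G] by blast
    then show "openin (top_of_set {0..1}) {t \<in> {0..1}. seg u v t \<in> points G}"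
      by (metis openin_euclidean_subtopology_iff openin_subtopology_self)
  qed auto
  then show ?thesis
    by (metis complex_open_def openin_complex_topology openin_subset openin_topspace subset_antisym)
qed

lemma continuous_map_seg:
  assumes "{u, v} \<in> edges G"
  shows "continuous_map (top_of_set {0..1}) (complex_topology G) (seg u v)"
  using assms seg_in_points[OF assms]
  by (auto simp: continuous_map_def openin_complex_topology complex_open_def)

text \<open>The 1-complex carries the final topology with respect to the parametrizations of its edges.\<close>

lemma continuous_map_on_complex:
  assumes "\<And>p. p \<in> points G \<Longrightarrow> f p \<in> topspace Y"
    and "\<And>u v. {u, v} \<in> edges G \<Longrightarrow> continuous_map (top_of_set {0..1}) Y (\<lambda>t. f (seg u v t))"
  shows "continuous_map (complex_topology G) Y f"
  unfolding continuous_map_def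
proof (intro conjI allI impI)
  fix U assume U: "openin Y U"
  show "openin (complex_topology G) {x \<in> topspace (complex_topology G). f x \<in> U}"
    unfolding openin_complex_topology complex_open_def
  proof (intro conjI allI impI)
    fix u v assume e: "{u, v} \<in> edges G"
    have "{t \<in> {0..1}. seg u v t \<in> {x \<in> topspace (complex_topology G). f x \<in> U}}
        = {t \<in> topspace (top_of_set {0..1}). f (seg u v t) \<in> U}"
      using seg_in_points[OF e] by auto
    then show "openin (top_of_set {0..1}) {t \<in> {0..1}. seg u v t \<in> {x \<in> topspace (complex_topology G). f x \<in> U}}"
      using openin_continuous_map_preimage[OF assms(2)[OF e] U] by simp
  qed auto
qed (use assms(1) in auto)

lemma continuous_map_coordinate:
  "continuous_map (complex_topology G) euclideanreal (\<lambda>p. p w)"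
  by (rule continuous_map_on_complex) (auto simp: seg_def intro!: continuous_intros)

lemma openin_coordinate:
  assumes "open (U :: real set)"
  shows "openin (complex_topology G) {p \<in> points G. p w \<in> U}"
  using openin_continuous_map_preimage[OF continuous_map_coordinate iffD1[OF open_openin assms]]
  by simp

lemma Hausdorff_complex: "Hausdorff_space (complex_topology G)"
  unfolding Hausdorff_space_def
proof (intro allI impI)
  fix p q assume pq: "p \<in> topspace (complex_topology G) \<and> q \<in> topspace (complex_topology G) \<and> p \<noteq> q"
  then obtain w where "p w \<noteq> q w" by auto
  then obtain U V :: "real set" where UV: "open U" "open V" "p w \<in> U" "q w \<in> V" "U \<inter> V = {}"
    by (meson separation_t2)
  show "\<exists>U V. openin (complex_topology G) U \<and> openin (complex_topology G) V \<and> p \<in> U \<and> q \<in> V \<and> disjnt U V"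
  proof (intro exI conjI)
    show "openin (complex_topology G) {x \<in> points G. x w \<in> U}" by (rule openin_coordinate[OF UV(1)])
    show "openin (complex_topology G) {x \<in> points G. x w \<in> V}" by (rule openin_coordinate[OF UV(2)])
  qed (use UV pq in \<open>auto simp: disjnt_iff\<close>)
qed

lemma simple_graph_edge:
  assumes "simple_graph G" "{u, v} \<in> edges G"
  shows "u \<in> verts G" "v \<in> verts G" "u \<noteq> v"
  using assms unfolding simple_graph_def by (auto simp: card_2_iff)

lemma simple_graph_edgeE:
  assumes "simple_graph G" "e \<in> edges G"
  obtains u v where "e = {u, v}" "u \<noteq> v" "u \<in> verts G" "v \<in> verts G"
proof -
  have "card e = 2" "e \<subseteq> verts G" using assms unfolding simple_graph_def by auto
  then obtain u v where "e = {u, v}" "u \<noteq> v" by (auto simp: card_2_iff)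
  then show ?thesis using \<open>e \<subseteq> verts G\<close> that by auto
qed

locale graph =
  fixes G :: "'a ugraph"
  assumes simple: "simple_graph G"
begin

lemma edge_vertsD: "{u, v} \<in> edges G \<Longrightarrow> u \<in> verts G" "{u, v} \<in> edges G \<Longrightarrow> v \<in> verts G"
    "{u, v} \<in> edges G \<Longrightarrow> u \<noteq> v"
  using simple_graph_edge[OF simple] by blast+

lemma points_cases:
  assumes "p \<in> points G"
  obtains v where "v \<in> verts G" "p = vertex v"
  | u v t where "{u, v} \<in> edges G" "0 < t" "t < 1" "p = seg u v t"
proof -
  consider "p \<in> vertex ` verts G" | e where "e \<in> edges G" "p \<in> edge_points e"
    using assms by (auto simp: points_def)
  then show ?thesis
  proof cases
    case 2
    obtain u v where uv: "e = {u, v}" "u \<in> verts G" "v \<in> verts G"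
      using simple_graph_edgeE[OF simple 2(1)] by metis
    then obtain t where t: "t \<in> {0..1}" "p = seg u v t" using 2 by (auto simp: edge_points_pair)
    then consider "t = 0" | "t = 1" | "0 < t" "t < 1" by fastforce
    then show ?thesis
      using uv t 2 that(1)[of u] that(1)[of v] that(2)[of u v t] by cases auto
  qed (use that in auto)
qed

lemma points_at:
  assumes "p \<in> points G" "p v > 0"
  shows "v \<in> verts G" "p = vertex v \<or> (\<exists>w. {v, w} \<in> edges G \<and> p = seg v w (1 - p v))" "p v \<le> 1"
proof -
  have "v \<in> verts G \<and> (p = vertex v \<or> (\<exists>w. {v, w} \<in> edges G \<and> p = seg v w (1 - p v))) \<and> p v \<le> 1"
    using assms(1)
  proof (cases rule: points_cases)
    case (1 u)
    then show ?thesis using assms(2) by (auto simp: vertex_def split: if_splits)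
  next
    case (2 a b t)
    have ab: "a \<noteq> b" using edge_vertsD 2 by blast
    consider "v = a" | "v = b" using assms(2) 2 by (auto simp: seg_apply split: if_splits)
    then show ?thesis
    proof cases
      case 1
      then have "p v = 1 - t" using 2 ab by (simp add: seg_apply)
      then show ?thesis using 1 2 edge_vertsD[OF 2(1)] by auto
    next
      case c: 2
      then have "p v = t" using 2 ab by (simp add: seg_apply)
      moreover have "p = seg v a (1 - t)" using 2 c seg_commute by metis
      ultimately show ?thesis using c 2 edge_vertsD[OF 2(1)] by (auto simp: insert_commute)
    qed
  qed
  then show "v \<in> verts G" "p = vertex v \<or> (\<exists>w. {v, w} \<in> edges G \<and> p = seg v w (1 - p v))" "p v \<le> 1"
    by auto
qed

lemma points_between:
  assumes "p \<in> points G" "p u > 0" "p v > 0" "u \<noteq> v"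
  shows "{u, v} \<in> edges G" "p = seg u v (p v)" "p u + p v = 1"
proof -
  have "p \<noteq> vertex u" using assms by (auto simp: vertex_def)
  then obtain w where w: "{u, w} \<in> edges G" "p = seg u w (1 - p u)"
    using points_at(2)[OF assms(1,2)] by auto
  have pv: "p v = seg u w (1 - p u) v" using w(2) by (rule fun_cong)
  then have "v = w" using assms(3,4) by (simp add: seg_apply split: if_splits)
  moreover from this have eq: "1 - p u = p v"
    using pv assms(4) by (simp add: seg_apply)
  ultimately show "{u, v} \<in> edges G" "p = seg u v (p v)" using w unfolding eq by blast+
  show "p u + p v = 1" using eq by simp
qed

lemma points_nonneg: "p \<in> points G \<Longrightarrow> 0 \<le> p v"
  by (cases rule: points_cases) (auto simp: seg_apply vertex_def)

lemma points_ex_pos: "p \<in> points G \<Longrightarrow> \<exists>v. p v > 0"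
  by (erule points_cases) (auto simp: seg_apply vertex_def edge_vertsD)

definition inner :: "'a set \<Rightarrow> ('a \<Rightarrow> real) set" where
  "inner e = {p \<in> points G. \<forall>v\<in>e. p v > 0}"

lemma inner_pair: "{u, v} \<in> edges G \<Longrightarrow> inner {u, v} = seg u v ` {0<..<1}"
proof (intro equalityI subsetI)
  fix p assume e: "{u, v} \<in> edges G" and "p \<in> inner {u, v}"
  then have p: "p \<in> points G" "p u > 0" "p v > 0" "u \<noteq> v" by (auto simp: inner_def edge_vertsD)
  show "p \<in> seg u v ` {0<..<1}"
    by (rule image_eqI[where x = "p v"], rule points_between(2)[OF p]) (use points_between(3)[OF p] p in auto)
next
  fix p assume e: "{u, v} \<in> edges G" and "p \<in> seg u v ` {0<..<1}"
  then obtain t where "p = seg u v t" "0 < t" "t < 1" by auto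
  then show "p \<in> inner {u, v}"
    using e edge_vertsD[OF e] seg_in_points[OF e, of t] by (auto simp: inner_def seg_apply)
qed

lemma inner_subset_edge_points: "e \<in> edges G \<Longrightarrow> inner e \<subseteq> edge_points e"
  by (metis edge_points_pair greaterThanLessThan_subseteq_atLeastAtMost_iff image_mono inner_pair
      order_refl simple simple_graph_edgeE)

lemma edge_points_inner:
  assumes "e \<in> edges G" "p \<in> edge_points e"
  shows "p \<in> inner e \<or> p \<in> vertex ` e"
proof -
  obtain u v where e: "e = {u, v}" using simple_graph_edgeE[OF simple assms(1)] by metis
  then obtain t where t: "t \<in> {0..1}" "p = seg u v t" using assms(2) by (auto simp: edge_points_pair)
  then consider "t = 0" | "t = 1" | "0 < t" "t < 1" by fastforce
  then show ?thesis using e t inner_pair[of u v] assms(1) by cases auto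
qed

lemma points_vertex_or_inner:
  "p \<in> points G \<Longrightarrow> p \<in> vertex ` verts G \<or> (\<exists>e\<in>edges G. p \<in> inner e)"
  by (erule points_cases) (auto simp: inner_pair intro!: bexI[of _ "{_, _}"])

lemma openin_inner: "e \<in> edges G \<Longrightarrow> openin (complex_topology G) (inner e)"
proof -
  assume e: "e \<in> edges G"
  obtain u v where uv: "e = {u, v}" using simple_graph_edgeE[OF simple e] by metis
  have "openin (complex_topology G) ({p \<in> points G. p u \<in> {0<..}} \<inter> {p \<in> points G. p v \<in> {0<..}})"
    by (intro openin_Int openin_coordinate) auto
  moreover have "{p \<in> points G. p u \<in> {0<..}} \<inter> {p \<in> points G. p v \<in> {0<..}} = inner e"
    by (auto simp: inner_def uv)
  ultimately show ?thesis by simp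
qed

text \<open>A point is a convex combination of vertices, and its mass in \<open>A\<close> is the total coefficient of the vertices in \<open>A\<close>.
  This is affine on every edge, and constant on the edges that do not leave \<open>A\<close>.\<close>

definition mass :: "'a set \<Rightarrow> ('a \<Rightarrow> real) \<Rightarrow> real" where
  "mass A p = (\<Sum>a | a \<in> A \<and> p a \<noteq> 0. p a)"

lemma mass_vertex [simp]: "mass A (vertex v) = of_bool (v \<in> A)"
proof -
  have "{a. a \<in> A \<and> vertex v a \<noteq> 0} = (if v \<in> A then {v} else {})" by (auto simp: vertex_def)
  then show ?thesis by (simp add: mass_def vertex_def)
qed

lemma mass_seg:
  assumes "u \<noteq> v" shows "mass A (seg u v t) = (1 - t) * of_bool (u \<in> A) + t * of_bool (v \<in> A)"
proof -
  have "mass A (seg u v t) = (\<Sum>a\<in>{u, v} \<inter> A. seg u v t a)"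
    unfolding mass_def by (rule sum.mono_neutral_left) (auto simp: seg_apply)
  also have "\<dots> = (\<Sum>a\<in>{u, v}. of_bool (a \<in> A) * seg u v t a)"
    by (rule sum.mono_neutral_cong_left) auto
  also have "\<dots> = (1 - t) * of_bool (u \<in> A) + t * of_bool (v \<in> A)" using assms by (simp add: seg_apply)
  finally show ?thesis .
qed

lemma mass_singleton: "mass {v} p = p v"
proof -
  have "{a. a \<in> {v} \<and> p a \<noteq> 0} = (if p v = 0 then {} else {v})" by auto
  then show ?thesis by (simp add: mass_def)
qed

lemma mass_bounds: assumes "p \<in> points G" shows "0 \<le> mass A p" "mass A p \<le> 1"
  using assms by (cases rule: points_cases; auto simp: mass_seg edge_vertsD)+

lemma mass_verts: "p \<in> points G \<Longrightarrow> mass (verts G) p = 1"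
  by (erule points_cases) (auto simp: mass_seg edge_vertsD)

lemma mass_posD: "mass A p > 0 \<Longrightarrow> \<exists>a\<in>A. p a \<noteq> 0"
  unfolding mass_def by (metis (mono_tags, lifting) less_irrefl mem_Collect_eq sum.neutral)

lemma finite_support: "p \<in> points G \<Longrightarrow> finite {a. p a \<noteq> 0}"
proof (erule points_cases)
  fix v assume "p = vertex v"
  then show ?thesis by (auto intro: finite_subset[of _ "{v}"] simp: vertex_def split: if_splits)
next
  fix u v t assume "p = seg u v t"
  then show ?thesis by (auto intro: finite_subset[of _ "{u, v}"] simp: seg_apply split: if_splits)
qed

lemma mass_ge: assumes "p \<in> points G" "a \<in> A" shows "p a \<le> mass A p"
proof (cases "p a = 0")
  case False
  have "finite {a \<in> A. p a \<noteq> 0}" using finite_support[OF assms(1)] by (rule rev_finite_subset) auto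
  then show ?thesis unfolding mass_def using False assms points_nonneg[OF assms(1)] 
    by (intro member_le_sum) auto
qed (use mass_bounds assms in auto)

lemma mass_Diff:
  assumes "p \<in> points G" "B \<subseteq> A" shows "mass (A - B) p = mass A p - mass B p"
proof -
  have fin: "finite {a \<in> A. p a \<noteq> 0}" using finite_support[OF assms(1)] by (rule rev_finite_subset) auto
  have "{a. a \<in> A - B \<and> p a \<noteq> 0} = {a \<in> A. p a \<noteq> 0} - {a \<in> B. p a \<noteq> 0}" by auto
  then show ?thesis unfolding mass_def using fin assms(2) by (simp add: sum_diff subset_iff)
qed

lemma mass_finite: "finite A \<Longrightarrow> mass A p = (\<Sum>a\<in>A. p a)"
  unfolding mass_def by (rule sum.mono_neutral_left) auto

end

section \<open>Arcs\<close>

lemma continuous_map_affine_reparametrization: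
  fixes g :: "real \<Rightarrow> 'p"
  assumes "continuous_map (top_of_set {a..b}) X g" and "\<And>t. t \<in> S \<Longrightarrow> m * t + c \<in> {a..b}"
  shows "continuous_map (top_of_set S) X (\<lambda>t. g (m * t + c))"
proof -
  have "continuous_map (top_of_set S) (top_of_set {a..b}) (\<lambda>t. m * t + c)"
    using assms(2) by (auto simp: continuous_map_in_subtopology intro!: continuous_intros)
  from continuous_map_compose[OF this assms(1)] show ?thesis by (simp add: o_def)
qed

text \<open>An injective path is a homeomorphism onto its image, since its domain is compact and \<open>X\<close> is Hausdorff. Arbitrary parameter intervals
  are convenient for cutting and joining arcs, and the degenerate intervals account for the trivial arcs.\<close>

lemma is_arc_iff_injective_path:
  assumes X: "Hausdorff_space X"
  shows "is_arc X P x y \<longleftrightarrow> (\<exists>a b g. (a::real) \<le> b \<and> continuous_map (top_of_set {a..b}) X g \<and>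
           inj_on g {a..b} \<and> P = g ` {a..b} \<and> g a = x \<and> g b = y)" (is "_ \<longleftrightarrow> ?R")
proof
  assume arc: "is_arc X P x y"
  then consider "P \<subseteq> topspace X" "x = y" "P = {x}"
    | g where "P \<subseteq> topspace X" "homeomorphic_map (top_of_set {0..1::real}) (subtopology X P) g" "g 0 = x" "g 1 = y"
    by (auto simp: is_arc_def)
  then show ?R
  proof cases
    case 1
    then show ?thesis by (intro exI[of _ "0::real"] exI[of _ "\<lambda>_. x"]) auto
  next
    case 2
    have "continuous_map (top_of_set {0..1}) X g"
      using homeomorphic_imp_continuous_map[OF 2(2)] by (rule continuous_map_into_fulltopology)
    moreover have "inj_on g {0..1}" using homeomorphic_imp_injective_map[OF 2(2)] by simp
    moreover have "P = g ` {0..1}" using homeomorphic_imp_surjective_map[OF 2(2)] 2(1) by auto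
    ultimately show ?thesis using 2 by (intro exI[of _ "0::real"] exI[of _ "1::real"] exI[of _ g]) auto
  qed
next
  assume ?R
  then obtain a b g where ab: "(a::real) \<le> b" and cont: "continuous_map (top_of_set {a..b}) X g"
    and inj: "inj_on g {a..b}" and P: "P = g ` {a..b}" "g a = x" "g b = y" by blast
  have sub: "P \<subseteq> topspace X" using continuous_map_image_subset_topspace[OF cont] P by auto
  show "is_arc X P x y"
  proof (cases "a = b")
    case True
    then show ?thesis using P sub by (auto simp: is_arc_def)
  next
    case False
    then have ab: "a < b" using ab by simp
    have img: "(\<lambda>t. (b - a) * t + a) ` {0..1} = {a..b}"
    proof (intro equalityI subsetI)
      fix s assume "s \<in> {a..b}"
      then show "s \<in> (\<lambda>t. (b - a) * t + a) ` {0..1}"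
        using ab by (intro image_eqI[of _ _ "(s - a) / (b - a)"]) (auto simp: divide_simps)
    next
      fix s assume "s \<in> (\<lambda>t. (b - a) * t + a) ` {0..1}"
      then obtain t where "s = (b - a) * t + a" "t \<in> {0..1}" by (rule imageE)
      moreover from this obtain m where m: "m = (b - a) * t" "m \<le> (b - a) * 1" "0 \<le> m"
        using ab mult_left_mono[of t 1 "b - a"] mult_nonneg_nonneg[of "b - a" t] by force
      ultimately have "s = m + a" "m \<le> b - a" by simp_all
      with m(3) have "a \<le> s" "s \<le> b" by linarith+
      then show "s \<in> {a..b}" by simp
    qed
    let ?h = "\<lambda>t. g ((b - a) * t + a)"
    have him: "?h ` {0..1} = P" using img P by (metis (no_types, lifting) image_cong image_image)
    have "continuous_map (top_of_set {0..1}) X ?h"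
      by (rule continuous_map_affine_reparametrization[OF cont]) (use img in blast)
    then have "continuous_map (top_of_set {0..1}) (subtopology X P) ?h"
      using him by (auto simp: continuous_map_in_subtopology)
    moreover have "inj_on ?h {0..1}"
    proof (rule inj_onI)
      fix s t :: real assume st: "s \<in> {0..1}" "t \<in> {0..1}" "?h s = ?h t"
      then have "(b - a) * s + a = (b - a) * t + a"
        using inj_onD[OF inj st(3)] img by blast
      then show "s = t" using ab by simp
    qed
    ultimately have "homeomorphic_map (top_of_set {0..1}) (subtopology X P) ?h"
      using him sub X
      by (intro continuous_imp_homeomorphic_map)
        (auto simp: compact_space_subtopology Hausdorff_space_subtopology)
    then show ?thesis using sub P unfolding is_arc_def by (intro conjI disjI2 exI[of _ ?h]) auto
  qed
qed

lemma is_arc_sym: assumes "Hausdorff_space X" "is_arc X P x y" shows "is_arc X P y x"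
proof -
  obtain a b g where g: "(a::real) \<le> b" "continuous_map (top_of_set {a..b}) X g"
    "inj_on g {a..b}" "P = g ` {a..b}" "g a = x" "g b = y"
    using assms is_arc_iff_injective_path by metis
  let ?h = "\<lambda>t. g ((-1) * t + 0)"
  have "continuous_map (top_of_set {-b..-a}) X ?h"
    by (rule continuous_map_affine_reparametrization[OF g(2)]) auto
  moreover have "inj_on ?h {-b..-a}"
  proof (rule inj_onI)
    fix s t assume st: "s \<in> {-b..-a}" "t \<in> {-b..-a}" "?h s = ?h t"
    have "-1 * s + 0 = -1 * t + 0" by (rule inj_onD[OF g(3) st(3)]) (use st in auto)
    then show "s = t" by simp
  qed
  moreover have "P = ?h ` {-b..-a}"
    using g(4) by (simp add: image_image[of g uminus, symmetric])
  ultimately show ?thesis using g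
    by (subst is_arc_iff_injective_path[OF assms(1)], intro exI[of _ "-b"] exI[of _ "-a"] exI[of _ ?h]) auto
qed

lemma is_arc_endpoints: assumes "Hausdorff_space X" "is_arc X P x y" shows "x \<in> P" "y \<in> P"
proof -
  obtain a b g where "(a::real) \<le> b" "P = g ` {a..b}" "g a = x" "g b = y"
    using assms is_arc_iff_injective_path by metis
  then show "x \<in> P" "y \<in> P" by auto
qed

lemma is_arc_compactin: assumes "Hausdorff_space X" "is_arc X P x y" shows "compactin X P"
proof -
  obtain a b g where "continuous_map (top_of_set {a..b::real}) X g" "P = g ` {a..b}"
    using assms is_arc_iff_injective_path by metis
  then show ?thesis using image_compactin[of "top_of_set {a..b}" "{a..b}" X g] by (simp add: compactin_subtopology)
qed

text \<open>Follow the first arc up to its first point on the second one, and then the second arc.\<close>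

lemma is_arc_join:
  assumes X: "Hausdorff_space X" and "is_arc X P x y" "is_arc X Q y z"
  obtains R where "is_arc X R x z" "R \<subseteq> P \<union> Q"
proof -
  obtain a b p where p: "(a::real) \<le> b" "continuous_map (top_of_set {a..b}) X p"
    "inj_on p {a..b}" "P = p ` {a..b}" "p a = x" "p b = y"
    using assms is_arc_iff_injective_path by metis
  obtain c d q where q: "(c::real) \<le> d" "continuous_map (top_of_set {c..d}) X q"
    "inj_on q {c..d}" "Q = q ` {c..d}" "q c = y" "q d = z"
    using assms is_arc_iff_injective_path by metis
  define T where "T = {t \<in> {a..b}. p t \<in> Q}"
  have "closedin X Q" using is_arc_compactin[OF X assms(3)] compactin_imp_closedin[OF X] by blast
  then have "closedin (top_of_set {a..b}) T"
    using closedin_continuous_map_preimage[OF p(2)] by (simp add: T_def)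
  then have "compact T" by (metis closedin_compact compact_Icc)
  moreover have "y \<in> Q" using q(1,4,5) by force
  then have "b \<in> T" using p by (auto simp: T_def)
  ultimately obtain t0 where t0: "t0 \<in> T" "\<And>t. t \<in> T \<Longrightarrow> t0 \<le> t"
    using compact_attains_inf[of T] by auto
  then obtain s0 where s0: "s0 \<in> {c..d}" "q s0 = p t0" using q(4) by (auto simp: T_def)
  have t0ab: "t0 \<in> {a..b}" using t0 by (auto simp: T_def)
  define e where "e = t0 + (d - s0)"
  define r where "r = (\<lambda>t. if t \<le> t0 then p t else q (1 * t + (s0 - t0)))"
  have sub: "subtopology (top_of_set {a..e}) {x \<in> topspace (top_of_set {a..e}). Q x}
      = top_of_set {x \<in> topspace (top_of_set {a..e}). Q x}" for Q
    unfolding subtopology_subtopology by (rule arg_cong[where f = top_of_set]) auto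
  have "continuous_map (top_of_set {a..e}) X r"
    unfolding r_def
  proof (rule continuous_map_cases_le)
    have "{x \<in> topspace (top_of_set {a..e}). x \<le> t0} \<subseteq> {a..b}" using t0ab by auto
    then have "continuous_map (top_of_set {x \<in> topspace (top_of_set {a..e}). x \<le> t0}) X p"
      using continuous_map_from_subtopology_mono[OF p(2)] by blast
    then show "continuous_map (subtopology (top_of_set {a..e}) {x \<in> topspace (top_of_set {a..e}). x \<le> t0}) X p"
      unfolding sub .
    have "continuous_map (top_of_set {x \<in> topspace (top_of_set {a..e}). t0 \<le> x}) X (\<lambda>t. q (1 * t + (s0 - t0)))"
      using s0 t0ab by (intro continuous_map_affine_reparametrization[OF q(2)]) (auto simp: e_def)
    then show "continuous_map (subtopology (top_of_set {a..e}) {x \<in> topspace (top_of_set {a..e}). t0 \<le> x}) X (\<lambda>t. q (1 * t + (s0 - t0)))"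
      unfolding sub .
  qed (use s0 in auto)
  moreover have "inj_on r {a..e}"
  proof -
    have mixed: False if "s \<in> {a..e}" "t \<in> {a..e}" "s \<le> t0" "\<not> t \<le> t0" "r s = r t" for s t
    proof -
      have tq: "t + (s0 - t0) \<in> {c..d}" using that s0 by (auto simp: e_def)
      have eq: "p s = q (t + (s0 - t0))" using that by (simp add: r_def)
      then have "s \<in> T" using tq that t0ab q(4) by (auto simp: T_def)
      then have "s = t0" using t0(2) that by force
      then have "q s0 = q (t + (s0 - t0))" using eq s0 by simp
      then have "s0 = t + (s0 - t0)" using inj_onD[OF q(3)] s0 tq by blast
      then show False using that by simp
    qed
    show ?thesis
    proof (rule inj_onI)
      fix s t assume st: "s \<in> {a..e}" "t \<in> {a..e}" "r s = r t"
      consider "s \<le> t0" "t \<le> t0" | "\<not> s \<le> t0" "\<not> t \<le> t0" | "s \<le> t0" "\<not> t \<le> t0" | "\<not> s \<le> t0" "t \<le> t0" by blast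
      then show "s = t"
      proof cases
        case 1
        then show ?thesis using st inj_onD[OF p(3), of s t] t0ab by (auto simp: r_def)
      next
        case 2
        have "s + (s0 - t0) \<in> {c..d}" "t + (s0 - t0) \<in> {c..d}" using 2 st s0 by (auto simp: e_def)
        moreover have "q (s + (s0 - t0)) = q (t + (s0 - t0))" using st 2 by (simp add: r_def)
        ultimately have "s + (s0 - t0) = t + (s0 - t0)" using inj_onD[OF q(3)] by blast
        then show ?thesis by simp
      qed (use mixed st in metis)+
    qed
  qed
  moreover have "a \<le> e" using t0ab s0 by (auto simp: e_def)
  moreover have "r a = x" using t0ab p by (simp add: r_def)
  moreover have "r e = z" using q s0 by (auto simp: r_def e_def)
  ultimately have "is_arc X (r ` {a..e}) x z"
    using is_arc_iff_injective_path[OF X] by blast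
  moreover have "r ` {a..e} \<subseteq> P \<union> Q"
  proof
    fix w assume "w \<in> r ` {a..e}"
    then obtain t where t: "t \<in> {a..e}" "w = r t" by blast
    show "w \<in> P \<union> Q"
    proof (cases "t \<le> t0")
      case True
      then show ?thesis using t t0ab p by (auto simp: r_def)
    next
      case False
      then have "1 * t + (s0 - t0) \<in> {c..d}" using t s0 by (auto simp: e_def)
      then show ?thesis using t False q by (auto simp: r_def)
    qed
  qed
  ultimately show ?thesis using that by blast
qed

text \<open>Every subset of \<open>Z\<close> is finite on each edge and hence closed in the 1-complex. Thus \<open>Z\<close> has no limit points,
  and the Bolzano-Weierstrass property applies.\<close>

lemma (in graph) compactin_Int_finite:
  assumes "compactin (complex_topology G) P" "Z \<subseteq> points G"
    and fin: "\<And>e. e \<in> edges G \<Longrightarrow> finite (Z \<inter> edge_points e)"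
  shows "finite (P \<inter> Z)"
proof (rule ccontr)
  let ?X = "complex_topology G"
  assume "infinite (P \<inter> Z)"
  then have "P \<inter> ?X derived_set_of (P \<inter> Z) \<noteq> {}"
    using compactin_imp_Bolzano_Weierstrass[OF assms(1)] by blast
  then obtain p where p: "p \<in> ?X derived_set_of Z"
    using derived_set_of_mono[of "P \<inter> Z" Z ?X] by blast
  have "openin ?X (points G - (Z - {p}))"
    unfolding openin_complex_topology complex_open_def
  proof (intro conjI allI impI)
    fix u v assume e: "{u, v} \<in> edges G"
    let ?F = "{t \<in> {0..1}. seg u v t \<in> Z}"
    have "inj_on (seg u v) ?F"
    proof (rule inj_onI)
      fix s t assume "seg u v s = seg u v t"
      then have "seg u v s v = seg u v t v" by simp
      then show "s = t" using edge_vertsD(3)[OF e] by (simp add: seg_apply)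
    qed
    moreover have "seg u v ` ?F \<subseteq> Z \<inter> edge_points {u, v}" by (auto simp: edge_points_pair)
    ultimately have "finite ?F" using fin[OF e] inj_on_finite by blast
    then have "finite {t \<in> {0..1}. seg u v t \<in> Z - {p}}" by (rule rev_finite_subset) auto
    then have "open (- {t \<in> {0..1}. seg u v t \<in> Z - {p}})" by (simp add: finite_imp_closed open_Compl)
    then have "openin (top_of_set {0..1}) ({0..1} \<inter> - {t \<in> {0..1}. seg u v t \<in> Z - {p}})"
      by (rule openin_open_Int)
    moreover have "{0..1} \<inter> - {t \<in> {0..1}. seg u v t \<in> Z - {p}} = {t \<in> {0..1}. seg u v t \<in> points G - (Z - {p})}"
      using seg_in_points[OF e] by blast
    ultimately show "openin (top_of_set {0..1}) {t \<in> {0..1}. seg u v t \<in> points G - (Z - {p})}" by simp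
  qed auto
  moreover have "p \<in> points G - (Z - {p})" using p by (auto simp: derived_set_of_def)
  moreover have "\<forall>T. p \<in> T \<and> openin ?X T \<longrightarrow> (\<exists>y. y \<noteq> p \<and> y \<in> Z \<and> y \<in> T)"
    using p by (simp add: derived_set_of_def)
  ultimately obtain y where "y \<noteq> p" "y \<in> Z" "y \<in> points G - (Z - {p})"
    by metis
  then show False by blast
qed

lemma finite_if_disjoint_meet_finite:
  assumes "pairwise disjnt \<C>" "finite Y" "\<And>K. K \<in> \<C> \<Longrightarrow> K \<inter> Y \<noteq> {}"
  shows "finite \<C>"
proof -
  have "\<forall>K\<in>\<C>. \<exists>y. y \<in> K \<inter> Y" using assms(3) by blast
  then obtain f where f: "\<forall>K\<in>\<C>. f K \<in> K \<inter> Y" using bchoice[of \<C>] by metis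
  have "inj_on f \<C>"
  proof (rule inj_onI, rule ccontr)
    fix K K' assume K: "K \<in> \<C>" "K' \<in> \<C>" "f K = f K'" "K \<noteq> K'"
    then have "disjnt K K'" using assms(1) by (simp add: pairwise_def)
    moreover have "f K \<in> K \<inter> K'" using f K by auto
    ultimately show False by (auto simp: disjnt_def)
  qed
  then show ?thesis using inj_on_finite[of f \<C> Y] f assms(2) by auto
qed

section \<open>The length distance\<close>

locale weighted_graph = graph +
  fixes len :: "'a set \<Rightarrow> real"
  assumes len_pos: "e \<in> edges G \<Longrightarrow> 0 < len e"
begin

abbreviation (input) X where "X \<equiv> complex_topology G"
abbreviation \<kappa> where "\<kappa> \<equiv> edge_coord len"
abbreviation L where "L \<equiv> length_dist G len"

lemma edge_coord_seg:
  assumes "{u, v} \<in> edges G"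
  shows "(\<forall>t. \<kappa> {u, v} (seg u v t) = len {u, v} * t) \<or> (\<forall>t. \<kappa> {u, v} (seg u v t) = len {u, v} * (1 - t))"
proof -
  have "(SOME w. w \<in> {u, v}) \<in> {u, v}" by (rule someI[of _ u]) simp
  then consider "(SOME w. w \<in> {u, v}) = u" | "(SOME w. w \<in> {u, v}) = v" by blast
  then show ?thesis
    using edge_vertsD(3)[OF assms] by cases (auto simp: edge_coord_def seg_apply)
qed

lemma edge_coord_diff:
  assumes "{u, v} \<in> edges G"
  shows "\<bar>\<kappa> {u, v} (seg u v s) - \<kappa> {u, v} (seg u v t)\<bar> = len {u, v} * \<bar>s - t\<bar>"
proof -
  have "len {u, v} * s - len {u, v} * t = len {u, v} * (s - t)"
    "len {u, v} * (1 - s) - len {u, v} * (1 - t) = len {u, v} * (t - s)" by (simp_all add: algebra_simps)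
  then show ?thesis using edge_coord_seg[OF assms] len_pos[OF assms] by (auto simp: abs_mult)
qed

lemma inj_on_edge_coord: "e \<in> edges G \<Longrightarrow> inj_on (\<kappa> e) (edge_points e)"
proof -
  assume e: "e \<in> edges G"
  obtain u v where uv: "e = {u, v}" using simple_graph_edgeE[OF simple e] by metis
  have "s = t" if "\<kappa> e (seg u v s) = \<kappa> e (seg u v t)" for s t
    using edge_coord_diff[of u v s t] len_pos[of e] that uv e by auto
  then show ?thesis by (auto simp: uv edge_points_pair inj_on_def)
qed

lemma continuous_map_edge_coord: "continuous_map X euclideanreal (\<kappa> e)"
  unfolding edge_coord_def
  by (rule continuous_map_real_mult_left, rule continuous_map_coordinate)

lemma compactin_edge_points: "e \<in> edges G \<Longrightarrow> compactin X (edge_points e)"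
proof -
  assume e: "e \<in> edges G"
  obtain u v where uv: "e = {u, v}" using simple_graph_edgeE[OF simple e] by metis
  then show ?thesis
    using image_compactin[OF _ continuous_map_seg[of u v G], of "{0..1}"] e
    by (simp add: compactin_subtopology edge_points_pair)
qed

lemma closedin_edge_points: "e \<in> edges G \<Longrightarrow> closedin X (edge_points e)"
  using compactin_edge_points compactin_imp_closedin[OF Hausdorff_complex] by blast

lemma compactin_Int_edge_points: "compactin X P \<Longrightarrow> e \<in> edges G \<Longrightarrow> compactin X (P \<inter> edge_points e)"
  by (metis Int_commute closed_Int_compactin closedin_edge_points)

lemma compact_edge_coord: "compactin X K \<Longrightarrow> compact (\<kappa> e ` K)"
  using image_compactin[OF _ continuous_map_edge_coord] by force

lemma inner_in_edge_points:
  assumes "e \<in> edges G" "e' \<in> edges G" "p \<in> inner e" "p \<in> edge_points e'"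
  shows "e = e'"
proof -
  obtain u v where uv: "e' = {u, v}" using simple_graph_edgeE[OF simple assms(2)] by metis
  then have "\<And>w. p w > 0 \<Longrightarrow> w \<in> e'" using assms(4) by (auto simp: edge_points_pair seg_apply split: if_splits)
  then have "e \<subseteq> e'" using assms(3) by (auto simp: inner_def)
  moreover have "card e = 2" "card e' = 2" using assms simple by (auto simp: simple_graph_def)
  ultimately show ?thesis by (metis card.infinite card_subset_eq zero_neq_numeral)
qed

definition edges_met where "edges_met P = {e \<in> edges G. inner e \<inter> P \<noteq> {}}"

text \<open>Choose one inner point of each edge that is met; every edge contains at most one of them.\<close>

lemma finite_edges_met: 
  assumes "compactin X P" shows "finite (edges_met P)"
proof -
  have "\<forall>e\<in>edges_met P. \<exists>z. z \<in> inner e \<inter> P" by (auto simp: edges_met_def)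
  then obtain z where z: "\<And>e. e \<in> edges_met P \<Longrightarrow> z e \<in> inner e \<inter> P"
    using bchoice[of "edges_met P"] by metis
  have met: "edges_met P \<subseteq> edges G" by (auto simp: edges_met_def)
  have "finite (z ` edges_met P \<inter> edge_points e)" if "e \<in> edges G" for e
  proof -
    have "z ` edges_met P \<inter> edge_points e \<subseteq> {z e}"
    proof
      fix p assume "p \<in> z ` edges_met P \<inter> edge_points e"
      then obtain e' where e': "e' \<in> edges_met P" "p = z e'" "z e' \<in> edge_points e" by blast
      then have "e' = e" using inner_in_edge_points[of e' e "z e'"] z met that by blast
      then show "p \<in> {z e}" using e' by simp
    qed
    then show ?thesis using finite_subset by blast
  qed
  moreover have "z ` edges_met P \<subseteq> points G" using z by (auto simp: inner_def)
  ultimately have "finite (P \<inter> z ` edges_met P)" using compactin_Int_finite[OF assms] by blast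
  moreover have "P \<inter> z ` edges_met P = z ` edges_met P" using z by auto
  moreover have "inj_on z (edges_met P)"
  proof (rule inj_onI)
    fix e e' assume e: "e \<in> edges_met P" "e' \<in> edges_met P" "z e = z e'"
    then have "z e \<in> inner e" "z e \<in> edge_points e'"
      using z[of e] z[of e'] inner_subset_edge_points[of e'] met by auto
    then show "e = e'" using inner_in_edge_points e met by blast
  qed
  ultimately show ?thesis by (metis finite_image_iff)
qed

lemma finite_vertices_met: 
  assumes "compactin X P" shows "finite (P \<inter> vertex ` verts G)"
proof (rule compactin_Int_finite[OF assms])
  fix e assume "e \<in> edges G"
  then obtain u v where uv: "e = {u, v}" using simple_graph_edgeE[OF simple] by metis
  have "vertex ` verts G \<inter> edge_points e \<subseteq> {vertex u, vertex v}"
  proof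
    fix p assume "p \<in> vertex ` verts G \<inter> edge_points e"
    then obtain w t where t: "vertex w = seg u v t" "p = vertex w" unfolding uv edge_points_pair by auto
    have "vertex w w = (1::real)" by (simp add: vertex_def)
    then have "w \<in> {u, v}" unfolding t(1) by (auto simp: seg_apply split: if_splits)
    then show "p \<in> {vertex u, vertex v}" using t(2) by auto
  qed
  then show "finite (vertex ` verts G \<inter> edge_points e)" using finite_subset by blast
qed (auto simp: points_def)

definition comps where
  "comps P e = connected_components_of (subtopology X (P \<inter> edge_points e))"

lemma comps_subset: "P \<subseteq> points G \<Longrightarrow> e \<in> edges G \<Longrightarrow> K \<in> comps P e \<Longrightarrow> K \<subseteq> P \<inter> edge_points e"
  using connected_components_of_subset[of K "subtopology X (P \<inter> edge_points e)"]
  by (auto simp: comps_def)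

lemma Union_comps: "P \<subseteq> points G \<Longrightarrow> e \<in> edges G \<Longrightarrow> \<Union> (comps P e) = P \<inter> edge_points e"
  unfolding comps_def Union_connected_components_of using edge_points_subset by auto

lemma comps_interval:
  assumes "compactin X P" "e \<in> edges G" "K \<in> comps P e"
  shows "connectedin X K" "compactin X K"
    "\<exists>a b. a \<le> b \<and> \<kappa> e ` K = {a..b}"
proof -
  show conn: "connectedin X K"
    using connectedin_connected_components_of[of K "subtopology X (P \<inter> edge_points e)"] assms(3)
    by (simp add: comps_def connectedin_subtopology)
  have "closedin (subtopology X (P \<inter> edge_points e)) K"
    using closedin_connected_components_of assms(3) unfolding comps_def by blast
  moreover have "compact_space (subtopology X (P \<inter> edge_points e))"
    using compactin_Int_edge_points[OF assms(1,2)] compact_space_subtopology by blast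
  ultimately show comp: "compactin X K"
    using closedin_compact_space compactin_subtopology by blast
  have "connected (\<kappa> e ` K)" 
    using connectedin_continuous_map_image[OF continuous_map_edge_coord conn] by simp
  moreover have "compact (\<kappa> e ` K)" by (rule compact_edge_coord[OF comp])
  ultimately obtain a b where "\<kappa> e ` K = {a..b}" using iffD1[OF connected_compact_interval_1, OF conjI] by metis
  moreover have "K \<noteq> {}"
    using nonempty_connected_components_of[of K "subtopology X (P \<inter> edge_points e)"] assms(3)
    by (simp add: comps_def)
  ultimately show "\<exists>a b. a \<le> b \<and> \<kappa> e ` K = {a..b}"
    by (metis atLeastatMost_empty_iff image_is_empty)
qed

text \<open>An arc can enter a component of its intersection with an edge only through an endpoint
  of that edge, unless it starts in it. So there are at most three such components.\<close>

lemma comps_meet: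
  assumes "is_arc X P x y" "e \<in> edges G" "K \<in> comps P e"
  shows "x \<in> K \<or> K \<inter> vertex ` e \<noteq> {}"
proof (rule ccontr)
  assume contr: "\<not> (x \<in> K \<or> K \<inter> vertex ` e \<noteq> {})"
  obtain a b g where g: "(a::real) \<le> b" "continuous_map (top_of_set {a..b}) X g"
    "inj_on g {a..b}" "P = g ` {a..b}" "g a = x" "g b = y"
    using assms(1) is_arc_iff_injective_path[OF Hausdorff_complex] by metis
  have P: "compactin X P" by (rule is_arc_compactin[OF Hausdorff_complex assms(1)])
  then have PG: "P \<subseteq> points G" using compactin_subset_topspace by fastforce
  have K: "K \<subseteq> P \<inter> edge_points e" by (rule comps_subset[OF PG assms(2,3)])
  define T where "T = {t \<in> {a..b}. g t \<in> K}"
  have "closedin X K" using comps_interval(2)[OF P assms(2,3)] compactin_imp_closedin[OF Hausdorff_complex] by blast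
  then have "closedin (top_of_set {a..b}) T"
    using closedin_continuous_map_preimage[OF g(2)] by (simp add: T_def)
  then have "compact T" by (metis closedin_compact compact_Icc)
  moreover have "K \<noteq> {}" using nonempty_connected_components_of assms(3) unfolding comps_def by blast
  then have "T \<noteq> {}" using K g(4) by (auto simp: T_def)
  ultimately obtain c where c: "c \<in> T" "\<And>t. t \<in> T \<Longrightarrow> c \<le> t"
    using compact_attains_inf[of T] by auto
  have "g c \<in> K" "c \<in> {a..b}" using c by (auto simp: T_def)
  then have "g c \<in> inner e" using contr edge_points_inner[OF assms(2)] K by blast
  have "c \<noteq> a" using contr \<open>g c \<in> K\<close> g(5) by auto
  have "openin (top_of_set {a..b}) {t \<in> topspace (top_of_set {a..b}). g t \<in> inner e}"
    by (rule openin_continuous_map_preimage[OF g(2) openin_inner[OF assms(2)]])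
  then obtain U where U: "open U" "{t \<in> {a..b}. g t \<in> inner e} = {a..b} \<inter> U"
    unfolding openin_open by auto
  then have "c \<in> U" using \<open>g c \<in> inner e\<close> \<open>c \<in> {a..b}\<close> by blast
  then obtain \<delta> where \<delta>: "\<delta> > 0" "cball c \<delta> \<subseteq> U" using U(1) open_contains_cball by blast
  define c' where "c' = max a (c - \<delta>)"
  have c': "c' < c" "a \<le> c'" using \<delta> \<open>c \<noteq> a\<close> \<open>c \<in> {a..b}\<close> by (auto simp: c'_def)
  have sub: "{c'..c} \<subseteq> {a..b}" using c' \<open>c \<in> {a..b}\<close> by auto
  have "{c'..c} \<subseteq> U" using \<delta> by (auto simp: c'_def subset_eq dist_real_def)
  then have gin: "g ` {c'..c} \<subseteq> inner e" using U(2) sub by blast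
  have "connectedin (top_of_set {a..b}) {c'..c}" using sub by (simp add: connectedin_subtopology)
  then have "connectedin X (g ` {c'..c})" using connectedin_continuous_map_image[OF g(2)] by blast
  moreover have "g ` {c'..c} \<subseteq> P \<inter> edge_points e"
    using gin inner_subset_edge_points[OF assms(2)] sub g(4) by blast
  ultimately have "connectedin (subtopology X (P \<inter> edge_points e)) (g ` {c'..c})"
    by (simp add: connectedin_subtopology)
  moreover have "\<not> disjnt K (g ` {c'..c})" using \<open>g c \<in> K\<close> c' by (auto simp: disjnt_iff)
  ultimately have "g ` {c'..c} \<subseteq> K"
    using connected_components_of_maximal assms(3) unfolding comps_def by blast
  then have "c' \<in> T" using c' sub by (auto simp: T_def)
  then show False using c(2) c'(1) by force
qed

lemma finite_comps:
  assumes "is_arc X P x y" "e \<in> edges G" shows "finite (comps P e)"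
proof (rule finite_if_disjoint_meet_finite)
  show "pairwise disjnt (comps P e)" unfolding comps_def by (rule pairwise_disjoint_connected_components_of)
  obtain u v where "e = {u, v}" using simple_graph_edgeE[OF simple assms(2)] by metis
  then show "finite (insert x (vertex ` e))" by simp
  show "K \<inter> insert x (vertex ` e) \<noteq> {}" if "K \<in> comps P e" for K using comps_meet[OF assms that] by auto
qed

definition trace_measure where
  "trace_measure P e = measure lborel (\<kappa> e ` (P \<inter> edge_points e))"

lemma trace_measure_fmeasurable:
  assumes "compactin X P" "e \<in> edges G" shows "\<kappa> e ` (P \<inter> edge_points e) \<in> fmeasurable lborel"
  by (rule fmeasurable_compact[OF compact_edge_coord[OF compactin_Int_edge_points[OF assms]]])

lemma trace_measure_eq_sum_comps:
  assumes "is_arc X P x y" "e \<in> edges G"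
  shows "trace_measure P e = (\<Sum>K\<in>comps P e. measure lborel (\<kappa> e ` K))"
proof -
  have P: "compactin X P" by (rule is_arc_compactin[OF Hausdorff_complex assms(1)])
  then have PG: "P \<subseteq> points G" using compactin_subset_topspace by fastforce
  have "\<kappa> e ` (P \<inter> edge_points e) = (\<Union>K\<in>comps P e. \<kappa> e ` K)"
    unfolding Union_comps[OF PG assms(2), symmetric] by blast
  moreover have "measure lborel (\<Union>K\<in>comps P e. \<kappa> e ` K) = (\<Sum>K\<in>comps P e. measure lborel (\<kappa> e ` K))"
  proof (rule measure_UNION')
    show "finite (comps P e)" by (rule finite_comps[OF assms])
    show "\<kappa> e ` K \<in> fmeasurable lborel" if "K \<in> comps P e" for K
      by (rule fmeasurable_compact[OF compact_edge_coord[OF comps_interval(2)[OF P assms(2) that]]])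
    show "pairwise (\<lambda>K K'. disjnt (\<kappa> e ` K) (\<kappa> e ` K')) (comps P e)"
    proof (rule pairwiseI)
      fix K K' assume K: "K \<in> comps P e" "K' \<in> comps P e" "K \<noteq> K'"
      have "pairwise disjnt (comps P e)" unfolding comps_def by (rule pairwise_disjoint_connected_components_of)
      from pairwiseD[OF this K] have "K \<inter> K' = {}" by (simp add: disjnt_def)
      moreover have "K \<subseteq> edge_points e" "K' \<subseteq> edge_points e" using comps_subset[OF PG assms(2)] K by auto
      ultimately have "\<kappa> e ` K \<inter> \<kappa> e ` K' = {}"
        using inj_on_image_Int[OF inj_on_edge_coord[OF assms(2)], of K K'] by simp
      then show "disjnt (\<kappa> e ` K) (\<kappa> e ` K')" by (simp add: disjnt_def)
    qed
  qed
  ultimately show ?thesis by (simp add: trace_measure_def)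
qed

text \<open>A component of the intersection of an arc with an edge corresponds to a compact interval, whose diameter is
  its measure. The trivial components, which are not counted as half-edges, have measure 0, and a nontrivial one contains
  an inner point of the edge. So it suffices to sum over a finite set of edges.\<close>

lemma arc_length_eq_sum_comps:
  assumes "is_arc X P x y" "finite F" "edges_met P \<subseteq> F" "F \<subseteq> edges G"
  shows "maximal_half_edges G P \<subseteq> Sigma F (comps P)"
    "arc_length G len P = (\<Sum>(e, K)\<in>Sigma F (comps P). measure lborel (\<kappa> e ` K))"
proof -
  have P: "compactin X P" by (rule is_arc_compactin[OF Hausdorff_complex assms(1)])
  then have PG: "P \<subseteq> points G" using compactin_subset_topspace by fastforce
  have M: "maximal_half_edges G P = {(e, K). e \<in> edges G \<and> K \<in> comps P e \<and> (\<nexists>p. K = {p})}"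
    by (simp add: maximal_half_edges_def comps_def)
  show sub: "maximal_half_edges G P \<subseteq> Sigma F (comps P)"
  proof
    fix x assume "x \<in> maximal_half_edges G P"
    then obtain e K where x: "x = (e, K)" "e \<in> edges G" "K \<in> comps P e" "\<nexists>p. K = {p}" unfolding M by blast
    obtain a b where ab: "a \<le> b" "\<kappa> e ` K = {a..b}" using comps_interval(3)[OF P x(2,3)] by blast
    have K: "K \<subseteq> P \<inter> edge_points e" by (rule comps_subset[OF PG x(2,3)])
    have "a \<noteq> b"
    proof
      assume "a = b"
      then have im: "\<kappa> e ` K = {a}" using ab by simp
      then obtain p where "p \<in> K" by blast
      moreover have "K \<subseteq> {p}"
      proof
        fix q assume q: "q \<in> K"
        have "\<kappa> e q = \<kappa> e p"
          using imageI[OF q, of "\<kappa> e"] imageI[OF \<open>p \<in> K\<close>, of "\<kappa> e"] unfolding im by simp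
        then have "q = p"
          by (rule inj_onD[OF inj_on_edge_coord[OF x(2)]]) (use q \<open>p \<in> K\<close> K in auto)
        then show "q \<in> {p}" by simp
      qed
      ultimately have "K = {p}" by (simp add: subset_singleton_iff) blast
      then show False using x(4) by blast
    qed
    then have "infinite (\<kappa> e ` K)" using ab by simp
    then have "infinite K" by blast
    moreover have "finite (vertex ` e)" using x(2) simple_graph_edgeE[OF simple] by (metis finite.emptyI finite_imageI finite_insert)
    ultimately have "\<not> K \<subseteq> vertex ` e" using finite_subset by blast
    then obtain p where "p \<in> K" "p \<notin> vertex ` e" by blast
    then have "p \<in> inner e \<inter> P" using edge_points_inner[OF x(2), of p] K by blast
    then have "e \<in> F" using x(2) assms(3) by (auto simp: edges_met_def)
    then show "x \<in> Sigma F (comps P)" using x by blast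
  qed
  have fin: "finite (Sigma F (comps P))"
    using assms(2,4) finite_comps[OF assms(1)] by (intro finite_SigmaI) auto
  show "arc_length G len P = (\<Sum>(e, K)\<in>Sigma F (comps P). measure lborel (\<kappa> e ` K))"
    unfolding arc_length_def
  proof (rule sum.mono_neutral_cong_left[OF fin sub], safe)
    fix e K assume eK: "e \<in> F" "K \<in> comps P e" "(e, K) \<notin> maximal_half_edges G P"
    then obtain p where "K = {p}" unfolding M using assms(4) by blast
    then show "measure lborel (\<kappa> e ` K) = 0" by simp
  next
    fix e K assume "(e, K) \<in> maximal_half_edges G P"
    then have "e \<in> edges G" "K \<in> comps P e" unfolding M by auto
    then obtain a b where "a \<le> b" "\<kappa> e ` K = {a..b}" using comps_interval(3)[OF P] by blast
    then show "half_edge_length len e K = measure lborel (\<kappa> e ` K)"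
      by (simp add: half_edge_length_def)
  qed
qed

lemma arc_length_eq_trace_measure:
  assumes "is_arc X P x y" "finite F" "edges_met P \<subseteq> F" "F \<subseteq> edges G"
  shows "arc_length G len P = (\<Sum>e\<in>F. trace_measure P e)"
proof -
  have "arc_length G len P = (\<Sum>e\<in>F. \<Sum>K\<in>comps P e. measure lborel (\<kappa> e ` K))"
    unfolding arc_length_eq_sum_comps(2)[OF assms]
    using assms(2,4) finite_comps[OF assms(1)] by (subst sum.Sigma) auto
  also have "\<dots> = (\<Sum>e\<in>F. trace_measure P e)"
    using assms(4) trace_measure_eq_sum_comps[OF assms(1)] by (intro sum.cong) auto
  finally show ?thesis .
qed

lemma edges_met_subset: "edges_met P \<subseteq> edges G"
  by (auto simp: edges_met_def)

lemma arc_length_nonneg: assumes "is_arc X P x y" shows "0 \<le> arc_length G len P"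
  unfolding arc_length_eq_trace_measure[OF assms finite_edges_met[OF is_arc_compactin[OF Hausdorff_complex assms]] order_refl edges_met_subset]
  by (intro sum_nonneg) (simp add: trace_measure_def)

lemma arc_length_subadditive:
  assumes arcs: "is_arc X P x y" "is_arc X P' x' y'" "is_arc X Q z w" and sub: "Q \<subseteq> P \<union> P'"
  shows "arc_length G len Q \<le> arc_length G len P + arc_length G len P'"
proof -
  note comp = arcs[THEN is_arc_compactin[OF Hausdorff_complex]]
  define F where "F = edges_met P \<union> edges_met P' \<union> edges_met Q"
  have F: "finite F" "F \<subseteq> edges G" using comp[THEN finite_edges_met] edges_met_subset by (auto simp: F_def)
  have "trace_measure Q e \<le> trace_measure P e + trace_measure P' e" if "e \<in> F" for e
  proof -
    have e: "e \<in> edges G" using that F by blast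
    note fm = comp[THEN trace_measure_fmeasurable[OF _ e]]
    have "trace_measure Q e \<le> measure lborel (\<kappa> e ` (P \<inter> edge_points e) \<union> \<kappa> e ` (P' \<inter> edge_points e))"
      unfolding trace_measure_def using fm sub by (intro measure_mono_fmeasurable) (auto intro: fmeasurableD)
    also have "\<dots> \<le> trace_measure P e + trace_measure P' e"
      unfolding trace_measure_def using fm by (intro measure_Un_le) (auto intro: fmeasurableD)
    finally show ?thesis .
  qed
  then have "(\<Sum>e\<in>F. trace_measure Q e) \<le> (\<Sum>e\<in>F. trace_measure P e + trace_measure P' e)"
    by (rule sum_mono)
  also have "\<dots> = (\<Sum>e\<in>F. trace_measure P e) + (\<Sum>e\<in>F. trace_measure P' e)" by (rule sum.distrib)
  also have "(\<Sum>e\<in>F. trace_measure Q e) = arc_length G len Q"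
    by (rule arc_length_eq_trace_measure[OF arcs(3) F(1) _ F(2), symmetric]) (auto simp: F_def)
  also have "(\<Sum>e\<in>F. trace_measure P e) = arc_length G len P"
    by (rule arc_length_eq_trace_measure[OF arcs(1) F(1) _ F(2), symmetric]) (auto simp: F_def)
  also have "(\<Sum>e\<in>F. trace_measure P' e) = arc_length G len P'"
    by (rule arc_length_eq_trace_measure[OF arcs(2) F(1) _ F(2), symmetric]) (auto simp: F_def)
  finally show ?thesis .
qed

lemma edge_arc:
  assumes "e \<in> edges G" "p \<in> edge_points e" "q \<in> edge_points e"
  obtains P where "is_arc X P p q" "arc_length G len P \<le> \<bar>\<kappa> e p - \<kappa> e q\<bar>"
proof -
  obtain u v where uv: "e = {u, v}" using simple_graph_edgeE[OF simple assms(1)] by metis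
  have e: "{u, v} \<in> edges G" using assms(1) uv by simp
  have "\<exists>P. is_arc X P (seg u v s) (seg u v t) \<and> arc_length G len P \<le> \<bar>\<kappa> e (seg u v s) - \<kappa> e (seg u v t)\<bar>"
    if st: "0 \<le> s" "s \<le> t" "t \<le> 1" for s t
  proof -
    let ?P = "seg u v ` {s..t}"
    have sub: "{s..t} \<subseteq> {0..1}" using st by auto
    have "continuous_map (top_of_set {s..t}) X (seg u v)"
      by (rule continuous_map_from_subtopology_mono[OF continuous_map_seg[OF e] sub])
    moreover have "inj_on (seg u v) {s..t}"
    proof (rule inj_onI)
      fix a b assume "seg u v a = seg u v b"
      then have "seg u v a v = seg u v b v" by simp
      then show "a = b" using edge_vertsD(3)[OF e] by (simp add: seg_apply)
    qed
    ultimately have arc: "is_arc X ?P (seg u v s) (seg u v t)"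
      unfolding is_arc_iff_injective_path[OF Hausdorff_complex]
      by (intro exI[of _ s] exI[of _ t] exI[of _ "seg u v"] conjI) (use st in auto)
    have Pe: "?P \<subseteq> edge_points e" using sub by (auto simp: uv edge_points_pair)
    have met: "edges_met ?P \<subseteq> {e}"
    proof
      fix e' assume "e' \<in> edges_met ?P"
      then obtain p where p: "e' \<in> edges G" "p \<in> inner e'" "p \<in> ?P" unfolding edges_met_def by blast
      then have "p \<in> edge_points e" using Pe by blast
      then show "e' \<in> {e}" using inner_in_edge_points[OF p(1) assms(1) p(2)] by simp
    qed
    have "arc_length G len ?P = trace_measure ?P e"
      using arc_length_eq_trace_measure[OF arc _ met] assms(1) by simp
    also have "\<dots> \<le> measure lborel {min (\<kappa> e (seg u v s)) (\<kappa> e (seg u v t)) .. max (\<kappa> e (seg u v s)) (\<kappa> e (seg u v t))}"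
      unfolding trace_measure_def
    proof (rule measure_mono_fmeasurable)
      show "\<kappa> e ` (?P \<inter> edge_points e) \<in> sets lborel"
        using trace_measure_fmeasurable[OF is_arc_compactin[OF Hausdorff_complex arc] assms(1)]
        by (rule fmeasurableD)
      have "\<kappa> e (seg u v r) \<in> {min (\<kappa> e (seg u v s)) (\<kappa> e (seg u v t)) .. max (\<kappa> e (seg u v s)) (\<kappa> e (seg u v t))}"
        if r: "s \<le> r" "r \<le> t" for r
      proof -
        have mono: "len e * s \<le> len e * r" "len e * r \<le> len e * t"
            "len e * (1 - r) \<le> len e * (1 - s)" "len e * (1 - t) \<le> len e * (1 - r)"
          using r len_pos[OF assms(1)] by (auto intro!: mult_left_mono)
        from edge_coord_seg[OF e] consider "\<forall>t. \<kappa> e (seg u v t) = len e * t"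
          | "\<forall>t. \<kappa> e (seg u v t) = len e * (1 - t)" unfolding uv by blast
        then show ?thesis
        proof cases
          case 1
          then have "\<kappa> e (seg u v s) \<le> \<kappa> e (seg u v r)" "\<kappa> e (seg u v r) \<le> \<kappa> e (seg u v t)" using mono by simp_all
          then show ?thesis by (simp add: min_def max_def)
        next
          case 2
          then have "\<kappa> e (seg u v r) \<le> \<kappa> e (seg u v s)" "\<kappa> e (seg u v t) \<le> \<kappa> e (seg u v r)" using mono by simp_all
          then show ?thesis by (simp add: min_def max_def)
        qed
      qed
      then show "\<kappa> e ` (?P \<inter> edge_points e) \<subseteq> {min (\<kappa> e (seg u v s)) (\<kappa> e (seg u v t)) .. max (\<kappa> e (seg u v s)) (\<kappa> e (seg u v t))}"
        by auto
    qed (rule fmeasurable_compact, rule compact_Icc)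
    also have "\<dots> = \<bar>\<kappa> e (seg u v s) - \<kappa> e (seg u v t)\<bar>" by (simp add: min_def max_def)
    finally show ?thesis using arc by blast
  qed note oriented = this
  obtain s t where st: "p = seg u v s" "q = seg u v t" "s \<in> {0..1}" "t \<in> {0..1}"
    using assms(2,3) unfolding uv edge_points_pair by blast
  show ?thesis
  proof (cases "s \<le> t")
    case True
    then show ?thesis using oriented[of s t] st that by auto
  next
    case False
    then obtain P where "is_arc X P q p" "arc_length G len P \<le> \<bar>\<kappa> e q - \<kappa> e p\<bar>"
      using oriented[of t s] st by auto
    then show ?thesis using that is_arc_sym[OF Hausdorff_complex] by (metis abs_minus_commute)
  qed
qed

definition edge_contraction :: "(('a \<Rightarrow> real) \<Rightarrow> real) \<Rightarrow> bool" where
  "edge_contraction f \<longleftrightarrow>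
    (\<forall>e\<in>edges G. \<forall>p\<in>edge_points e. \<forall>q\<in>edge_points e. \<bar>f p - f q\<bar> \<le> \<bar>\<kappa> e p - \<kappa> e q\<bar>)"

lemma edge_contractionI:
  assumes "\<And>u v s t. {u, v} \<in> edges G \<Longrightarrow> \<bar>f (seg u v s) - f (seg u v t)\<bar> \<le> len {u, v} * \<bar>s - t\<bar>"
  shows "edge_contraction f"
  unfolding edge_contraction_def
proof (intro ballI)
  fix e p q assume e: "e \<in> edges G" and "p \<in> edge_points e" "q \<in> edge_points e"
  obtain u v where uv: "e = {u, v}" using simple_graph_edgeE[OF simple e] by metis
  then obtain s t where "p = seg u v s" "q = seg u v t" 
    using \<open>p \<in> edge_points e\<close> \<open>q \<in> edge_points e\<close> unfolding uv edge_points_pair by blast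
  then show "\<bar>f p - f q\<bar> \<le> \<bar>\<kappa> e p - \<kappa> e q\<bar>"
    using assms[of u v s t] edge_coord_diff[of u v s t] uv e by simp
qed

lemma edge_contraction_continuous:
  assumes "edge_contraction f" shows "continuous_map X euclideanreal f"
proof (rule continuous_map_on_complex)
  fix u v assume e: "{u, v} \<in> edges G"
  have "continuous_on {0..1} (\<lambda>t. f (seg u v t))"
  proof (rule continuous_on_eq_continuous_within[THEN iffD2], rule ballI)
    fix t :: real assume t: "t \<in> {0..1}"
    have "((\<lambda>s. len {u, v} * \<bar>s - t\<bar>) \<longlongrightarrow> len {u, v} * \<bar>t - t\<bar>) (at t within {0..1})"
      by (intro tendsto_intros)
    then have lim: "((\<lambda>s. len {u, v} * \<bar>s - t\<bar>) \<longlongrightarrow> 0) (at t within {0..1})" by simp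
    have "\<forall>\<^sub>F s in at t within {0..1}. norm (f (seg u v s) - f (seg u v t)) \<le> len {u, v} * \<bar>s - t\<bar>"
      unfolding eventually_at_filter
    proof (rule always_eventually, intro allI impI)
      fix s :: real assume "s \<noteq> t" "s \<in> {0..1}"
      then have "\<bar>f (seg u v s) - f (seg u v t)\<bar> \<le> \<bar>\<kappa> {u, v} (seg u v s) - \<kappa> {u, v} (seg u v t)\<bar>"
        using assms e t unfolding edge_contraction_def by (auto simp: edge_points_pair)
      then show "norm (f (seg u v s) - f (seg u v t)) \<le> len {u, v} * \<bar>s - t\<bar>"
        using edge_coord_diff[OF e] by simp
    qed
    from Lim_null_comparison[OF this lim] 
    have "((\<lambda>s. f (seg u v s) - f (seg u v t)) \<longlongrightarrow> 0) (at t within {0..1})" .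
    then have "((\<lambda>s. f (seg u v s)) \<longlongrightarrow> f (seg u v t)) (at t within {0..1})" by (simp add: LIM_zero_iff)
    then show "continuous (at t within {0..1}) (\<lambda>t. f (seg u v t))" by (simp add: continuous_within)
  qed
  then show "continuous_map (top_of_set {0..1}) euclideanreal (\<lambda>t. f (seg u v t))" by simp
qed simp

text \<open>Around an inner point of an edge, a nontrivial arc runs along that edge for a while. So no inner point gets lost
  by leaving out the trivial components.\<close>

lemma arc_inner_in_maximal_half_edge:
  assumes arc: "is_arc X P x y" "x \<noteq> y" and e: "e \<in> edges G" "p \<in> P" "p \<in> inner e"
  shows "\<exists>K. (e, K) \<in> maximal_half_edges G P \<and> p \<in> K"
proof -
  obtain a b g where g: "(a::real) \<le> b" "continuous_map (top_of_set {a..b}) X g"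
    "inj_on g {a..b}" "P = g ` {a..b}" "g a = x" "g b = y"
    using assms(1) is_arc_iff_injective_path[OF Hausdorff_complex] by metis
  have P: "compactin X P" by (rule is_arc_compactin[OF Hausdorff_complex arc(1)])
  then have PG: "P \<subseteq> points G" using compactin_subset_topspace by fastforce
  have ab: "a < b" using g(1,5,6) arc(2) by (cases "a = b") auto
  obtain c where c: "c \<in> {a..b}" "p = g c" using e(2) g(4) by blast
  have "openin (top_of_set {a..b}) {t \<in> topspace (top_of_set {a..b}). g t \<in> inner e}"
    by (rule openin_continuous_map_preimage[OF g(2) openin_inner[OF e(1)]])
  then obtain U where U: "open U" "{t \<in> {a..b}. g t \<in> inner e} = {a..b} \<inter> U"
    unfolding openin_open by auto
  then have "c \<in> U" using e(3) c by blast
  then obtain \<delta> where \<delta>: "\<delta> > 0" "cball c \<delta> \<subseteq> U" using U(1) open_contains_cball by blast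
  define I where "I = {max a (c - \<delta>)..min b (c + \<delta>)}"
  have sub: "I \<subseteq> {a..b}" "I \<subseteq> U" using \<delta> by (auto simp: I_def subset_eq dist_real_def)
  have cI: "c \<in> I" using c(1) \<delta> by (auto simp: I_def)
  obtain c' where c': "c' \<in> I" "c' \<noteq> c"
  proof (cases "c = a")
    case True
    then show ?thesis using that[of "min b (c + \<delta>)"] ab \<delta> by (auto simp: I_def)
  next
    case False
    then show ?thesis using that[of "max a (c - \<delta>)"] c(1) \<delta> by (auto simp: I_def)
  qed
  have gin: "g ` I \<subseteq> inner e" using U(2) sub by blast
  have "connectedin (top_of_set {a..b}) I" using sub(1) by (simp add: connectedin_subtopology I_def)
  then have "connectedin X (g ` I)" using connectedin_continuous_map_image[OF g(2)] by blast
  moreover have "g ` I \<subseteq> P \<inter> edge_points e"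
    using gin inner_subset_edge_points[OF e(1)] sub(1) g(4) by blast
  ultimately have conn: "connectedin (subtopology X (P \<inter> edge_points e)) (g ` I)"
    by (simp add: connectedin_subtopology)
  have "p \<in> P \<inter> edge_points e" using e inner_subset_edge_points by blast
  then obtain K where K: "K \<in> comps P e" "p \<in> K"
    unfolding Union_comps[OF PG e(1), symmetric] by blast
  have "\<not> disjnt K (g ` I)" using cI c K by (auto simp: disjnt_iff)
  then have "g ` I \<subseteq> K" using connected_components_of_maximal[OF _ conn] K unfolding comps_def by blast
  moreover have "g c' \<noteq> g c" using c' sub c(1) g(3) by (meson inj_onD subsetD)
  ultimately have "\<nexists>q. K = {q}" using cI c'(1) by blast
  then show ?thesis using K e(1) unfolding maximal_half_edges_def comps_def by blast
qed

text \<open>By connectedness the image of the arc covers the interval between \<open>f x\<close> and \<open>f y\<close>. Up to finitely many vertices,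
  the arc is the union of its maximal half-edges, and the image of each of them is an interval that is at most
  as long as the half-edge.\<close>

lemma edge_contraction_le_arc_length:
  assumes f: "edge_contraction f" and arc: "is_arc X P x y"
  shows "\<bar>f x - f y\<bar> \<le> arc_length G len P"
proof (cases "x = y")
  case True
  then show ?thesis using arc_length_nonneg[OF arc] by simp
next
  case False
  have P: "compactin X P" by (rule is_arc_compactin[OF Hausdorff_complex arc])
  then have PG: "P \<subseteq> points G" using compactin_subset_topspace by fastforce
  note fcont = edge_contraction_continuous[OF f]
  let ?M = "maximal_half_edges G P" and ?V = "P \<inter> vertex ` verts G"
  have fin: "finite ?M"
  proof -
    have "?M \<subseteq> Sigma (edges_met P) (comps P)"
      by (rule arc_length_eq_sum_comps(1)[OF arc finite_edges_met[OF P] order_refl edges_met_subset])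
    moreover have "finite (Sigma (edges_met P) (comps P))"
      using finite_edges_met[OF P] finite_comps[OF arc] edges_met_subset by (intro finite_SigmaI) auto
    ultimately show ?thesis by (rule finite_subset)
  qed
  have MD: "e \<in> edges G" "K \<in> comps P e" if "(e, K) \<in> ?M" for e K
    using that by (auto simp: maximal_half_edges_def comps_def)
  have piece: "f ` K \<in> fmeasurable lborel" "measure lborel (f ` K) \<le> half_edge_length len e K"
    if "(e, K) \<in> ?M" for e K
  proof -
    note ci = comps_interval[OF P MD[OF that]]
    have "compact (f ` K)" using image_compactin[OF ci(2) fcont] by simp
    then show "f ` K \<in> fmeasurable lborel" by (rule fmeasurable_compact)
    have "connected (f ` K)" using connectedin_continuous_map_image[OF fcont ci(1)] by simp
    then obtain a b where ab: "f ` K = {a..b}" using \<open>compact (f ` K)\<close> connected_compact_interval_1 by metis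
    obtain c d where cd: "c \<le> d" "\<kappa> e ` K = {c..d}" using ci(3) by blast
    have "K \<noteq> {}" using cd by force
    then have "a \<le> b" using ab by (metis atLeastatMost_empty_iff image_is_empty)
    then obtain p q where pq: "p \<in> K" "q \<in> K" "f p = a" "f q = b"
      using ab by (metis atLeastAtMost_iff imageE order_refl)
    have "p \<in> edge_points e" "q \<in> edge_points e" using pq comps_subset[OF PG MD[OF that]] by auto
    then have "\<bar>a - b\<bar> \<le> \<bar>\<kappa> e p - \<kappa> e q\<bar>" 
      using f MD(1)[OF that] pq unfolding edge_contraction_def by blast
    moreover have "\<kappa> e p \<in> {c..d}" "\<kappa> e q \<in> {c..d}" using cd pq by blast+
    ultimately have "b - a \<le> d - c" by auto
    then show "measure lborel (f ` K) \<le> half_edge_length len e K"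
      using ab cd \<open>a \<le> b\<close> by (simp add: half_edge_length_def)
  qed
  have cover: "P \<subseteq> (\<Union>(e, K)\<in>?M. K) \<union> ?V"
  proof
    fix p assume p: "p \<in> P"
    then consider "p \<in> vertex ` verts G" | e where "e \<in> edges G" "p \<in> inner e"
      using points_vertex_or_inner PG by blast
    then show "p \<in> (\<Union>(e, K)\<in>?M. K) \<union> ?V"
    proof cases
      case 2
      then show ?thesis using arc_inner_in_maximal_half_edge[OF arc False 2(1) p 2(2)] by blast
    qed (use p in blast)
  qed
  obtain a b g where g: "(a::real) \<le> b" "continuous_map (top_of_set {a..b}) X g"
    "inj_on g {a..b}" "P = g ` {a..b}" "g a = x" "g b = y"
    using arc is_arc_iff_injective_path[OF Hausdorff_complex] by metis
  have "connectedin (top_of_set {a..b}) {a..b}" by (simp add: connectedin_subtopology)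
  then have "connectedin X P" using connectedin_continuous_map_image[OF g(2)] g(4) by blast
  then have "connected (f ` P)" using connectedin_continuous_map_image[OF fcont] by simp
  moreover have "f x \<in> f ` P" "f y \<in> f ` P" using is_arc_endpoints[OF Hausdorff_complex arc] by auto
  ultimately have between: "{min (f x) (f y)..max (f x) (f y)} \<subseteq> f ` P"
    by (auto simp: connected_contains_Icc min_def max_def)
  let ?U = "(\<Union>(e, K)\<in>?M. f ` K) \<union> f ` ?V"
  have fmV: "f ` ?V \<in> fmeasurable lborel" using finite_vertices_met[OF P] by (intro fmeasurable_compact finite_imp_compact) simp
  have fmM: "(\<Union>(e, K)\<in>?M. f ` K) \<in> fmeasurable lborel"
    using fin piece(1) by (intro fmeasurable.finite_UN) auto
  have "\<bar>f x - f y\<bar> = measure lborel {min (f x) (f y)..max (f x) (f y)}" by (simp add: min_def max_def)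
  also have "\<dots> \<le> measure lborel ?U"
  proof (rule measure_mono_fmeasurable)
    have "f ` P \<subseteq> f ` ((\<Union>(e, K)\<in>?M. K) \<union> ?V)" by (rule image_mono[OF cover])
    also have "\<dots> = ?U" by (simp add: image_Un image_UN case_prod_beta)
    finally show "{min (f x) (f y)..max (f x) (f y)} \<subseteq> ?U" using between by (rule order_trans[rotated])
    show "?U \<in> fmeasurable lborel" by (rule fmeasurable.Un[OF fmM fmV])
  qed simp
  also have "\<dots> \<le> measure lborel (\<Union>(e, K)\<in>?M. f ` K) + measure lborel (f ` ?V)"
    using fmV fmM by (intro measure_Un_le fmeasurableD)
  also have "measure lborel (f ` ?V) = 0"
    using finite_vertices_met[OF P] by (simp add: measure_def emeasure_lborel_countable countable_finite)
  also have "measure lborel (\<Union>(e, K)\<in>?M. f ` K) \<le> (\<Sum>(e, K)\<in>?M. measure lborel (f ` K))"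
  proof -
    have "measure lborel (\<Union>x\<in>?M. f ` snd x) \<le> (\<Sum>x\<in>?M. measure lborel (f ` snd x))"
      by (rule measure_UNION_le[OF fin], rule fmeasurableD) (use piece(1) in force)
    then show ?thesis by (simp add: case_prod_beta)
  qed
  also have "\<dots> \<le> (\<Sum>(e, K)\<in>?M. half_edge_length len e K)"
    using piece(2) by (intro sum_mono) auto
  finally show ?thesis by (simp add: arc_length_def)
qed

end

lemma connected_graph_simple: "connected_graph G \<Longrightarrow> simple_graph G"
  by (simp add: connected_graph_def)

locale weighted_connected_graph =
  fixes G :: "'a ugraph" and len :: "'a set \<Rightarrow> real"
  assumes connected: "connected_graph G"
    and len_pos': "e \<in> edges G \<Longrightarrow> 0 < len e"

sublocale weighted_connected_graph \<subseteq> weighted_graph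
  by unfold_locales (use connected connected_graph_simple len_pos' in auto)

context weighted_connected_graph
begin

lemma arc_exists:
  assumes "x \<in> points G" "y \<in> points G"
  obtains P where "is_arc X P x y"
proof -
  have vert: "\<exists>P. is_arc X P (vertex u) (vertex v)" if "u \<in> verts G" "v \<in> verts G" for u v
  proof -
    have "reach G {} u v" using connected that by (simp add: connected_graph_def)
    then have "(\<lambda>x y. {x, y} \<in> edges G)\<^sup>*\<^sup>* u v" by (simp add: reach_def)
    then show ?thesis
    proof induction
      case base
      have "is_arc X {vertex u} (vertex u) (vertex u)" using that by (simp add: is_arc_def vertex_in_points)
      then show ?case by blast
    next
      case (step w z)
      obtain P where P: "is_arc X P (vertex u) (vertex w)" using step.IH by blast
      have "vertex w \<in> edge_points {w, z}" "vertex z \<in> edge_points {w, z}"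
        using imageI[of 0 "{0..1}" "seg w z"] imageI[of 1 "{0..1}" "seg w z"] by (simp_all add: edge_points_pair)
      then obtain Q where "is_arc X Q (vertex w) (vertex z)" using edge_arc[OF step.hyps(2)] by metis
      from is_arc_join[OF Hausdorff_complex P this] show ?case by metis
    qed
  qed
  have to_vert: "\<exists>P. \<exists>v\<in>verts G. is_arc X P p (vertex v)" if "p \<in> points G" for p
    using that
  proof (cases rule: points_cases)
    case (1 v)
    then have "is_arc X {p} p (vertex v)" using that by (simp add: is_arc_def)
    then show ?thesis using 1 by blast
  next
    case (2 u v t)
    have "p \<in> edge_points {u, v}" "vertex u \<in> edge_points {u, v}"
      using 2 imageI[of 0 "{0..1}" "seg u v"] by (simp_all add: edge_points_pair)
    then obtain Q where "is_arc X Q p (vertex u)" using edge_arc[OF 2(1)] by metis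
    then show ?thesis using edge_vertsD(1)[OF 2(1)] by blast
  qed
  obtain P u where P: "u \<in> verts G" "is_arc X P x (vertex u)" using to_vert[OF assms(1)] by blast
  obtain Q v where Q: "v \<in> verts G" "is_arc X Q y (vertex v)" using to_vert[OF assms(2)] by blast
  obtain R where R: "is_arc X R (vertex u) (vertex v)" using vert P(1) Q(1) by blast
  obtain R' where R': "is_arc X R' x (vertex v)" using is_arc_join[OF Hausdorff_complex P(2) R] by metis
  obtain R'' where "is_arc X R'' x y"
    using is_arc_join[OF Hausdorff_complex R' is_arc_sym[OF Hausdorff_complex Q(2)]] by metis
  then show ?thesis by (rule that)
qed

lemma L_le: assumes "is_arc X P x y" shows "L x y \<le> arc_length G len P"
proof -
  have "P \<subseteq> points G" using compactin_subset_topspace[OF is_arc_compactin[OF Hausdorff_complex assms]] by simp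
  then have xy: "x \<in> points G" "y \<in> points G" using is_arc_endpoints[OF Hausdorff_complex assms] by auto
  have "Inf {arc_length G len P |P. is_arc X P x y} \<le> arc_length G len P"
  proof (rule cInf_lower)
    show "bdd_below {arc_length G len P |P. is_arc X P x y}"
      by (rule bdd_belowI[of _ 0]) (auto intro: arc_length_nonneg)
  qed (use assms in blast)
  then show ?thesis using xy by (simp add: length_dist_def)
qed

lemma L_approx:
  assumes "x \<in> points G" "y \<in> points G" "L x y < r"
  obtains P where "is_arc X P x y" "arc_length G len P < r"
proof -
  obtain Q where "is_arc X Q x y" by (rule arc_exists[OF assms(1,2)])
  then have ne: "{arc_length G len P |P. is_arc X P x y} \<noteq> {}" by blast
  have "Inf {arc_length G len P |P. is_arc X P x y} < r" using assms by (simp add: length_dist_def)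
  from cInf_lessD[OF ne this] show ?thesis using that by blast
qed

lemma L_greatest:
  assumes "x \<in> points G" "y \<in> points G" "\<And>P. is_arc X P x y \<Longrightarrow> c \<le> arc_length G len P"
  shows "c \<le> L x y"
proof (rule ccontr)
  assume "\<not> c \<le> L x y"
  then have "L x y < c" by simp
  then obtain P where "is_arc X P x y" "arc_length G len P < c" by (rule L_approx[OF assms(1,2)])
  then show False using assms(3)[of P] by simp
qed

lemma L_nonneg: "0 \<le> L x y"
  using L_greatest[of x y 0] arc_length_nonneg by (cases "x \<in> points G \<and> y \<in> points G") (auto simp: length_dist_def)

lemma L_sym: "L x y = L y x"
proof -
  have "is_arc X P x y \<longleftrightarrow> is_arc X P y x" for P using is_arc_sym[OF Hausdorff_complex] by blast
  then show ?thesis by (auto simp: length_dist_def)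
qed

lemma L_triangle:
  assumes "x \<in> points G" "y \<in> points G" "z \<in> points G"
  shows "L x z \<le> L x y + L y z"
proof (rule field_le_epsilon)
  fix \<epsilon> :: real assume "\<epsilon> > 0"
  then have less: "L x y < L x y + \<epsilon>/2" "L y z < L y z + \<epsilon>/2" by simp_all
  obtain P where P: "is_arc X P x y" "arc_length G len P < L x y + \<epsilon>/2"
    by (rule L_approx[OF assms(1,2) less(1)])
  obtain Q where Q: "is_arc X Q y z" "arc_length G len Q < L y z + \<epsilon>/2"
    by (rule L_approx[OF assms(2,3) less(2)])
  obtain R where R: "is_arc X R x z" "R \<subseteq> P \<union> Q" by (rule is_arc_join[OF Hausdorff_complex P(1) Q(1)])
  have "L x z \<le> arc_length G len R" by (rule L_le[OF R(1)])
  also have "\<dots> \<le> arc_length G len P + arc_length G len Q"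
    by (rule arc_length_subadditive[OF P(1) Q(1) R])
  finally show "L x z \<le> L x y + L y z + \<epsilon>" using P Q by linarith
qed

lemma L_seg:
  assumes e: "{u, v} \<in> edges G" and st: "s \<in> {0..1}" "t \<in> {0..1}"
  shows "L (seg u v s) (seg u v t) \<le> len {u, v} * \<bar>s - t\<bar>"
proof -
  have "seg u v s \<in> edge_points {u, v}" "seg u v t \<in> edge_points {u, v}" using st by (auto simp: edge_points_pair)
  then obtain P where P: "is_arc X P (seg u v s) (seg u v t)"
    "arc_length G len P \<le> \<bar>\<kappa> {u, v} (seg u v s) - \<kappa> {u, v} (seg u v t)\<bar>"
    by (rule edge_arc[OF e])
  show ?thesis using L_le[OF P(1)] P(2) edge_coord_diff[OF e, of s t] by simp
qed

lemma L_edge: "{u, v} \<in> edges G \<Longrightarrow> L (vertex u) (vertex v) \<le> len {u, v}"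
  using L_seg[of u v 0 1] by simp

lemma L_refl: assumes "x \<in> points G" shows "L x x = 0"
proof -
  have arc: "is_arc X {x} x x" using assms by (simp add: is_arc_def)
  have "K = {x}" if "K \<in> connected_components_of (subtopology X ({x} \<inter> edge_points e))" for e K
    using connected_components_of_subset[OF that] nonempty_connected_components_of[OF that] by auto
  then have "maximal_half_edges G {x} = {}" unfolding maximal_half_edges_def by blast
  then have "arc_length G len {x} = 0" by (simp add: arc_length_def)
  then show ?thesis using L_le[OF arc] L_nonneg[of x x] by simp
qed

lemma L_contraction:
  assumes "edge_contraction f" "x \<in> points G" "y \<in> points G" shows "\<bar>f x - f y\<bar> \<le> L x y"
  using L_greatest[OF assms(2,3)] edge_contraction_le_arc_length[OF assms(1)] by blast

text \<open>Lower bounds for distances come from two families of contractions: multiples of the mass of a vertex set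
  all of whose leaving edges are long, and bump functions supported by a single edge.\<close>

lemma L_ge_mass:
  assumes "\<And>u v. {u, v} \<in> edges G \<Longrightarrow> u \<in> A \<Longrightarrow> v \<notin> A \<Longrightarrow> \<delta> \<le> len {u, v}"
    and "0 \<le> \<delta>" "x \<in> points G" "y \<in> points G"
  shows "\<delta> * \<bar>mass A x - mass A y\<bar> \<le> L x y"
proof -
  have "edge_contraction (\<lambda>p. \<delta> * mass A p)"
  proof (rule edge_contractionI)
    fix u v s t assume e: "{u, v} \<in> edges G"
    have "\<delta> * mass A (seg u v s) - \<delta> * mass A (seg u v t) = \<delta> * (of_bool (v \<in> A) - of_bool (u \<in> A)) * (s - t)"
      using edge_vertsD(3)[OF e] by (simp add: mass_seg algebra_simps)
    then have "\<bar>\<delta> * mass A (seg u v s) - \<delta> * mass A (seg u v t)\<bar> = \<delta> * of_bool ((u \<in> A) \<noteq> (v \<in> A)) * \<bar>s - t\<bar>"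
      using assms(2) by (auto simp: abs_mult)
    moreover have "\<delta> * of_bool ((u \<in> A) \<noteq> (v \<in> A)) \<le> len {u, v}"
      using assms(1)[of u v] assms(1)[of v u] e len_pos[OF e] by (auto simp: insert_commute)
    ultimately show "\<bar>\<delta> * mass A (seg u v s) - \<delta> * mass A (seg u v t)\<bar> \<le> len {u, v} * \<bar>s - t\<bar>"
      using mult_right_mono[of "\<delta> * of_bool ((u \<in> A) \<noteq> (v \<in> A))" "len {u, v}" "\<bar>s - t\<bar>"] by simp
  qed
  from L_contraction[OF this assms(3,4)] show ?thesis
    using assms(2) by (simp add: right_diff_distrib[symmetric] abs_mult)
qed

lemma L_ge_edge_bump:
  assumes e: "{u, w} \<in> edges G" and \<alpha>\<beta>: "0 \<le> \<alpha>" "\<alpha> \<le> len {u, w}" "0 \<le> \<beta>" "\<beta> \<le> len {u, w}"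
    and xy: "x \<in> points G" "y \<in> points G"
  shows "\<bar>min (\<alpha> * x u) (\<beta> * x w) - min (\<alpha> * y u) (\<beta> * y w)\<bar> \<le> L x y"
proof -
  have uw: "u \<noteq> w" using edge_vertsD(3)[OF e] .
  have min_diff: "\<bar>min a b - min c d\<bar> \<le> max \<bar>a - c\<bar> \<bar>b - d\<bar>" for a b c d :: real by linarith
  have "edge_contraction (\<lambda>p. min (\<alpha> * p u) (\<beta> * p w))" unfolding edge_contraction_def
  proof (intro ballI)
    fix e' p q assume e': "e' \<in> edges G" and pq: "p \<in> edge_points e'" "q \<in> edge_points e'"
    show "\<bar>min (\<alpha> * p u) (\<beta> * p w) - min (\<alpha> * q u) (\<beta> * q w)\<bar> \<le> \<bar>\<kappa> e' p - \<kappa> e' q\<bar>"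
    proof (cases "e' = {u, w}")
      case True
      then obtain s t where st: "p = seg u w s" "q = seg u w t" using pq unfolding True edge_points_pair by blast
      have "\<alpha> * p u - \<alpha> * q u = \<alpha> * (t - s)" "\<beta> * p w - \<beta> * q w = \<beta> * (s - t)"
        using uw unfolding st by (simp_all add: seg_apply algebra_simps)
      then have "\<bar>\<alpha> * p u - \<alpha> * q u\<bar> \<le> len {u, w} * \<bar>s - t\<bar>" "\<bar>\<beta> * p w - \<beta> * q w\<bar> \<le> len {u, w} * \<bar>s - t\<bar>"
        using \<alpha>\<beta> by (simp_all add: abs_mult abs_minus_commute[of t s] mult_right_mono)
      then have "\<bar>min (\<alpha> * p u) (\<beta> * p w) - min (\<alpha> * q u) (\<beta> * q w)\<bar> \<le> len {u, w} * \<bar>s - t\<bar>"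
        using min_diff[of "\<alpha> * p u" "\<beta> * p w" "\<alpha> * q u" "\<beta> * q w"] by linarith
      then show ?thesis using edge_coord_diff[OF e, of s t] st True by simp
    next
      case False
      have "min (\<alpha> * r u) (\<beta> * r w) = 0" if r: "r \<in> edge_points e'" for r
      proof -
        obtain a b where ab: "e' = {a, b}" using simple_graph_edgeE[OF simple e'] by metis
        have "r \<in> points G" using r edge_points_subset[OF e'] by blast
        then have nn: "0 \<le> r u" "0 \<le> r w" using points_nonneg by blast+
        have "r u = 0 \<or> r w = 0"
        proof (rule ccontr)
          assume "\<not> ?thesis"
          then have "u \<in> {a, b}" "w \<in> {a, b}" using r unfolding ab edge_points_pair
            by (auto simp: seg_apply split: if_splits)
          then show False using uw False ab by auto
        qed
        moreover have "0 \<le> \<alpha> * r u" "0 \<le> \<beta> * r w" using nn \<alpha>\<beta> by simp_all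
        ultimately show ?thesis by (auto simp: min_def)
      qed
      then show ?thesis using pq by simp
    qed
  qed
  from L_contraction[OF this xy] show ?thesis .
qed

text \<open>The bump function on the edge \<open>uw\<close> is scaled on both sides of \<open>x\<close> so that it attains its maximum only at \<open>x\<close>.
  Its value at \<open>y\<close> is the same, as it does not increase distances.\<close>

lemma L_zero_inner:
  assumes e: "{u, w} \<in> edges G" and x: "x \<in> points G" "x u > 0" "x w > 0"
    and y: "y \<in> points G" "L x y = 0"
  shows "x = y"
proof -
  have uw: "u \<noteq> w" using edge_vertsD(3)[OF e] .
  \<comment> \<open>The largest height for which the slopes \<open>c / x u\<close> and \<open>c / x w\<close> are at most the length of the edge.\<close>
  define c where "c = len {u, w} * min (x u) (x w)"
  have c: "c > 0" using len_pos[OF e] x by (simp add: c_def)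
  have "c \<le> len {u, w} * x u" "c \<le> len {u, w} * x w" 
    unfolding c_def using len_pos[OF e] by (auto intro!: mult_left_mono)
  then have b: "0 \<le> c / x u" "c / x u \<le> len {u, w}" "0 \<le> c / x w" "c / x w \<le> len {u, w}"
    using c x by (simp_all add: divide_simps mult.commute)
  have "min (c / x u * x u) (c / x w * x w) = min (c / x u * y u) (c / x w * y w)"
    using L_ge_edge_bump[OF e b x(1) y(1)] y(2) by linarith
  then have "c \<le> c / x u * y u" "c \<le> c / x w * y w" using x by auto
  then have ge: "x u \<le> y u" "x w \<le> y w" using c x by (simp_all add: divide_simps)
  note px = points_between[OF x uw] and py = points_between[OF y(1) _ _ uw]
  have pos: "0 < y u" "0 < y w" using ge x by auto
  have "y w = x w" using px(3) py(3)[OF pos] ge by linarith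
  then show ?thesis using px(2) py(2)[OF pos] by metis
qed

section \<open>The quotient metric space\<close>

abbreviation ident where "ident \<equiv> vertex_identification G len"

lemma ident_dist: "(x, y) \<in> ident \<Longrightarrow> L x y = 0"
  using L_refl by (auto simp: vertex_identification_def)

lemma L_cong: assumes "(x, x') \<in> ident" "(y, y') \<in> ident" shows "L x y = L x' y'"
proof -
  have pts: "x \<in> points G" "x' \<in> points G" "y \<in> points G" "y' \<in> points G" using assms by (auto simp: vertex_identification_def)
  have 0: "L x x' = 0" "L y y' = 0" "L x' x = 0" "L y' y = 0" using assms ident_dist L_sym by metis+
  show ?thesis
    using L_triangle[of x x' y] L_triangle[of x' y' y] L_triangle[of x' x y'] L_triangle[of x y y'] pts 0 by linarith
qed

lemma equiv_ident: "equiv (points G) ident"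
proof (rule equivI)
  show "ident \<subseteq> points G \<times> points G" by (auto simp: vertex_identification_def)
  show "refl_on (points G) ident" by (auto simp: vertex_identification_def refl_on_def)
  show "sym ident" using L_sym by (auto simp: vertex_identification_def sym_def)
  show "trans ident"
  proof (rule transI)
    fix x y z assume xyz: "(x, y) \<in> ident" "(y, z) \<in> ident"
    then have pts: "x \<in> points G" "y \<in> points G" "z \<in> points G" by (auto simp: vertex_identification_def)
    have "L x z = 0"
      using L_triangle[OF pts] ident_dist[OF xyz(1)] ident_dist[OF xyz(2)] L_nonneg[of x z] by linarith
    then show "(x, z) \<in> ident" using xyz pts by (auto simp: vertex_identification_def)
  qed
qed

lemma quotient_dist_class:
  assumes "x \<in> points G" "y \<in> points G"
  shows "quotient_dist G len (ident `` {x}) (ident `` {y}) = L x y"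
proof -
  have in_class: "(z, SOME w. w \<in> ident `` {z}) \<in> ident" if "z \<in> points G" for z
    using someI[of "\<lambda>w. w \<in> ident `` {z}" z] equiv_class_self[OF equiv_ident that] by simp
  show ?thesis
    unfolding quotient_dist_def using L_cong[OF in_class in_class] assms by simp
qed

lemma quotient_pointsE:
  assumes "A \<in> quotient_points G len" obtains x where "x \<in> points G" "A = ident `` {x}"
  using assms unfolding quotient_points_def by (rule quotientE)

text \<open>Distinct points at distance 0 are vertices, so that the identification of vertices turns the pseudometric into a metric.\<close>

lemma ident_iff: "x \<in> points G \<Longrightarrow> y \<in> points G \<Longrightarrow> (x, y) \<in> ident \<longleftrightarrow> L x y = 0"
proof
  assume xy: "x \<in> points G" "y \<in> points G" "L x y = 0"
  have inner_eq: "a = b" if "e \<in> edges G" "a \<in> inner e" "b \<in> points G" "L a b = 0" for a b e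
  proof -
    obtain u v where uv: "e = {u, v}" using simple_graph_edgeE[OF simple \<open>e \<in> edges G\<close>] by metis
    show ?thesis
      using L_zero_inner[of u v a b] that unfolding uv inner_def by auto
  qed
  consider "x \<in> vertex ` verts G" "y \<in> vertex ` verts G" | e where "e \<in> edges G" "x \<in> inner e"
    | e where "e \<in> edges G" "y \<in> inner e"
    using points_vertex_or_inner xy by blast
  then show "(x, y) \<in> ident"
  proof cases
    case 1
    then show ?thesis using xy by (simp add: vertex_identification_def)
  next
    case 2
    then show ?thesis using inner_eq[OF 2] xy by (simp add: vertex_identification_def)
  next
    case 3
    have "y = x" using inner_eq[OF 3 xy(1)] xy(3) L_sym[of x y] by simp
    then show ?thesis using xy by (simp add: vertex_identification_def)
  qed
qed (rule ident_dist)

lemma Metric_space_quotient: "Metric_space (quotient_points G len) (quotient_dist G len)"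
proof
  show "0 \<le> quotient_dist G len A B" for A B by (simp add: quotient_dist_def L_nonneg)
  show "quotient_dist G len A B = quotient_dist G len B A" for A B
    unfolding quotient_dist_def by (rule L_sym)
  show "quotient_dist G len A B = 0 \<longleftrightarrow> A = B"
    if AB: "A \<in> quotient_points G len" "B \<in> quotient_points G len" for A B
  proof -
    obtain x where x: "x \<in> points G" "A = ident `` {x}" by (rule quotient_pointsE[OF AB(1)])
    obtain y where y: "y \<in> points G" "B = ident `` {y}" by (rule quotient_pointsE[OF AB(2)])
    show ?thesis
      unfolding x(2) y(2) quotient_dist_class[OF x(1) y(1)] eq_equiv_class_iff[OF equiv_ident x(1) y(1)]
      using ident_iff[OF x(1) y(1)] by simp
  qed
  show "quotient_dist G len A C \<le> quotient_dist G len A B + quotient_dist G len B C"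
    if AB: "A \<in> quotient_points G len" "B \<in> quotient_points G len" "C \<in> quotient_points G len" for A B C
  proof -
    obtain x where x: "x \<in> points G" "A = ident `` {x}" by (rule quotient_pointsE[OF AB(1)])
    obtain y where y: "y \<in> points G" "B = ident `` {y}" by (rule quotient_pointsE[OF AB(2)])
    obtain z where z: "z \<in> points G" "C = ident `` {z}" by (rule quotient_pointsE[OF AB(3)])
    show ?thesis
      unfolding x(2) y(2) z(2) quotient_dist_class[OF x(1) y(1)] quotient_dist_class[OF x(1) z(1)]
        quotient_dist_class[OF y(1) z(1)]
      by (rule L_triangle[OF x(1) y(1) z(1)])
  qed
qed

end

section \<open>Completion by Cauchy sequences\<close>

context Metric_space
begin

abbreviation cauchy_class where "cauchy_class s \<equiv> cauchy_equiv M d `` {s}"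

lemma MCauchy_in: "MCauchy s \<Longrightarrow> s n \<in> M"
  by (auto simp: MCauchy_def)

lemma MCauchy_dist_convergent:
  assumes s: "MCauchy s" and t: "MCauchy t" shows "convergent (\<lambda>n. d (s n) (t n))"
proof -
  have "Cauchy (\<lambda>n. d (s n) (t n))"
  proof (rule metric_CauchyI)
    fix \<epsilon> :: real assume "\<epsilon> > 0"
    then have e2: "\<epsilon>/2 > 0" by simp
    obtain N1 where N1: "\<And>m n. N1 \<le> m \<Longrightarrow> N1 \<le> n \<Longrightarrow> d (s m) (s n) < \<epsilon>/2"
      using s e2 unfolding MCauchy_def by meson
    obtain N2 where N2: "\<And>m n. N2 \<le> m \<Longrightarrow> N2 \<le> n \<Longrightarrow> d (t m) (t n) < \<epsilon>/2"
      using t e2 unfolding MCauchy_def by meson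
    have "dist (d (s m) (t m)) (d (s n) (t n)) < \<epsilon>" if "m \<ge> max N1 N2" "n \<ge> max N1 N2" for m n
    proof -
      note M = MCauchy_in[OF s] MCauchy_in[OF t]
      have "d (s m) (s n) < \<epsilon>/2" "d (t m) (t n) < \<epsilon>/2" using that N1 N2 by auto
      then show ?thesis
        using triangle[OF M(1)[of m] M(1)[of n] M(2)[of m]] triangle[OF M(1)[of n] M(2)[of n] M(2)[of m]]
          triangle[OF M(1)[of n] M(1)[of m] M(2)[of n]] triangle[OF M(1)[of m] M(2)[of m] M(2)[of n]]
          commute[of "s m" "s n"] commute[of "t m" "t n"]
        unfolding dist_real_def by linarith
    qed
    then show "\<exists>N. \<forall>m\<ge>N. \<forall>n\<ge>N. dist (d (s m) (t m)) (d (s n) (t n)) < \<epsilon>" by blast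
  qed
  then show ?thesis by (simp add: Cauchy_convergent)
qed

lemma equiv_cauchy: "equiv {s. MCauchy s} (cauchy_equiv M d)"
proof (rule equivI)
  show "cauchy_equiv M d \<subseteq> {s. MCauchy s} \<times> {s. MCauchy s}" by (auto simp: cauchy_equiv_def)
  show "refl_on {s. MCauchy s} (cauchy_equiv M d)"
    by (auto simp: refl_on_def cauchy_equiv_def MCauchy_in)
  show "sym (cauchy_equiv M d)" by (auto simp: sym_def cauchy_equiv_def commute)
  show "trans (cauchy_equiv M d)"
  proof (rule transI)
    fix s t u assume "(s, t) \<in> cauchy_equiv M d" "(t, u) \<in> cauchy_equiv M d"
    then have C: "MCauchy s" "MCauchy t" "MCauchy u" "(\<lambda>n. d (s n) (t n)) \<longlonglongrightarrow> 0" "(\<lambda>n. d (t n) (u n)) \<longlonglongrightarrow> 0"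
      by (auto simp: cauchy_equiv_def)
    have "(\<lambda>n. d (s n) (t n) + d (t n) (u n)) \<longlonglongrightarrow> 0" using tendsto_add[OF C(4,5)] by simp
    then have "(\<lambda>n. d (s n) (u n)) \<longlonglongrightarrow> 0"
      by (rule Lim_null_comparison[rotated])
        (use triangle MCauchy_in C in \<open>auto intro!: always_eventually\<close>)
    then show "(s, u) \<in> cauchy_equiv M d" using C by (simp add: cauchy_equiv_def)
  qed
qed

lemma cauchy_class_in: "MCauchy s \<Longrightarrow> cauchy_class s \<in> completion_points M d"
  unfolding completion_points_def by (auto intro: quotientI)

lemma completion_pointsE:
  assumes "A \<in> completion_points M d" obtains s where "MCauchy s" "A = cauchy_class s"
  using assms unfolding completion_points_def by (auto elim: quotientE)

lemma cauchy_class_eq_iff: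
  "MCauchy s \<Longrightarrow> MCauchy t \<Longrightarrow> cauchy_class s = cauchy_class t \<longleftrightarrow> (\<lambda>n. d (s n) (t n)) \<longlonglongrightarrow> 0"
  using eq_equiv_class_iff[OF equiv_cauchy, of s t] by (simp add: cauchy_equiv_def)

lemma cauchy_equiv_dist_diff:
  assumes "(s, s') \<in> cauchy_equiv M d" "(t, t') \<in> cauchy_equiv M d"
  shows "(\<lambda>n. d (s n) (t n) - d (s' n) (t' n)) \<longlonglongrightarrow> 0"
proof -
  have C: "MCauchy s" "MCauchy s'" "MCauchy t" "MCauchy t'" "(\<lambda>n. d (s n) (s' n)) \<longlonglongrightarrow> 0" "(\<lambda>n. d (t n) (t' n)) \<longlonglongrightarrow> 0"
    using assms by (auto simp: cauchy_equiv_def)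
  have lim: "(\<lambda>n. d (s n) (s' n) + d (t n) (t' n)) \<longlonglongrightarrow> 0" using tendsto_add[OF C(5,6)] by simp
  have le: "norm (d (s n) (t n) - d (s' n) (t' n)) \<le> d (s n) (s' n) + d (t n) (t' n)" for n
  proof -
    note M = C(1-4)[THEN MCauchy_in, of n]
    show ?thesis
      using triangle[OF M(1,2,3)] triangle[OF M(2,4,3)] triangle[OF M(2,1,4)] triangle[OF M(1,3,4)]
        commute[of "s n" "s' n"] commute[of "t n" "t' n"] unfolding real_norm_def by linarith
  qed
  show ?thesis by (rule Lim_null_comparison[OF always_eventually[OF allI[OF le]] lim])
qed

text \<open>The distance of two classes is defined by chosen representatives, but it is the limit for all of them.\<close>

lemma completion_dist_tendsto:
  assumes s: "MCauchy s" and t: "MCauchy t"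
  shows "(\<lambda>n. d (s n) (t n)) \<longlonglongrightarrow> completion_dist M d (cauchy_class s) (cauchy_class t)"
proof -
  let ?s = "SOME r. r \<in> cauchy_class s" and ?t = "SOME r. r \<in> cauchy_class t"
  have sel: "(r, SOME q. q \<in> cauchy_class r) \<in> cauchy_equiv M d" if "MCauchy r" for r
    using someI[of "\<lambda>q. q \<in> cauchy_class r" r] equiv_class_self[OF equiv_cauchy, of r] that by simp
  have C: "MCauchy ?s" "MCauchy ?t" using sel[OF s] sel[OF t] by (auto simp: cauchy_equiv_def)
  have "(\<lambda>n. d (?s n) (?t n)) \<longlonglongrightarrow> lim (\<lambda>n. d (?s n) (?t n))"
    using MCauchy_dist_convergent[OF C] by (simp add: convergent_LIMSEQ_iff)
  then have "(\<lambda>n. d (?s n) (?t n) + (d (s n) (t n) - d (?s n) (?t n))) \<longlonglongrightarrow> lim (\<lambda>n. d (?s n) (?t n)) + 0"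
    by (rule tendsto_add[OF _ cauchy_equiv_dist_diff[OF sel[OF s] sel[OF t]]])
  then show ?thesis
    using cauchy_class_in[OF s] cauchy_class_in[OF t] by (simp add: completion_dist_def)
qed

lemma Metric_space_completion: "Metric_space (completion_points M d) (completion_dist M d)"
proof
  have lim: "(\<lambda>n. d (s n) (t n)) \<longlonglongrightarrow> completion_dist M d (cauchy_class s) (cauchy_class t)"
    if "MCauchy s" "MCauchy t" for s t by (rule completion_dist_tendsto[OF that])
  show "0 \<le> completion_dist M d A B" for A B
  proof (cases "A \<in> completion_points M d \<and> B \<in> completion_points M d")
    case True
    then obtain s t where "MCauchy s" "MCauchy t" "A = cauchy_class s" "B = cauchy_class t"
      using completion_pointsE[of A] completion_pointsE[of B] by metis
    then show ?thesis using LIMSEQ_le_const[OF lim] nonneg by auto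
  qed (auto simp: completion_dist_def)
  show "completion_dist M d A B = completion_dist M d B A" for A B
    by (simp add: completion_dist_def commute conj_commute)
  show "completion_dist M d A B = 0 \<longleftrightarrow> A = B"
    if AB: "A \<in> completion_points M d" "B \<in> completion_points M d" for A B
  proof -
    obtain s t where st: "MCauchy s" "MCauchy t" "A = cauchy_class s" "B = cauchy_class t"
      using completion_pointsE[OF AB(1)] completion_pointsE[OF AB(2)] by metis
    have "completion_dist M d A B = 0 \<longleftrightarrow> (\<lambda>n. d (s n) (t n)) \<longlonglongrightarrow> 0"
      using lim[OF st(1,2)] LIMSEQ_unique[OF lim[OF st(1,2)], of 0] unfolding st(3,4) by auto
    then show ?thesis using cauchy_class_eq_iff[OF st(1,2)] unfolding st(3,4) by simp
  qed
  show "completion_dist M d A C \<le> completion_dist M d A B + completion_dist M d B C"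
    if AB: "A \<in> completion_points M d" "B \<in> completion_points M d" "C \<in> completion_points M d" for A B C
  proof -
    obtain s where s: "MCauchy s" "A = cauchy_class s" by (rule completion_pointsE[OF AB(1)])
    obtain t where t: "MCauchy t" "B = cauchy_class t" by (rule completion_pointsE[OF AB(2)])
    obtain u where u: "MCauchy u" "C = cauchy_class u" by (rule completion_pointsE[OF AB(3)])
    have "d (s n) (u n) \<le> d (s n) (t n) + d (t n) (u n)" for n
      by (rule triangle[OF MCauchy_in[OF s(1)] MCauchy_in[OF t(1)] MCauchy_in[OF u(1)]])
    then show ?thesis
      unfolding s(2) t(2) u(2)
      by (intro LIMSEQ_le[OF lim[OF s(1) u(1)] tendsto_add[OF lim[OF s(1) t(1)] lim[OF t(1) u(1)]]]) blast
  qed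
qed

lemma metrizable_completion_topology: "metrizable_space (completion_topology M d)"
  unfolding completion_topology_def
  by (rule Metric_space.metrizable_space_mtopology[OF Metric_space_completion])

lemma topspace_completion: "topspace (completion_topology M d) = completion_points M d"
  unfolding completion_topology_def by (rule Metric_space.topspace_mtopology[OF Metric_space_completion])

text \<open>Labelling the classes of Cauchy sequences by the points of \<open>Y\<close> is a bijection that respects the topologies. In this
  form a completion can be recognized without a metric on \<open>Y\<close>.\<close>

lemma homeomorphic_completion:
  assumes cauchy: "\<And>a. a \<in> topspace Y \<Longrightarrow> MCauchy (\<sigma> a)"
    and complete: "\<And>s. MCauchy s \<Longrightarrow> \<exists>a\<in>topspace Y. (\<lambda>n. d (s n) (\<sigma> a n)) \<longlonglongrightarrow> 0"
    and distinct: "\<And>a b. a \<in> topspace Y \<Longrightarrow> b \<in> topspace Y \<Longrightarrow> (\<lambda>n. d (\<sigma> a n) (\<sigma> b n)) \<longlonglongrightarrow> 0 \<Longrightarrow> a = b"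
    and opens: "\<And>U. U \<subseteq> topspace Y \<Longrightarrow> openin Y U \<longleftrightarrow>
       (\<forall>a\<in>U. \<exists>r>0. \<forall>b\<in>topspace Y. completion_dist M d (cauchy_class (\<sigma> a)) (cauchy_class (\<sigma> b)) < r \<longrightarrow> b \<in> U)"
  obtains h where "homeomorphic_map (completion_topology M d) Y h"
    "\<And>a. a \<in> topspace Y \<Longrightarrow> h (cauchy_class (\<sigma> a)) = a"
proof -
  interpret C: Metric_space "completion_points M d" "completion_dist M d" by (rule Metric_space_completion)
  define j where "j a = cauchy_class (\<sigma> a)" for a
  have j_in: "j a \<in> completion_points M d" if "a \<in> topspace Y" for a
    using cauchy_class_in[OF cauchy[OF that]] by (simp add: j_def)
  have inj: "inj_on j (topspace Y)"
  proof (rule inj_onI)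
    fix a b assume ab: "a \<in> topspace Y" "b \<in> topspace Y" "j a = j b"
    then have "(\<lambda>n. d (\<sigma> a n) (\<sigma> b n)) \<longlonglongrightarrow> 0"
      using cauchy_class_eq_iff[OF cauchy[OF ab(1)] cauchy[OF ab(2)]] by (simp add: j_def)
    then show "a = b" by (rule distinct[OF ab(1,2)])
  qed
  have surj: "j ` topspace Y = completion_points M d"
  proof (intro equalityI subsetI)
    fix A assume "A \<in> completion_points M d"
    then obtain s where s: "MCauchy s" "A = cauchy_class s" by (rule completion_pointsE)
    then obtain a where a: "a \<in> topspace Y" "(\<lambda>n. d (s n) (\<sigma> a n)) \<longlonglongrightarrow> 0" using complete by blast
    then have "A = j a" using cauchy_class_eq_iff[OF s(1) cauchy[OF a(1)]] s(2) by (simp add: j_def)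
    then show "A \<in> j ` topspace Y" using a(1) by blast
  qed (use j_in in auto)
  have "quotient_map Y (completion_topology M d) j"
    unfolding quotient_map_def
  proof (intro conjI allI impI)
    show "j ` topspace Y = topspace (completion_topology M d)" using surj by (simp add: topspace_completion)
    fix V assume "V \<subseteq> topspace (completion_topology M d)"
    then have V: "V \<subseteq> completion_points M d" by (simp add: topspace_completion)
    let ?U = "{x \<in> topspace Y. j x \<in> V}"
    have "openin (completion_topology M d) V \<longleftrightarrow> (\<forall>A\<in>V. \<exists>r>0. C.mball A r \<subseteq> V)"
      unfolding completion_topology_def C.openin_mtopology using V by auto
    also have "\<dots> \<longleftrightarrow> (\<forall>a\<in>?U. \<exists>r>0. C.mball (j a) r \<subseteq> V)"
    proof
      assume R: "\<forall>a\<in>?U. \<exists>r>0. C.mball (j a) r \<subseteq> V"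
      show "\<forall>A\<in>V. \<exists>r>0. C.mball A r \<subseteq> V"
      proof
        fix A assume A: "A \<in> V"
        then have "A \<in> j ` topspace Y" using V surj by blast
        then obtain a where "a \<in> topspace Y" "A = j a" by blast
        then show "\<exists>r>0. C.mball A r \<subseteq> V" using R A by simp
      qed
    qed simp
    also have "\<dots> \<longleftrightarrow> (\<forall>a\<in>?U. \<exists>r>0. \<forall>b\<in>topspace Y. completion_dist M d (j a) (j b) < r \<longrightarrow> b \<in> ?U)"
    proof -
      have "C.mball (j a) r \<subseteq> V \<longleftrightarrow> (\<forall>b\<in>topspace Y. completion_dist M d (j a) (j b) < r \<longrightarrow> b \<in> ?U)"
        if "a \<in> ?U" for a r
      proof
        assume "C.mball (j a) r \<subseteq> V"
        then show "\<forall>b\<in>topspace Y. completion_dist M d (j a) (j b) < r \<longrightarrow> b \<in> ?U"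
          using that j_in by (auto simp: subset_eq)
      next
        assume R: "\<forall>b\<in>topspace Y. completion_dist M d (j a) (j b) < r \<longrightarrow> b \<in> ?U"
        show "C.mball (j a) r \<subseteq> V"
        proof
          fix B assume "B \<in> C.mball (j a) r"
          then have B: "B \<in> completion_points M d" "completion_dist M d (j a) B < r" by auto
          then obtain b where "b \<in> topspace Y" "B = j b" unfolding surj[symmetric] by blast
          then show "B \<in> V" using R B by blast
        qed
      qed
      then show ?thesis by blast
    qed
    also have "\<dots> \<longleftrightarrow> openin Y ?U" using opens[of ?U] by (simp add: j_def)
    finally show "openin Y ?U \<longleftrightarrow> openin (completion_topology M d) V" by simp
  qed
  then have hj: "homeomorphic_map Y (completion_topology M d) j"
    using inj by (simp add: homeomorphic_map_def)
  then obtain h where h: "homeomorphic_maps Y (completion_topology M d) j h"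
    using homeomorphic_map_maps by blast
  show ?thesis
  proof
    show "homeomorphic_map (completion_topology M d) Y h"
      using h homeomorphic_maps_map by blast
    show "h (cauchy_class (\<sigma> a)) = a" if "a \<in> topspace Y" for a
      using h that by (simp add: homeomorphic_maps_def j_def)
  qed
qed

end

theorem (in weighted_connected_graph) metrizable_length_space: "metrizable_space (length_space G len)"
  unfolding length_space_def
  by (rule Metric_space.metrizable_completion_topology[OF Metric_space_quotient])

section \<open>Components, rays and ends\<close>

context graph
begin

lemma reachD: "reach G S u v \<Longrightarrow> u \<in> verts G" "reach G S u v \<Longrightarrow> v \<in> verts G"
    "reach G S u v \<Longrightarrow> u \<notin> S" "reach G S u v \<Longrightarrow> v \<notin> S"
  by (auto simp: reach_def)

lemma reach_refl: "v \<in> verts G \<Longrightarrow> v \<notin> S \<Longrightarrow> reach G S v v"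
  by (simp add: reach_def)

lemma reach_step: "reach G S u v \<Longrightarrow> {v, w} \<in> edges G \<Longrightarrow> w \<notin> S \<Longrightarrow> reach G S u w"
  using edge_vertsD(2)[of v w] by (auto simp: reach_def intro: rtranclp.rtrancl_into_rtrancl)

lemma reach_edge: "{u, v} \<in> edges G \<Longrightarrow> u \<notin> S \<Longrightarrow> v \<notin> S \<Longrightarrow> reach G S u v"
  using reach_step[OF reach_refl] edge_vertsD by blast

lemma reach_trans: "reach G S u v \<Longrightarrow> reach G S v w \<Longrightarrow> reach G S u w"
  by (auto simp: reach_def)

lemma reach_sym: assumes "reach G S u v" shows "reach G S v u"
proof -
  have "symp (\<lambda>x y. x \<notin> S \<and> y \<notin> S \<and> {x, y} \<in> edges G)"
    by (auto simp: symp_def insert_commute)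
  then have "symp (\<lambda>x y. x \<notin> S \<and> y \<notin> S \<and> {x, y} \<in> edges G)\<^sup>*\<^sup>*" by (rule symp_rtranclp)
  then show ?thesis using assms by (auto simp: reach_def dest: sympD)
qed

lemma reach_mono: assumes "reach G S' u v" "S \<subseteq> S'" shows "reach G S u v"
proof -
  have "(\<lambda>x y. x \<notin> S' \<and> y \<notin> S' \<and> {x, y} \<in> edges G)\<^sup>*\<^sup>* u v" using assms(1) by (simp add: reach_def)
  then have "(\<lambda>x y. x \<notin> S \<and> y \<notin> S \<and> {x, y} \<in> edges G)\<^sup>*\<^sup>* u v"
    by (rule rtranclp_mono[THEN predicate2D, rotated]) (use assms(2) in auto)
  then show ?thesis using assms by (auto simp: reach_def)
qed

lemma reach_induct [consumes 1, case_names refl step]: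
  assumes "reach G S u v" "P u"
    and "\<And>w z. reach G S u w \<Longrightarrow> P w \<Longrightarrow> {w, z} \<in> edges G \<Longrightarrow> w \<notin> S \<Longrightarrow> z \<notin> S \<Longrightarrow> P z"
  shows "P v"
proof -
  have u: "u \<in> verts G" "u \<notin> S" using reachD[OF assms(1)] by auto
  have "(\<lambda>x y. x \<notin> S \<and> y \<notin> S \<and> {x, y} \<in> edges G)\<^sup>*\<^sup>* u v" using assms(1) by (simp add: reach_def)
  then have "reach G S u v \<and> P v"
  proof induction
    case base
    then show ?case using assms(2) reach_refl u by blast
  next
    case (step y z)
    then show ?case using assms(3)[of y z] reach_step[of S u y z] by blast
  qed
  then show ?thesis by blast
qed

text \<open>Reachability in \<open>G - (-A)\<close> is reachability by a walk in \<open>A\<close>.\<close>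

definition connected_set :: "'a set \<Rightarrow> bool" where
  "connected_set A \<longleftrightarrow> (\<forall>u\<in>A. \<forall>v\<in>A. reach G (- A) u v)"

lemma componentsE:
  assumes "C \<in> components_minus G S"
  obtains v where "v \<in> verts G" "v \<notin> S" "C = {w. reach G S v w}"
  using assms unfolding components_minus_def by blast

lemma component_of: "v \<in> verts G \<Longrightarrow> v \<notin> S \<Longrightarrow> {w. reach G S v w} \<in> components_minus G S"
  unfolding components_minus_def by blast

lemma component_reach: "C \<in> components_minus G S \<Longrightarrow> u \<in> C \<Longrightarrow> v \<in> C \<Longrightarrow> reach G S u v"
  by (erule componentsE) (auto intro: reach_trans reach_sym)

lemma component_closed: "C \<in> components_minus G S \<Longrightarrow> u \<in> C \<Longrightarrow> reach G S u v \<Longrightarrow> v \<in> C"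
  by (erule componentsE) (auto intro: reach_trans)

lemma component_eq: "C \<in> components_minus G S \<Longrightarrow> v \<in> C \<Longrightarrow> C = {w. reach G S v w}"
  using component_reach component_closed by blast

lemma component_unique: "C \<in> components_minus G S \<Longrightarrow> C' \<in> components_minus G S \<Longrightarrow> v \<in> C \<Longrightarrow> v \<in> C' \<Longrightarrow> C = C'"
  using component_eq by metis

lemma component_sub: "C \<in> components_minus G S \<Longrightarrow> C \<subseteq> verts G - S"
  by (erule componentsE) (auto dest: reachD)

lemma component_nonempty: "C \<in> components_minus G S \<Longrightarrow> C \<noteq> {}"
  by (erule componentsE) (auto intro: reach_refl)

lemma component_leave: "C \<in> components_minus G S \<Longrightarrow> u \<in> C \<Longrightarrow> {u, v} \<in> edges G \<Longrightarrow> v \<notin> C \<Longrightarrow> v \<in> S"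
  using component_closed[of C S u v] component_sub[of C S] reach_edge[of u v S] by blast

lemma component_connected: assumes "C \<in> components_minus G S" shows "connected_set C"
  unfolding connected_set_def
proof (intro ballI)
  fix u v assume uv: "u \<in> C" "v \<in> C"
  have "reach G S u v" by (rule component_reach[OF assms uv])
  then have "reach G (- C) u v"
  proof (induction rule: reach_induct)
    case refl
    then show ?case using uv component_sub[OF assms] by (auto intro: reach_refl)
  next
    case (step w z)
    have "z \<in> C"
      using component_closed[OF assms, of w z] reachD(4)[OF step.IH] reach_edge[OF step.hyps(2,3,4)] by blast
    then show ?case using reach_step[OF step.IH step.hyps(2)] by blast
  qed
  then show "reach G (- C) u v" .
qed

text \<open>Used to replace the possibly infinite separator \<open>W n\<close> of a component by a finite one.\<close>

lemma componentI:
  assumes "A \<noteq> {}" "A \<subseteq> verts G - S" "connected_set A"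
    and leave: "\<And>u v. u \<in> A \<Longrightarrow> {u, v} \<in> edges G \<Longrightarrow> v \<notin> A \<Longrightarrow> v \<in> S"
  shows "A \<in> components_minus G S"
proof -
  obtain a where a: "a \<in> A" using assms(1) by blast
  have "A = {w. reach G S a w}"
  proof (intro equalityI subsetI CollectI)
    fix w assume "w \<in> A"
    then have "reach G (- A) a w" using assms(3) a by (simp add: connected_set_def)
    then show "reach G S a w" by (rule reach_mono) (use assms(2) in auto)
  next
    fix w assume "w \<in> {w. reach G S a w}"
    then have "reach G S a w" by simp
    then show "w \<in> A" 
    proof (induction rule: reach_induct)
      case (step w z)
      then show ?case using leave[of w z] by blast
    qed (rule a)
  qed
  then show ?thesis using component_of[of a S] a assms(2) by auto
qed

lemma raysD: "r \<in> rays G \<Longrightarrow> inj r" "r \<in> rays G \<Longrightarrow> {r n, r (Suc n)} \<in> edges G" "r \<in> rays G \<Longrightarrow> r n \<in> verts G"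
  using edge_vertsD(1)[of "r n" "r (Suc n)"] by (auto simp: rays_def)

abbreviation ev :: "(nat \<Rightarrow> 'a) \<Rightarrow> 'a set \<Rightarrow> bool" where
  "ev r A \<equiv> (\<forall>\<^sub>F n in sequentially. r n \<in> A)"

lemma ray_leaves_finite:
  assumes "r \<in> rays G" "finite S" shows "\<exists>N. \<forall>n\<ge>N. r n \<notin> S"
proof -
  have "finite (r -` S)" by (rule finite_vimageI[OF assms(2) raysD(1)[OF assms(1)]])
  then obtain N where "\<forall>n\<in>r -` S. n < N" by (metis finite_nat_set_iff_bounded)
  then have "\<forall>n\<ge>N. r n \<notin> S" by (metis not_le vimageI2)
  then show ?thesis by blast
qed

lemma ray_tail_reach:
  assumes "r \<in> rays G" "\<forall>n\<ge>N. r n \<notin> S" "N \<le> m" shows "reach G S (r N) (r m)"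
  using assms(3)
proof (induction m rule: dec_induct)
  case base
  show ?case using assms raysD by (intro reach_refl) auto
next
  case (step m)
  show ?case by (rule reach_step[OF step.IH]) (use raysD[OF assms(1)] assms(2) step in auto)
qed

lemma ray_component:
  assumes "r \<in> rays G" "finite S"
  shows "\<exists>C\<in>components_minus G S. ev r C"
proof -
  obtain N where N: "\<forall>n\<ge>N. r n \<notin> S" using ray_leaves_finite[OF assms] by blast
  have "{w. reach G S (r N) w} \<in> components_minus G S"
    using N raysD(3)[OF assms(1)] by (intro component_of) auto
  moreover have "ev r {w. reach G S (r N) w}"
    unfolding eventually_sequentially using ray_tail_reach[OF assms(1) N] by blast
  ultimately show ?thesis by blast
qed

lemma ev_meet: "ev r A \<Longrightarrow> ev r B \<Longrightarrow> \<exists>n. r n \<in> A \<and> r n \<in> B"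
  using eventually_happens'[OF sequentially_bot eventually_conj] by fast

lemma ev_component_unique:
  "C \<in> components_minus G S \<Longrightarrow> C' \<in> components_minus G S \<Longrightarrow> ev r C \<Longrightarrow> ev r C' \<Longrightarrow> C = C'"
  using ev_meet[of r C C'] component_unique by blast

text \<open>The first vertices of two equivalent rays do not matter, as \<open>S\<close> may be enlarged by finitely many of them. In terms
  of tails, transitivity is evident.\<close>

lemma vertex_equiv_iff:
  assumes r: "r \<in> rays G" and r': "r' \<in> rays G"
  shows "(r, r') \<in> vertex_equiv G \<longleftrightarrow>
    (\<forall>S. finite S \<and> S \<subseteq> verts G \<longrightarrow> (\<exists>C\<in>components_minus G S. ev r C \<and> ev r' C))"
proof
  assume eq: "(r, r') \<in> vertex_equiv G"
  show "\<forall>S. finite S \<and> S \<subseteq> verts G \<longrightarrow> (\<exists>C\<in>components_minus G S. ev r C \<and> ev r' C)"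
  proof (intro allI impI)
    fix S assume S: "finite S \<and> S \<subseteq> verts G"
    obtain N N' where N: "\<forall>n\<ge>N. r n \<notin> S" and N': "\<forall>n\<ge>N'. r' n \<notin> S"
      using ray_leaves_finite[OF r] ray_leaves_finite[OF r'] S by metis
    \<comment> \<open>Removing the initial segments as well forces the vertices that can be reached from each other into the tails.\<close>
    let ?S = "S \<union> r ` {..<N} \<union> r' ` {..<N'}"
    have "finite ?S \<and> ?S \<subseteq> verts G" using S raysD(3)[OF r] raysD(3)[OF r'] by auto
    moreover have "\<forall>S. finite S \<and> S \<subseteq> verts G \<longrightarrow> (\<exists>m n. reach G S (r m) (r' n))"
      using eq by (simp add: vertex_equiv_def)
    ultimately obtain m n where mn: "reach G ?S (r m) (r' n)" by meson
    have "N \<le> m" using reachD(3)[OF mn] by (meson UnCI imageI lessThan_iff not_le)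
    have "N' \<le> n" using reachD(4)[OF mn] by (meson UnCI imageI lessThan_iff not_le)
    have reach: "reach G S (r m) (r' n)" by (rule reach_mono[OF mn]) auto
    have tails: "\<forall>k\<ge>m. r k \<notin> S" "\<forall>k\<ge>n. r' k \<notin> S" using N N' \<open>N \<le> m\<close> \<open>N' \<le> n\<close> by auto
    let ?C = "{w. reach G S (r m) w}"
    have "?C \<in> components_minus G S" using reachD[OF reach] by (intro component_of)
    moreover have "ev r ?C"
      unfolding eventually_sequentially using ray_tail_reach[OF r tails(1)] by blast
    moreover have "ev r' ?C"
      unfolding eventually_sequentially using reach_trans[OF reach ray_tail_reach[OF r' tails(2)]] by blast
    ultimately show "\<exists>C\<in>components_minus G S. ev r C \<and> ev r' C" by blast
  qed
next
  assume R: "\<forall>S. finite S \<and> S \<subseteq> verts G \<longrightarrow> (\<exists>C\<in>components_minus G S. ev r C \<and> ev r' C)"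
  have "\<exists>m n. reach G S (r m) (r' n)" if S: "finite S \<and> S \<subseteq> verts G" for S
  proof -
    obtain C where C: "C \<in> components_minus G S" "ev r C" "ev r' C" using R[rule_format, OF S] by blast
    obtain m where "r m \<in> C" using ev_meet[OF C(2,2)] by blast
    moreover obtain n where "r' n \<in> C" using ev_meet[OF C(3,3)] by blast
    ultimately show ?thesis using component_reach[OF C(1)] by blast
  qed
  then show "(r, r') \<in> vertex_equiv G" using r r' by (simp add: vertex_equiv_def)
qed

lemma equiv_vertex_equiv: "equiv (rays G) (vertex_equiv G)"
proof (rule equivI)
  show "vertex_equiv G \<subseteq> rays G \<times> rays G" by (auto simp: vertex_equiv_def)
  show "refl_on (rays G) (vertex_equiv G)"
    using ray_component by (auto simp: refl_on_def vertex_equiv_iff)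
  show "sym (vertex_equiv G)"
  proof (rule symI)
    fix r r' assume eq: "(r, r') \<in> vertex_equiv G"
    then have "r \<in> rays G" "r' \<in> rays G" by (auto simp: vertex_equiv_def)
    then show "(r', r) \<in> vertex_equiv G" using eq by (simp add: vertex_equiv_iff conj_commute)
  qed
  show "trans (vertex_equiv G)"
  proof (rule transI)
    fix r s t assume eq: "(r, s) \<in> vertex_equiv G" "(s, t) \<in> vertex_equiv G"
    then have rays: "r \<in> rays G" "s \<in> rays G" "t \<in> rays G" by (auto simp: vertex_equiv_def)
    show "(r, t) \<in> vertex_equiv G"
      unfolding vertex_equiv_iff[OF rays(1,3)]
    proof (intro allI impI)
      fix S assume S: "finite S \<and> S \<subseteq> verts G"
      obtain C where C: "C \<in> components_minus G S" "ev r C" "ev s C"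
        using eq(1)[unfolded vertex_equiv_iff[OF rays(1,2)], rule_format, OF S] by blast
      obtain C' where C': "C' \<in> components_minus G S" "ev s C'" "ev t C'"
        using eq(2)[unfolded vertex_equiv_iff[OF rays(2,3)], rule_format, OF S] by blast
      have "C = C'" by (rule ev_component_unique[OF C(1) C'(1) C(3) C'(2)])
      then show "\<exists>C\<in>components_minus G S. ev r C \<and> ev t C" using C C' by blast
    qed
  qed
qed

lemma ray_shift:
  assumes "r \<in> rays G" shows "(\<lambda>n. r (n + k)) \<in> rays G" "(r, \<lambda>n. r (n + k)) \<in> vertex_equiv G"
proof -
  show shift: "(\<lambda>n. r (n + k)) \<in> rays G"
    unfolding rays_def
  proof (intro CollectI conjI allI injI)
    fix x y assume "r (x + k) = r (y + k)"
    then show "x = y" using injD[OF raysD(1)[OF assms]] by fastforce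
  next
    show "{r (n + k), r (Suc n + k)} \<in> edges G" for n using raysD(2)[OF assms, of "n + k"] by simp
  qed
  have "ev r C \<Longrightarrow> ev (\<lambda>n. r (n + k)) C" for C
    by (rule eventually_compose_filterlim[OF _ filterlim_add_const_nat_at_top])
  then show "(r, \<lambda>n. r (n + k)) \<in> vertex_equiv G"
    using ray_component[OF assms] unfolding vertex_equiv_iff[OF assms shift] by blast
qed

lemma vertex_endsD:
  assumes "\<omega> \<in> vertex_ends G"
  shows "\<omega> \<noteq> {}" "\<omega> \<subseteq> rays G" "r \<in> \<omega> \<Longrightarrow> r' \<in> \<omega> \<Longrightarrow> (r, r') \<in> vertex_equiv G"
    "r \<in> \<omega> \<Longrightarrow> (r, r') \<in> vertex_equiv G \<Longrightarrow> r' \<in> \<omega>"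
proof -
  note q = assms[unfolded vertex_ends_def]
  show "\<omega> \<noteq> {}" using in_quotient_imp_non_empty[OF equiv_vertex_equiv q] .
  show "\<omega> \<subseteq> rays G" using in_quotient_imp_subset[OF equiv_vertex_equiv q] .
  show "r \<in> \<omega> \<Longrightarrow> r' \<in> \<omega> \<Longrightarrow> (r, r') \<in> vertex_equiv G" using quotient_eq_iff[OF equiv_vertex_equiv q q] by blast
  show "r \<in> \<omega> \<Longrightarrow> (r, r') \<in> vertex_equiv G \<Longrightarrow> r' \<in> \<omega>" using in_quotient_imp_closed[OF equiv_vertex_equiv q] by blast
qed

definition end_of :: "(nat \<Rightarrow> 'a) \<Rightarrow> (nat \<Rightarrow> 'a) set" where
  "end_of r = vertex_equiv G `` {r}"

lemma end_of: assumes "r \<in> rays G" shows "end_of r \<in> vertex_ends G" "r \<in> end_of r"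
  using assms equiv_class_self[OF equiv_vertex_equiv] by (auto simp: end_of_def vertex_ends_def intro: quotientI)

lemma end_component_ex:
  assumes \<omega>: "\<omega> \<in> vertex_ends G" and S: "finite S" "S \<subseteq> verts G"
  shows "\<exists>C\<in>components_minus G S. \<forall>r\<in>\<omega>. ev r C"
proof -
  obtain r where r: "r \<in> \<omega>" using vertex_endsD(1)[OF \<omega>] by blast
  then have ray: "r \<in> rays G" using vertex_endsD(2)[OF \<omega>] by blast
  obtain C where C: "C \<in> components_minus G S" "ev r C" using ray_component[OF ray S(1)] by blast
  have "ev r' C" if "r' \<in> \<omega>" for r'
  proof -
    have ray': "r' \<in> rays G" using that vertex_endsD(2)[OF \<omega>] by blast
    have "(r, r') \<in> vertex_equiv G" by (rule vertex_endsD(3)[OF \<omega> r that])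
    then obtain C' where C': "C' \<in> components_minus G S" "ev r C'" "ev r' C'"
      using S unfolding vertex_equiv_iff[OF ray ray'] by meson
    then show ?thesis using ev_component_unique[OF C(1) C'(1) C(2) C'(2)] by simp
  qed
  then show ?thesis using C(1) by blast
qed

text \<open>A tail of a ray of the end \<open>\<omega>\<close> lies in \<open>\<omega>\<close> again, so that all that matters is where the tails of the rays are.\<close>

lemma end_component_eq:
  assumes \<omega>: "\<omega> \<in> vertex_ends G" and S: "finite S" "S \<subseteq> verts G"
    and C: "C \<in> components_minus G S" "r \<in> \<omega>" "ev r C"
  shows "end_component G S \<omega> = C"
proof -
  obtain D where D: "D \<in> components_minus G S" "\<forall>r\<in>\<omega>. ev r D" using end_component_ex[OF \<omega> S] by blast
  have "C = D" using ev_component_unique[OF C(1) D(1) C(3)] D(2) C(2) by blast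
  show ?thesis unfolding end_component_def
  proof (rule the_equality)
    obtain N where N: "\<And>n. n \<ge> N \<Longrightarrow> r n \<in> C" using C(3) unfolding eventually_sequentially by blast
    have "r \<in> rays G" using C(2) vertex_endsD(2)[OF \<omega>] by blast
    then have "(\<lambda>n. r (n + N)) \<in> \<omega>" using ray_shift(2) vertex_endsD(4)[OF \<omega> C(2)] by blast
    moreover have "range (\<lambda>n. r (n + N)) \<subseteq> C" using N by auto
    ultimately show "C \<in> components_minus G S \<and> (\<exists>r\<in>\<omega>. range r \<subseteq> C)" using C(1) by blast
  next
    fix C' assume C': "C' \<in> components_minus G S \<and> (\<exists>r\<in>\<omega>. range r \<subseteq> C')"
    then obtain r' where r': "r' \<in> \<omega>" "range r' \<subseteq> C'" by blast
    then have "ev r' C'" by (intro always_eventually allI) auto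
    then have "C' = D" using ev_component_unique[of C' S D r'] C' D r' by blast
    then show "C' = C" using \<open>C = D\<close> by simp
  qed
qed

lemma end_component:
  assumes \<omega>: "\<omega> \<in> vertex_ends G" and S: "finite S" "S \<subseteq> verts G"
  shows "end_component G S \<omega> \<in> components_minus G S" "r \<in> \<omega> \<Longrightarrow> ev r (end_component G S \<omega>)"
proof -
  obtain D where D: "D \<in> components_minus G S" "\<forall>r\<in>\<omega>. ev r D" using end_component_ex[OF \<omega> S] by blast
  obtain q where "q \<in> \<omega>" using vertex_endsD(1)[OF \<omega>] by blast
  then have "end_component G S \<omega> = D" using end_component_eq[OF \<omega> S D(1)] D(2) by blast
  then show "end_component G S \<omega> \<in> components_minus G S" "r \<in> \<omega> \<Longrightarrow> ev r (end_component G S \<omega>)" using D by auto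
qed

lemma ex_ray_in_component_iff:
  assumes \<omega>: "\<omega> \<in> vertex_ends G" and S: "finite S" "S \<subseteq> verts G" and C: "C \<in> components_minus G S"
  shows "(\<exists>r\<in>\<omega>. range r \<subseteq> C) \<longleftrightarrow> end_component G S \<omega> = C"
proof
  assume "\<exists>r\<in>\<omega>. range r \<subseteq> C"
  then obtain r where r: "r \<in> \<omega>" "range r \<subseteq> C" by blast
  then have "ev r C" by (intro always_eventually allI) auto
  then show "end_component G S \<omega> = C" by (rule end_component_eq[OF \<omega> S C r(1)])
next
  assume eq: "end_component G S \<omega> = C"
  obtain r where r: "r \<in> \<omega>" using vertex_endsD(1)[OF \<omega>] by blast
  then have "ev r C" using end_component(2)[OF \<omega> S r] eq by simp
  then obtain N where N: "\<And>n. n \<ge> N \<Longrightarrow> r n \<in> C" unfolding eventually_sequentially by blast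
  have "r \<in> rays G" using r vertex_endsD(2)[OF \<omega>] by blast
  then have "(\<lambda>n. r (n + N)) \<in> \<omega>" using ray_shift(2) vertex_endsD(4)[OF \<omega> r] by blast
  moreover have "range (\<lambda>n. r (n + N)) \<subseteq> C" using N by auto
  ultimately show "\<exists>r\<in>\<omega>. range r \<subseteq> C" by blast
qed

lemma vertex_ends_eqI:
  assumes "\<omega> \<in> vertex_ends G" "\<omega>' \<in> vertex_ends G"
    and "\<And>S. finite S \<Longrightarrow> S \<subseteq> verts G \<Longrightarrow> end_component G S \<omega> = end_component G S \<omega>'"
  shows "\<omega> = \<omega>'"
proof -
  obtain r where r: "r \<in> \<omega>" using vertex_endsD(1)[OF assms(1)] by blast
  obtain r' where r': "r' \<in> \<omega>'" using vertex_endsD(1)[OF assms(2)] by blast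
  have rays: "r \<in> rays G" "r' \<in> rays G"
    using r r' vertex_endsD(2)[OF assms(1)] vertex_endsD(2)[OF assms(2)] by blast+
  have "(r, r') \<in> vertex_equiv G"
    unfolding vertex_equiv_iff[OF rays]
  proof (intro allI impI)
    fix S assume S: "finite S \<and> S \<subseteq> verts G"
    show "\<exists>C\<in>components_minus G S. ev r C \<and> ev r' C"
      using end_component(1)[OF assms(1), of S] end_component(2)[OF assms(1) _ _ r, of S]
        end_component(2)[OF assms(2) _ _ r', of S] assms(3)[of S] S by auto
  qed
  with assms(1,2) r r' show ?thesis
    unfolding vertex_ends_def by (intro quotient_eqI[OF equiv_vertex_equiv])
qed

text \<open>Always leave a vertex after the last visit of the walk to it. The walk may pause, so that it can be defined without
  knowing when it moves.\<close>

lemma walk_loop_erasure: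
  fixes w :: "nat \<Rightarrow> 'a"
  assumes step: "\<And>k. w (Suc k) = w k \<or> {w k, w (Suc k)} \<in> edges G"
    and fin: "\<And>k. finite {m. w m = w k}"
  obtains r where "r \<in> rays G" "\<And>A. ev w A \<Longrightarrow> ev r A"
proof -
  define last where "last k = Max {m. w m = w k}" for k
  have w_last: "w (last k) = w k" for k
    using Max_in[OF fin[of k]] unfolding last_def by blast
  have last_ge: "m \<le> last k" if "w m = w k" for m k
    using Max_ge[OF fin[of k]] that unfolding last_def by blast
  define t where "t = rec_nat (last 0) (\<lambda>_ k. last (Suc k))"
  have t_0: "t 0 = last 0" and t_Suc: "t (Suc i) = last (Suc (t i))" for i by (simp_all add: t_def)
  have t_less: "t i < t (Suc i)" for i using last_ge[of "Suc (t i)" "Suc (t i)"] t_Suc[of i] by simp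
  then have mono: "strict_mono t" by (rule strict_mono_Suc_iff[THEN iffD2, OF allI])
  have last_cong: "last k = last l" if "w k = w l" for k l using that by (simp add: last_def)
  have t_last: "last (t i) = t i" for i
    by (cases i) (simp_all add: t_0 t_Suc last_cong[OF w_last])
  define r where "r i = w (t i)" for i
  have "r i \<noteq> r j" if "i < j" for i j
  proof
    assume "r i = r j"
    then have "t j \<le> last (t i)" using last_ge[of "t j" "t i"] by (simp add: r_def)
    then show False using t_last[of i] strict_monoD[OF mono that] by simp
  qed
  then have "inj r" by (metis injI linorder_neqE_nat)
  moreover have "{r i, r (Suc i)} \<in> edges G" for i
  proof -
    have "w (Suc (t i)) \<noteq> w (t i)"
    proof
      assume "w (Suc (t i)) = w (t i)"
      from last_ge[OF this] show False using t_last[of i] by simp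
    qed
    then show ?thesis using step[of "t i"] w_last[of "Suc (t i)"] by (simp add: r_def t_Suc)
  qed
  ultimately have "r \<in> rays G" by (simp add: rays_def)
  moreover have "ev r A" if "ev w A" for A
    unfolding r_def by (rule eventually_subseq[OF mono that])
  ultimately show ?thesis by (rule that)
qed

text \<open>Choose a vertex \<open>c n\<close> in each of the sets and walk inside \<open>C n\<close> from \<open>c n\<close> to \<open>c (n + 1)\<close>, for one \<open>n\<close> after the other.\<close>

lemma connected_sets_walk:
  fixes C :: "nat \<Rightarrow> 'a set"
  assumes decr: "\<And>n. C (Suc n) \<subseteq> C n" and ne: "\<And>n. C n \<noteq> {}" and conn: "\<And>n. connected_set (C n)"
  obtains w where "\<And>k. w (Suc k) = w k \<or> {w k, w (Suc k)} \<in> edges G" "\<And>n. ev w (C n)"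
proof -
  define c where "c n = (SOME x. x \<in> C n)" for n
  have c: "c n \<in> C n" for n using ne[of n] unfolding c_def by (simp add: some_in_eq)
  have decr': "C m \<subseteq> C n" if "n \<le> m" for m n by (rule lift_Suc_antimono_le[of C, OF decr that])
  \<comment> \<open>In state \<open>(n, x)\<close> the walk is at \<open>x \<in> C n\<close> on a shortest way in \<open>C n\<close> to \<open>c (n + 1)\<close>.\<close>
  define E where "E n = (\<lambda>x y. x \<in> C n \<and> y \<in> C n \<and> {x, y} \<in> edges G)" for n
  define D where "D n x = (LEAST k. (E n ^^ k) x (c (Suc n)))" for n x
  have path: "\<exists>k. (E n ^^ k) x (c (Suc n))" if "x \<in> C n" for n x
  proof -
    have "reach G (- C n) x (c (Suc n))" using conn[of n] that c[of "Suc n"] decr[of n] by (auto simp: connected_set_def)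
    then have "(E n)\<^sup>*\<^sup>* x (c (Suc n))" by (simp add: reach_def E_def)
    then show ?thesis by (rule rtranclp_imp_relpowp)
  qed
  have closer: "\<exists>y. E n x y \<and> D n y < D n x" if x: "x \<in> C n" "x \<noteq> c (Suc n)" for n x
  proof -
    have D: "(E n ^^ D n x) x (c (Suc n))" unfolding D_def by (rule LeastI_ex[OF path[OF x(1)]])
    then obtain k where k: "D n x = Suc k" using x(2) by (cases "D n x") auto
    obtain y where y: "E n x y" "(E n ^^ k) y (c (Suc n))"
      using relpowp_Suc_D2[of k "E n"] D unfolding k by blast
    have "D n y \<le> k" unfolding D_def[of n y] by (rule Least_le, rule y(2))
    then show ?thesis using y(1) k by auto
  qed
  define nxt where "nxt = (\<lambda>(n, x). if x = c (Suc n) then (Suc n, x)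
      else (n, SOME y. E n x y \<and> D n y < D n x))"
  define s where "s k = (nxt ^^ k) (0, c 0)" for k
  have s_Suc: "s (Suc k) = nxt (s k)" for k by (simp add: s_def)
  have nxt_stay: "E n x (snd (nxt (n, x)))" "D n (snd (nxt (n, x))) < D n x" "fst (nxt (n, x)) = n"
    if "x \<in> C n" "x \<noteq> c (Suc n)" for n x
    using someI_ex[OF closer[OF that]] that by (auto simp: nxt_def)
  have inv: "snd (s k) \<in> C (fst (s k))" for k
  proof (induction k)
    case (Suc k)
    obtain n x where nx: "s k = (n, x)" by fastforce
    show ?case
    proof (cases "x = c (Suc n)")
      case True
      then show ?thesis using c[of "Suc n"] by (simp add: s_Suc nx nxt_def)
    next
      case False
      then show ?thesis using nxt_stay[of x n] Suc by (simp add: s_Suc nx E_def)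
    qed
  qed (simp add: s_def c)
  have fst_mono: "fst (s k) \<le> fst (s l)" if "k \<le> l" for k l
  proof (rule lift_Suc_mono_le[OF _ that])
    show "fst (s k) \<le> fst (s (Suc k))" for k by (simp add: s_Suc nxt_def split: prod.split)
  qed
  have advance: "\<exists>l. fst (s l) = Suc n" if "s k = (n, x)" for k n x
    using that
  proof (induction "D n x" arbitrary: k x rule: less_induct)
    case less
    have x: "x \<in> C n" using inv[of k] less.prems by simp
    show ?case
    proof (cases "x = c (Suc n)")
      case True
      then have "fst (s (Suc k)) = Suc n" by (simp add: s_Suc less.prems nxt_def)
      then show ?thesis by blast
    next
      case False
      have "s (Suc k) = (n, snd (nxt (n, x)))"
        using nxt_stay(3)[OF x False] by (simp add: s_Suc less.prems prod_eq_iff)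
      then show ?thesis using less.hyps[OF nxt_stay(2)[OF x False]] by blast
    qed
  qed
  have reaches: "\<exists>k. fst (s k) = n" for n
  proof (induction n)
    case 0
    have "fst (s 0) = 0" by (simp add: s_def)
    then show ?case by blast
  next
    case (Suc n)
    then obtain k where "fst (s k) = n" by blast
    then have "s k = (n, snd (s k))" by auto
    then show ?case by (rule advance)
  qed
  define w where "w k = snd (s k)" for k
  have "w (Suc k) = w k \<or> {w k, w (Suc k)} \<in> edges G" for k
  proof -
    obtain n x where nx: "s k = (n, x)" by fastforce
    have x: "x \<in> C n" using inv[of k] nx by simp
    show ?thesis
    proof (cases "x = c (Suc n)")
      case True
      then show ?thesis by (simp add: w_def s_Suc nx nxt_def)
    next
      case False
      then show ?thesis using nxt_stay(1)[OF x] by (simp add: w_def s_Suc nx E_def)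
    qed
  qed
  moreover have "ev w (C n)" for n
  proof -
    obtain k where "fst (s k) = n" using reaches by blast
    then have "w l \<in> C n" if "k \<le> l" for l
      using decr'[OF fst_mono[OF that]] inv[of l] by (auto simp: w_def)
    then show ?thesis unfolding eventually_sequentially by blast
  qed
  ultimately show ?thesis by (rule that)
qed

text \<open>The walk through these sets visits every vertex only finitely often, so that erasing its loops gives a ray. In this way
  a decreasing sequence of connected sets with empty intersection determines an end.\<close>

lemma connected_sets_ray:
  fixes C :: "nat \<Rightarrow> 'a set"
  assumes decr: "\<And>n. C (Suc n) \<subseteq> C n" and ne: "\<And>n. C n \<noteq> {}" and conn: "\<And>n. connected_set (C n)"
    and empty: "(\<Inter>n. C n) = {}"
  obtains r where "r \<in> rays G" "\<And>n. ev r (C n)"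
proof -
  obtain w where w: "\<And>k. w (Suc k) = w k \<or> {w k, w (Suc k)} \<in> edges G" "\<And>n. ev w (C n)"
    using connected_sets_walk[of C, OF decr ne conn] by metis
  have "finite {m. w m = w k}" for k
  proof -
    obtain n where n: "w k \<notin> C n" using empty by blast
    obtain N where N: "\<And>m. m \<ge> N \<Longrightarrow> w m \<in> C n" using w(2)[of n] unfolding eventually_sequentially by blast
    have "{m. w m = w k} \<subseteq> {..<N}"
    proof
      fix m assume "m \<in> {m. w m = w k}"
      then have "w m \<notin> C n" using n by simp
      then have "\<not> N \<le> m" using N by blast
      then show "m \<in> {..<N}" by simp
    qed
    then show ?thesis by (rule finite_subset) simp
  qed
  then obtain r where r: "r \<in> rays G" "\<And>A. ev w A \<Longrightarrow> ev r A"
    using walk_loop_erasure[of w, OF w(1)] by metis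
  show ?thesis by (rule that[OF r(1) r(2)[OF w(2)]])
qed

end

section \<open>The topology of \<open>MTOP(G)\<close>\<close>

context graph
begin

text \<open>The generating sets of \<open>MTOP(G)\<close> are described by inequalities for coordinates and masses. In this
  form they can be compared with the balls of a length metric.\<close>

lemma open_star_eq:
  assumes "v \<in> verts G" "0 < \<epsilon>" "\<epsilon> < 1"
  shows "open_star G v \<epsilon> = {p \<in> points G. p v > 1 - \<epsilon>}"
proof (intro equalityI subsetI)
  fix p assume "p \<in> open_star G v \<epsilon>"
  then consider "p = vertex v" | w t where "p = seg v w t" "{v, w} \<in> edges G" "0 \<le> t" "t < \<epsilon>"
    unfolding open_star_def by blast
  then show "p \<in> {p \<in> points G. p v > 1 - \<epsilon>}"
  proof cases
    case 1
    have "vertex v v = (1::real)" by (simp add: vertex_def)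
    then show ?thesis using 1 assms by (simp add: vertex_in_points)
  next
    case 2
    then show ?thesis using assms edge_vertsD(3)[OF 2(2)] seg_in_points[OF 2(2), of t] by (simp add: seg_apply)
  qed
next
  fix p assume "p \<in> {p \<in> points G. p v > 1 - \<epsilon>}"
  then have p: "p \<in> points G" "p v > 1 - \<epsilon>" by auto
  then have pos: "p v > 0" using assms by linarith
  consider "p = vertex v" | w where "{v, w} \<in> edges G" "p = seg v w (1 - p v)"
    using points_at(2)[OF p(1) pos] by blast
  then show "p \<in> open_star G v \<epsilon>"
  proof cases
    case 2
    have "0 \<le> 1 - p v" "1 - p v < \<epsilon>" using points_at(3)[OF p(1) pos] p(2) by auto
    then show ?thesis unfolding open_star_def using 2 by blast
  qed (simp add: open_star_def)
qed

lemma open_edge_part_eq: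
  assumes e: "{u, v} \<in> edges G" and T: "T \<subseteq> {0<..<1}"
  shows "seg u v ` T = {p \<in> points G. p u > 0 \<and> p v > 0 \<and> p v \<in> T}"
proof (intro equalityI subsetI)
  fix p assume "p \<in> seg u v ` T"
  then obtain t where t: "t \<in> T" "p = seg u v t" by blast
  then have "0 < t" "t < 1" using T by auto
  then show "p \<in> {p \<in> points G. p u > 0 \<and> p v > 0 \<and> p v \<in> T}"
    using t edge_vertsD(3)[OF e] seg_in_points[OF e, of t] by (simp add: seg_apply)
next
  fix p assume "p \<in> {p \<in> points G. p u > 0 \<and> p v > 0 \<and> p v \<in> T}"
  then have p: "p \<in> points G" "p u > 0" "p v > 0" "p v \<in> T" by auto
  show "p \<in> seg u v ` T"
    by (rule image_eqI[where x = "p v"], rule points_between(2)[OF p(1-3) edge_vertsD(3)[OF e]], rule p(4))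
qed

lemma end_nbhd_eq:
  assumes S: "finite S" "S \<subseteq> verts G" and \<omega>: "\<omega> \<in> vertex_ends G" and \<epsilon>: "0 < \<epsilon>"
  shows "end_nbhd G S \<omega> \<epsilon> =
    {p \<in> points G. mass (end_component G S \<omega>) p > max 0 (1 - \<epsilon>)} <+>
    {\<omega>' \<in> vertex_ends G. end_component G S \<omega>' = end_component G S \<omega>}"
proof -
  define C where "C = end_component G S \<omega>"
  have C: "C \<in> components_minus G S" unfolding C_def by (rule end_component(1)[OF \<omega> S])
  have "induced_points G C \<union>
      {seg c s t | c s t. c \<in> C \<and> s \<in> S \<and> {c, s} \<in> edges G \<and> 0 < t \<and> t < 1 \<and> t < \<epsilon>} =
      {p \<in> points G. mass C p > max 0 (1 - \<epsilon>)}" (is "?I \<union> ?E = ?M")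
  proof (intro equalityI subsetI)
    fix p assume "p \<in> ?I \<union> ?E"
    then consider v where "v \<in> C" "p = vertex v" | e where "e \<in> edges G" "e \<subseteq> C" "p \<in> edge_points e"
      | c s t where "c \<in> C" "s \<in> S" "{c, s} \<in> edges G" "0 < t" "t < 1" "t < \<epsilon>" "p = seg c s t"
      unfolding induced_points_def by blast
    then show "p \<in> ?M"
    proof cases
      case 1
      then show ?thesis using component_sub[OF C] \<epsilon> by (auto simp: vertex_in_points)
    next
      case 2
      obtain u v where uv: "e = {u, v}" using simple_graph_edgeE[OF simple 2(1)] by metis
      then obtain t where "p = seg u v t" using 2(3) unfolding uv edge_points_pair by blast
      then have "mass C p = 1" using uv 2 edge_vertsD(3)[of u v] by (simp add: mass_seg)
      then show ?thesis using 2 edge_points_subset[OF 2(1)] \<epsilon> by auto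
    next
      case 3
      have "s \<notin> C" using component_sub[OF C] 3 by blast
      then have "mass C p = 1 - t" using 3 edge_vertsD(3)[OF 3(3)] by (simp add: mass_seg)
      then show ?thesis using 3 seg_in_points[OF 3(3), of t] by simp
    qed
  next
    fix p assume "p \<in> ?M"
    then have p: "p \<in> points G" "mass C p > max 0 (1 - \<epsilon>)" by auto
    from p(1) show "p \<in> ?I \<union> ?E"
    proof (cases rule: points_cases)
      case (1 v)
      then have "v \<in> C" using p(2) by (auto split: if_splits)
      then show ?thesis using 1 by (simp add: induced_points_def)
    next
      case (2 u v t)
      have uv: "u \<noteq> v" by (rule edge_vertsD(3)[OF 2(1)])
      have m: "mass C p = (1 - t) * of_bool (u \<in> C) + t * of_bool (v \<in> C)"
        unfolding 2(4) by (rule mass_seg[OF uv])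
      consider "u \<in> C" "v \<in> C" | "u \<in> C" "v \<notin> C" | "u \<notin> C" "v \<in> C" | "u \<notin> C" "v \<notin> C" by blast
      then show ?thesis
      proof cases
        case c: 1
        have "p \<in> edge_points {u, v}" using 2 by (simp add: edge_points_pair)
        then show ?thesis using c 2 unfolding induced_points_def by blast
      next
        case c: 2
        then have "v \<in> S" using component_leave[OF C _ 2(1)] by blast
        moreover have "t < \<epsilon>" using p(2) m c by simp
        ultimately show ?thesis using c 2 by blast
      next
        case c: 3
        have e: "{v, u} \<in> edges G" using 2(1) by (simp add: insert_commute)
        then have "u \<in> S" using component_leave[OF C _ e] c by blast
        moreover have "1 - t < \<epsilon>" using p(2) m c by simp
        moreover have "p = seg v u (1 - t)" using 2(4) seg_commute by metis
        moreover have "0 < 1 - t" "1 - t < 1" using 2 by auto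
        ultimately show ?thesis using c e by blast
      next
        case 4
        then show ?thesis using p(2) m by simp
      qed
    qed
  qed
  moreover have "{\<omega>' \<in> vertex_ends G. \<exists>r\<in>\<omega>'. range r \<subseteq> C} = {\<omega>' \<in> vertex_ends G. end_component G S \<omega>' = C}"
    using ex_ray_in_component_iff[OF _ S C] by blast
  ultimately show ?thesis unfolding end_nbhd_def Let_def C_def[symmetric] by simp
qed

lemma mass_mono: assumes "p \<in> points G" "A \<subseteq> B" shows "mass A p \<le> mass B p"
  using mass_Diff[OF assms] mass_bounds(1)[OF assms(1), of "B - A"] by linarith

text \<open>As the basic neighbourhoods of an end decrease when \<open>S\<close> grows and \<open>\<epsilon>\<close> shrinks, they form a neighbourhood base, although the
  topology is only generated by them.\<close>

lemma end_nbhd_antimono: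
  assumes \<omega>: "\<omega> \<in> vertex_ends G" and S: "finite S" "S \<subseteq> verts G" "finite S'" "S' \<subseteq> verts G" "S \<subseteq> S'"
    and \<epsilon>: "0 < \<epsilon>'" "\<epsilon>' \<le> \<epsilon>"
  shows "end_nbhd G S' \<omega> \<epsilon>' \<subseteq> end_nbhd G S \<omega> \<epsilon>"
proof -
  let ?C = "end_component G S \<omega>" and ?C' = "end_component G S' \<omega>"
  note C = end_component[OF \<omega> S(1,2)] and C' = end_component[OF \<omega> S(3,4)]
  obtain r where r: "r \<in> \<omega>" using vertex_endsD(1)[OF \<omega>] by blast
  have sub: "?C' \<subseteq> ?C"
  proof
    fix v assume v: "v \<in> ?C'"
    obtain n where n: "r n \<in> ?C" "r n \<in> ?C'" using ev_meet[OF C(2)[OF r] C'(2)[OF r]] by blast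
    have "reach G S (r n) v" by (rule reach_mono[OF component_reach[OF C'(1) n(2) v] S(5)])
    then show "v \<in> ?C" by (rule component_closed[OF C(1) n(1)])
  qed
  have "end_component G S \<omega>' = ?C" if \<omega>': "\<omega>' \<in> vertex_ends G" "end_component G S' \<omega>' = ?C'" for \<omega>'
  proof -
    obtain q where q: "q \<in> \<omega>'" using vertex_endsD(1)[OF \<omega>'(1)] by blast
    have "ev q ?C'" using end_component(2)[OF \<omega>'(1) S(3,4) q] \<omega>'(2) by simp
    then have "ev q ?C" by (rule eventually_mono) (use sub in blast)
    then show ?thesis by (rule end_component_eq[OF \<omega>'(1) S(1,2) C(1) q])
  qed
  moreover have "max 0 (1 - \<epsilon>) < mass ?C p" if "p \<in> points G" "max 0 (1 - \<epsilon>') < mass ?C' p" for p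
    using mass_mono[OF that(1) sub] that(2) \<epsilon> by simp
  moreover have "0 < \<epsilon>" using \<epsilon> by simp
  ultimately show ?thesis
    unfolding end_nbhd_eq[OF S(1,2) \<omega> \<open>0 < \<epsilon>\<close>] end_nbhd_eq[OF S(3,4) \<omega> \<epsilon>(1)] by auto
qed

definition MTOP_base :: "(('a \<Rightarrow> real) + (nat \<Rightarrow> 'a) set) set set" where
  "MTOP_base = {Inl ` seg u v ` T | u v T. {u, v} \<in> edges G \<and> open T \<and> T \<subseteq> {0<..<1}} \<union>
      {Inl ` open_star G v \<epsilon> | v \<epsilon>. v \<in> verts G \<and> 0 < \<epsilon> \<and> \<epsilon> < 1} \<union>
      {end_nbhd G S \<omega> \<epsilon> | S \<omega> \<epsilon>. finite S \<and> S \<subseteq> verts G \<and> \<omega> \<in> vertex_ends G \<and> 0 < \<epsilon>}"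

lemma MTOP_base_cases [consumes 1, case_names edge star vend]:
  assumes "B \<in> MTOP_base"
  obtains u v T where "{u, v} \<in> edges G" "open T" "T \<subseteq> {0<..<1}" "B = Inl ` seg u v ` T"
  | v \<epsilon> where "v \<in> verts G" "0 < \<epsilon>" "\<epsilon> < 1" "B = Inl ` open_star G v \<epsilon>"
  | S \<omega> \<epsilon> where "finite S" "S \<subseteq> verts G" "\<omega> \<in> vertex_ends G" "0 < \<epsilon>" "B = end_nbhd G S \<omega> \<epsilon>"
  using assms unfolding MTOP_base_def Un_iff mem_Collect_eq
proof (elim disjE exE conjE)
  fix u v T assume a: "B = Inl ` seg u v ` T" "{u, v} \<in> edges G" "open T" "T \<subseteq> {0<..<1}"
  show thesis by (rule that(1)[OF a(2,3,4,1)])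
next
  fix v \<epsilon> assume a: "B = Inl ` open_star G v \<epsilon>" "v \<in> verts G" "0 < \<epsilon>" "\<epsilon> < 1"
  show thesis by (rule that(2)[OF a(2,3,4,1)])
next
  fix S \<omega> \<epsilon> assume a: "B = end_nbhd G S \<omega> \<epsilon>" "finite S" "S \<subseteq> verts G" "\<omega> \<in> vertex_ends G" "0 < \<epsilon>"
  show thesis by (rule that(3)[OF a(2,3,4,5,1)])
qed

lemma openin_MTOP_iff: "openin (MTOP G) U \<longleftrightarrow> generate_topology_on MTOP_base U"
  unfolding MTOP_def MTOP_base_def by (rule openin_topology_generated_by_iff)

lemma openin_MTOP_base: "B \<in> MTOP_base \<Longrightarrow> openin (MTOP G) B"
  unfolding openin_MTOP_iff by (rule generate_topology_on.Basis)

lemma openin_MTOP_edge: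
  "{u, v} \<in> edges G \<Longrightarrow> open T \<Longrightarrow> T \<subseteq> {0<..<1} \<Longrightarrow> openin (MTOP G) (Inl ` seg u v ` T)"
  by (rule openin_MTOP_base) (auto simp: MTOP_base_def)

lemma openin_MTOP_star:
  "v \<in> verts G \<Longrightarrow> 0 < \<epsilon> \<Longrightarrow> \<epsilon> < 1 \<Longrightarrow> openin (MTOP G) (Inl ` open_star G v \<epsilon>)"
  by (rule openin_MTOP_base) (auto simp: MTOP_base_def)

lemma openin_MTOP_end:
  "finite S \<Longrightarrow> S \<subseteq> verts G \<Longrightarrow> \<omega> \<in> vertex_ends G \<Longrightarrow> 0 < \<epsilon> \<Longrightarrow> openin (MTOP G) (end_nbhd G S \<omega> \<epsilon>)"
  by (rule openin_MTOP_base) (auto simp: MTOP_base_def)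

lemma end_in_nbhd:
  "finite S \<Longrightarrow> S \<subseteq> verts G \<Longrightarrow> \<omega> \<in> vertex_ends G \<Longrightarrow> 0 < \<epsilon> \<Longrightarrow> Inr \<omega> \<in> end_nbhd G S \<omega> \<epsilon>"
  by (simp add: end_nbhd_eq InrI)

lemma MTOP_end_nbhd:
  assumes "openin (MTOP G) U" "Inr \<omega> \<in> U" "\<omega> \<in> vertex_ends G"
  obtains S \<epsilon> where "finite S" "S \<subseteq> verts G" "0 < \<epsilon>" "end_nbhd G S \<omega> \<epsilon> \<subseteq> U"
proof -
  have "\<exists>S \<epsilon>. finite S \<and> S \<subseteq> verts G \<and> 0 < \<epsilon> \<and> end_nbhd G S \<omega> \<epsilon> \<subseteq> U"
    using assms(1)[unfolded openin_MTOP_iff] assms(2)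
  proof induction
    case (Int A B)
    obtain S \<epsilon> where S: "finite S" "S \<subseteq> verts G" "0 < \<epsilon>" "end_nbhd G S \<omega> \<epsilon> \<subseteq> A" using Int by blast
    obtain S' \<epsilon>' where S': "finite S'" "S' \<subseteq> verts G" "0 < \<epsilon>'" "end_nbhd G S' \<omega> \<epsilon>' \<subseteq> B" using Int by blast
    have "end_nbhd G (S \<union> S') \<omega> (min \<epsilon> \<epsilon>') \<subseteq> end_nbhd G S \<omega> \<epsilon>"
      by (rule end_nbhd_antimono[OF assms(3)]) (use S S' in auto)
    moreover have "end_nbhd G (S \<union> S') \<omega> (min \<epsilon> \<epsilon>') \<subseteq> end_nbhd G S' \<omega> \<epsilon>'"
      by (rule end_nbhd_antimono[OF assms(3)]) (use S S' in auto)
    ultimately have "end_nbhd G (S \<union> S') \<omega> (min \<epsilon> \<epsilon>') \<subseteq> A \<inter> B" using S(4) S'(4) by blast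
    then show ?case using S S' by (intro exI[of _ "S \<union> S'"] exI[of _ "min \<epsilon> \<epsilon>'"]) auto
  next
    case (UN K)
    then obtain k where k: "k \<in> K" "Inr \<omega> \<in> k" by blast
    obtain S \<epsilon> where "finite S" "S \<subseteq> verts G" "0 < \<epsilon>" "end_nbhd G S \<omega> \<epsilon> \<subseteq> k" using UN.IH[OF k] by blast
    then show ?case using k(1) by blast
  next
    case (Basis B)
    from Basis(1) show ?case
    proof (cases rule: MTOP_base_cases)
      case (vend S \<omega>' \<epsilon>)
      have "end_component G S \<omega> = end_component G S \<omega>'"
        using Basis(2) unfolding vend(5) end_nbhd_eq[OF vend(1-4)] by auto
      then have "end_nbhd G S \<omega> \<epsilon> = B"
        unfolding vend(5) end_nbhd_eq[OF vend(1-4)] end_nbhd_eq[OF vend(1,2) assms(3) vend(4)] by simp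
      then show ?thesis using vend by blast
    qed (use Basis(2) in auto)
  qed simp
  then show ?thesis using that by blast
qed

lemma points_Union_stars:
  "Inl ` points G = (\<Union>(v, \<epsilon>)\<in>{(v, \<epsilon>). v \<in> verts G \<and> 0 < \<epsilon> \<and> \<epsilon> < 1}. Inl ` open_star G v \<epsilon>)" (is "_ = ?U")
proof (intro equalityI subsetI)
  fix x :: "('a \<Rightarrow> real) + 'b" assume "x \<in> Inl ` points G"
  then obtain p where p: "p \<in> points G" "x = Inl p" by blast
  obtain v where v: "p v > 0" using points_ex_pos[OF p(1)] by blast
  \<comment> \<open>The star of this radius consists of the points whose coordinate at \<open>v\<close> exceeds \<open>p v / 2\<close>.\<close>
  let ?\<epsilon> = "1 - p v / 2"
  have \<epsilon>: "v \<in> verts G" "0 < ?\<epsilon>" "?\<epsilon> < 1" using v points_at(1,3)[OF p(1) v] by auto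
  have "p \<in> open_star G v ?\<epsilon>" using p(1) v by (simp add: open_star_eq[OF \<epsilon>])
  then have "x \<in> Inl ` open_star G v ?\<epsilon>" using p(2) by blast
  then show "x \<in> ?U" using \<epsilon> by blast
next
  fix x :: "('a \<Rightarrow> real) + 'b" assume "x \<in> ?U"
  then obtain v \<epsilon> where v: "v \<in> verts G" "0 < \<epsilon>" "\<epsilon> < 1" "x \<in> Inl ` open_star G v \<epsilon>" by blast
  then show "x \<in> Inl ` points G" using open_star_eq[OF v(1-3)] by blast
qed

lemma openin_MTOP_points: "openin (MTOP G) (Inl ` points G)"
  unfolding points_Union_stars
proof (rule openin_Union)
  fix B :: "(('a \<Rightarrow> real) + (nat \<Rightarrow> 'a) set) set"
  assume "B \<in> (\<lambda>(v, \<epsilon>). Inl ` open_star G v \<epsilon>) ` {(v, \<epsilon>). v \<in> verts G \<and> 0 < \<epsilon> \<and> \<epsilon> < 1}"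
  then obtain v \<epsilon> where "v \<in> verts G" "0 < \<epsilon>" "\<epsilon> < 1" "B = Inl ` open_star G v \<epsilon>" by blast
  then show "openin (MTOP G) B" using openin_MTOP_star by simp
qed

lemma topspace_MTOP: "topspace (MTOP G) = Inl ` points G \<union> Inr ` vertex_ends G"
proof (intro equalityI subsetI)
  fix x assume "x \<in> topspace (MTOP G)"
  then have "x \<in> \<Union> MTOP_base" unfolding MTOP_def MTOP_base_def by (simp only: topology_generated_by_topspace)
  then obtain B where B: "B \<in> MTOP_base" "x \<in> B" by blast
  from B(1) show "x \<in> Inl ` points G \<union> Inr ` vertex_ends G"
  proof (cases rule: MTOP_base_cases)
    case (edge u v T)
    then show ?thesis using B(2) open_edge_part_eq[OF edge(1,3)] by blast
  next
    case (star v \<epsilon>)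
    then show ?thesis using B(2) open_star_eq[OF star(1-3)] by blast
  next
    case (vend S \<omega> \<epsilon>)
    then show ?thesis using B(2) end_nbhd_eq[OF vend(1-4)] by auto
  qed
next
  fix x assume "x \<in> Inl ` points G \<union> Inr ` vertex_ends G"
  then consider "x \<in> Inl ` points G" | \<omega> where "\<omega> \<in> vertex_ends G" "x = Inr \<omega>" by blast
  then show "x \<in> topspace (MTOP G)"
  proof cases
    case 1
    then show ?thesis using openin_subset[OF openin_MTOP_points] by blast
  next
    case 2
    then have "x \<in> end_nbhd G {} \<omega> 1" using end_in_nbhd by simp
    then show ?thesis using openin_subset[OF openin_MTOP_end[of "{}" \<omega> 1]] 2 by auto
  qed
qed

definition dispersed :: "'a set \<Rightarrow> bool" where
  "dispersed A \<longleftrightarrow> (\<forall>\<omega>\<in>vertex_ends G. \<exists>S. finite S \<and> S \<subseteq> verts G \<and> end_component G S \<omega> \<inter> A = {})"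

text \<open>The set of ends is closed, hence a \<open>G\<^sub>\<delta>\<close> set if the space is metrizable. So its complement is a countable union
  of closed sets, and the vertices in a closed set that contains no end are dispersed.\<close>

lemma metrizable_imp_countably_dispersed:
  assumes "metrizable_space (MTOP G)"
  obtains V :: "nat \<Rightarrow> 'a set" where "\<And>n. dispersed (V n)" "(\<Union>n. V n) = verts G"
proof -
  have "fsigma_in (MTOP G) (Inl ` points G)"
    by (rule open_imp_fsigma_in[OF assms openin_MTOP_points])
  then obtain F :: "nat \<Rightarrow> (('a \<Rightarrow> real) + (nat \<Rightarrow> 'a) set) set" where F: "\<And>n. closedin (MTOP G) (F n)" "\<Union> (range F) = Inl ` points G"
    unfolding fsigma_in_ascending by blast
  define V where "V n = {v \<in> verts G. Inl (vertex v) \<in> F n}" for n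
  have "dispersed (V n)" for n
    unfolding dispersed_def
  proof
    fix \<omega> assume \<omega>: "\<omega> \<in> vertex_ends G"
    have open': "openin (MTOP G) (topspace (MTOP G) - F n)" using F(1) by blast
    have "Inr \<omega> \<notin> F n" using F(2) by blast
    then have "Inr \<omega> \<in> topspace (MTOP G) - F n" using \<omega> by (simp add: topspace_MTOP)
    then obtain S \<epsilon> where S: "finite S" "S \<subseteq> verts G" "0 < \<epsilon>" "end_nbhd G S \<omega> \<epsilon> \<subseteq> topspace (MTOP G) - F n"
      by (rule MTOP_end_nbhd[OF open' _ \<omega>])
    have "end_component G S \<omega> \<inter> V n = {}"
    proof (rule ccontr)
      assume "\<not> ?thesis"
      then obtain v where v: "v \<in> end_component G S \<omega>" "v \<in> V n" by blast
      then have "Inl (vertex v) \<in> end_nbhd G S \<omega> \<epsilon>"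
        unfolding end_nbhd_eq[OF S(1,2) \<omega> S(3)] using S(3) by (auto simp: V_def vertex_in_points)
      then show False using v(2) S(4) by (auto simp: V_def)
    qed
    then show "\<exists>S. finite S \<and> S \<subseteq> verts G \<and> end_component G S \<omega> \<inter> V n = {}" using S by blast
  qed
  moreover have "(\<Union>n. V n) = verts G"
  proof (intro equalityI subsetI)
    fix v assume v: "v \<in> verts G"
    then have "Inl (vertex v) \<in> \<Union> (range F)" unfolding F(2) by (simp add: vertex_in_points)
    then show "v \<in> (\<Union>n. V n)" using v by (auto simp: V_def)
  qed (auto simp: V_def)
  ultimately show ?thesis by (rule that)
qed

end

section \<open>Normal partitions\<close>

context graph
begin

lemma connected_set_hub:
  assumes "h \<in> A" "\<And>x. x \<in> A \<Longrightarrow> reach G (- A) h x" shows "connected_set A"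
  unfolding connected_set_def using assms reach_trans reach_sym by blast

lemma finite_connected_subset:
  assumes "reach G (- C) c u"
  shows "\<exists>K. finite K \<and> K \<subseteq> C \<and> connected_set K \<and> c \<in> K \<and> u \<in> K"
  using assms
proof (induction rule: reach_induct)
  case refl
  have "c \<in> verts G" "c \<in> C" using reachD[OF assms] by auto
  then have "connected_set {c}" by (intro connected_set_hub[of c]) (auto intro: reach_refl)
  then show ?case using \<open>c \<in> C\<close> by (intro exI[of _ "{c}"]) auto
next
  case (step w z)
  then obtain K where K: "finite K" "K \<subseteq> C" "connected_set K" "c \<in> K" "w \<in> K" by blast
  have reach: "reach G (- insert z K) c x" if "x \<in> K" for x
  proof -
    have "reach G (- K) c x" using K that by (simp add: connected_set_def)
    then show ?thesis by (rule reach_mono) auto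
  qed
  have "reach G (- insert z K) c z" by (rule reach_step[OF reach[OF K(5)] step.hyps(2)]) simp
  then have "connected_set (insert z K)" using reach K(4) by (intro connected_set_hub[of c]) auto
  then show ?case using K step.hyps(4) by (intro exI[of _ "insert z K"]) auto
qed

lemma connected_set_leave:
  assumes "connected_set C" "a \<in> C" "a \<in> A" "b \<in> C" "b \<notin> A"
  shows "\<exists>x y. x \<in> C \<and> x \<in> A \<and> y \<in> C \<and> y \<notin> A \<and> {x, y} \<in> edges G"
proof (rule ccontr)
  assume none: "\<not> ?thesis"
  have "reach G (- C) a b" using assms by (simp add: connected_set_def)
  then have "b \<in> A"
  proof (induction rule: reach_induct)
    case (step w z)
    then show ?case using none by blast
  qed (rule assms(3))
  then show False using assms(5) by blast
qed

lemma component_superset: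
  assumes "C \<in> components_minus G S'" "S \<subseteq> S'"
  obtains D where "D \<in> components_minus G S" "C \<subseteq> D"
proof -
  obtain v where v: "v \<in> C" using component_nonempty[OF assms(1)] by blast
  have "{w. reach G S v w} \<in> components_minus G S"
    using v component_sub[OF assms(1)] assms(2) by (intro component_of) auto
  moreover have "C \<subseteq> {w. reach G S v w}"
    using component_reach[OF assms(1) v] reach_mono[OF _ assms(2)] by blast
  ultimately show ?thesis by (rule that)
qed

text \<open>A partition of the vertex set into finite connected parts that are arranged like the vertices of a normal
  spanning tree: \<open>W n\<close> is the union of the parts of height less than \<open>n\<close>, every component of \<open>G - W n\<close> contains
  exactly one part of height \<open>n\<close>, and if \<open>n > 0\<close>, then this part has an edge to a part of height \<open>n - 1\<close>. As every edge
  that leaves such a component ends in one of the \<open>n\<close> parts below it, its neighbourhood is finite.\<close>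

definition normal_partition :: "(nat \<Rightarrow> 'a set) \<Rightarrow> bool" where
  "normal_partition W \<longleftrightarrow> W 0 = {} \<and> (\<forall>n. W n \<subseteq> W (Suc n)) \<and> (\<Union>n. W n) = verts G \<and>
    (\<forall>n. \<forall>C\<in>components_minus G (W n).
       finite (C \<inter> W (Suc n)) \<and> C \<inter> W (Suc n) \<noteq> {} \<and> connected_set (C \<inter> W (Suc n))) \<and>
    (\<forall>n. \<forall>C\<in>components_minus G (W (Suc n)).
       \<exists>c\<in>C \<inter> W (Suc (Suc n)). \<exists>z\<in>W (Suc n) - W n. {c, z} \<in> edges G)"

text \<open>Here \<open>B - A\<close> is the union of the parts of the last level. A walk in \<open>C\<close> from a vertex of the first set \<open>V i\<close> that
  meets \<open>C\<close> to a neighbour of \<open>B - A\<close> is a suitable part.\<close>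

lemma part_exists:
  fixes V :: "nat \<Rightarrow> 'a set"
  assumes C: "C \<in> components_minus G B" and V: "(\<Union>i. V i) = verts G"
  shows "\<exists>K. finite K \<and> K \<subseteq> C \<and> K \<noteq> {} \<and> connected_set K \<and> K \<inter> V (LEAST i. C \<inter> V i \<noteq> {}) \<noteq> {} \<and>
    ((\<exists>c\<in>C. \<exists>z\<in>B - A. {c, z} \<in> edges G) \<longrightarrow> (\<exists>c\<in>K. \<exists>z\<in>B - A. {c, z} \<in> edges G))"
proof -
  obtain v where v: "v \<in> C" "v \<in> verts G" using component_nonempty[OF C] component_sub[OF C] by blast
  then obtain i where "C \<inter> V i \<noteq> {}" using V by blast
  then have "C \<inter> V (LEAST i. C \<inter> V i \<noteq> {}) \<noteq> {}" by (rule LeastI)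
  then obtain u where u: "u \<in> C" "u \<in> V (LEAST i. C \<inter> V i \<noteq> {})" by blast
  obtain c where c: "c \<in> C" "(\<exists>c\<in>C. \<exists>z\<in>B - A. {c, z} \<in> edges G) \<longrightarrow> (\<exists>z\<in>B - A. {c, z} \<in> edges G)"
    using v(1) by blast
  have "reach G (- C) c u" using component_connected[OF C] c(1) u(1) by (simp add: connected_set_def)
  then obtain K where "finite K" "K \<subseteq> C" "connected_set K" "c \<in> K" "u \<in> K"
    using finite_connected_subset[of C c u] by metis
  then show ?thesis using u(2) c(2) by (intro exI[of _ K] conjI) blast+
qed

text \<open>The parts are chosen level by level, in such a way that the first of the sets \<open>V i\<close> that meets a component
  gets served. If a vertex were left over for ever, then the same \<open>V i\<close> would be served infinitely often along
  a sequence of parts that converges to an end. This end could not be separated from \<open>V i\<close>.\<close>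

theorem normal_partition_exists:
  fixes V :: "nat \<Rightarrow> 'a set"
  assumes disp: "\<And>i. dispersed (V i)" and V: "(\<Union>i. V i) = verts G"
  obtains W where "normal_partition W"
proof -
  define idx where "idx C = (LEAST i. C \<inter> V i \<noteq> {})" for C
  define part where "part A B C = (SOME K. finite K \<and> K \<subseteq> C \<and> K \<noteq> {} \<and> connected_set K \<and> K \<inter> V (idx C) \<noteq> {} \<and>
    ((\<exists>c\<in>C. \<exists>z\<in>B - A. {c, z} \<in> edges G) \<longrightarrow> (\<exists>c\<in>K. \<exists>z\<in>B - A. {c, z} \<in> edges G)))" for A B C
  \<comment> \<open>The state \<open>(P n, W n)\<close> of the recursion keeps the previous set, because new parts are attached to \<open>W n - P n\<close>.\<close>
  define st where "st = rec_nat ({}, {}) (\<lambda>_ (A, B). (B, B \<union> \<Union> (part A B ` components_minus G B)))"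
  define P where "P n = fst (st n)" for n
  define W where "W n = snd (st n)" for n
  define K where "K n C = part (P n) (W n) C" for n C
  have W_0: "W 0 = {}" and P_Suc: "P (Suc n) = W n"
    and W_Suc: "W (Suc n) = W n \<union> (\<Union>C\<in>components_minus G (W n). K n C)" for n
    by (simp_all add: W_def P_def K_def st_def split: prod.split)
  have K: "finite (K n C)" "K n C \<subseteq> C" "K n C \<noteq> {}" "connected_set (K n C)" "K n C \<inter> V (idx C) \<noteq> {}"
    "(\<exists>c\<in>C. \<exists>z\<in>W n - P n. {c, z} \<in> edges G) \<longrightarrow> (\<exists>c\<in>K n C. \<exists>z\<in>W n - P n. {c, z} \<in> edges G)"
    if "C \<in> components_minus G (W n)" for n C
    using someI_ex[OF part_exists[OF that V, of "P n"]] unfolding K_def part_def idx_def by blast+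
  have W_mono: "W n \<subseteq> W (Suc n)" for n using W_Suc by blast
  have W_mono': "W m \<subseteq> W n" if "m \<le> n" for m n by (rule lift_Suc_mono_le[of W, OF W_mono that])
  have part: "C \<inter> W (Suc n) = K n C" if C: "C \<in> components_minus G (W n)" for n C
  proof (intro equalityI subsetI)
    fix v assume v: "v \<in> C \<inter> W (Suc n)"
    then have "v \<notin> W n" using component_sub[OF C] by blast
    then obtain D where D: "D \<in> components_minus G (W n)" "v \<in> K n D" using v W_Suc by blast
    then have "C = D" using component_unique[OF C D(1), of v] v K(2)[OF D(1)] by blast
    then show "v \<in> K n C" using D by simp
  next
    fix v assume "v \<in> K n C"
    then show "v \<in> C \<inter> W (Suc n)" using K(2)[OF C] C W_Suc by blast
  qed
  have attach: "\<exists>c\<in>C \<inter> W (Suc (Suc n)). \<exists>z\<in>W (Suc n) - W n. {c, z} \<in> edges G"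
    if C: "C \<in> components_minus G (W (Suc n))" for n C
  proof -
    obtain D where D: "D \<in> components_minus G (W n)" "C \<subseteq> D" by (rule component_superset[OF C W_mono])
    obtain a where a: "a \<in> C" using component_nonempty[OF C] by blast
    obtain b where b: "b \<in> D" "b \<in> W (Suc n)" using K(3)[OF D(1)] part[OF D(1)] by blast
    have "b \<notin> C" using b component_sub[OF C] by blast
    then obtain c z where cz: "c \<in> C" "z \<in> D" "z \<notin> C" "{c, z} \<in> edges G"
      using connected_set_leave[OF component_connected[OF D(1)], of a C b] a b(1) D(2) by blast
    have "z \<in> W (Suc n)" by (rule component_leave[OF C cz(1,4,3)])
    moreover have "z \<notin> W n" using cz(2) component_sub[OF D(1)] by blast
    ultimately have "\<exists>c\<in>C. \<exists>z\<in>W (Suc n) - P (Suc n). {c, z} \<in> edges G" using cz unfolding P_Suc by blast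
    then have "\<exists>c\<in>K (Suc n) C. \<exists>z\<in>W (Suc n) - W n. {c, z} \<in> edges G" using K(6)[OF C] unfolding P_Suc by blast
    then show ?thesis unfolding part[OF C] .
  qed
  have W_verts: "W n \<subseteq> verts G" for n
  proof (induction n)
    case (Suc n)
    have "K n C \<subseteq> verts G" if "C \<in> components_minus G (W n)" for C
      using K(2)[OF that] component_sub[OF that] by blast
    then show ?case using Suc W_Suc[of n] by blast
  qed (simp add: W_0)
  have "verts G \<subseteq> (\<Union>n. W n)"
  proof (rule ccontr)
    assume "\<not> verts G \<subseteq> (\<Union>n. W n)"
    then obtain v where v: "v \<in> verts G" "\<And>n. v \<notin> W n" by blast
    \<comment> \<open>The parts in the components that contain a vertex \<open>v\<close> outside of all \<open>W n\<close> would converge to an end, and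
      from some point on all of them would meet the same set \<open>V i\<close>.\<close>
    define C where "C n = {w. reach G (W n) v w}" for n
    have C: "C n \<in> components_minus G (W n)" for n unfolding C_def by (rule component_of[OF v])
    have vC: "v \<in> C n" for n unfolding C_def using reach_refl[OF v] by simp
    have C_decr: "C (Suc n) \<subseteq> C n" for n unfolding C_def using reach_mono[OF _ W_mono] by blast
    have idx_le: "idx (C n) \<le> idx (C m)" if "n \<le> m" for n m
    proof -
      have "C m \<subseteq> C n" by (rule lift_Suc_antimono_le[of C, OF C_decr that])
      moreover have "C m \<inter> V (idx (C m)) \<noteq> {}" using K(2,5)[OF C] by blast
      ultimately have "C n \<inter> V (idx (C m)) \<noteq> {}" by blast
      then show ?thesis unfolding idx_def[of "C n"] by (rule Least_le)
    qed
    obtain j where j: "v \<in> V j" using v(1) V by blast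
    have "idx (C n) \<le> j" for n
    proof -
      have "C n \<inter> V j \<noteq> {}" using j vC by blast
      then show ?thesis unfolding idx_def by (rule Least_le)
    qed
    then have "range (\<lambda>n. idx (C n)) \<subseteq> {..j}" by auto
    then have fin: "finite (range (\<lambda>n. idx (C n)))" by (rule finite_subset) simp
    have "Max (range (\<lambda>n. idx (C n))) \<in> range (\<lambda>n. idx (C n))" by (rule Max_in[OF fin]) simp
    then obtain N where N': "Max (range (\<lambda>n. idx (C n))) = idx (C N)" by (rule rangeE)
    have "idx (C n) \<le> idx (C N)" for n unfolding N'[symmetric] by (rule Max_ge[OF fin]) simp
    then have N: "idx (C n) = idx (C N)" if "N \<le> n" for n using idx_le[OF that] order_antisym by blast
    define Q where "Q n = K n (C n)" for n
    have Q: "finite (Q n)" "Q n \<subseteq> C n" "Q n \<noteq> {}" "connected_set (Q n)" "Q n \<inter> V (idx (C n)) \<noteq> {}" "Q n = C n \<inter> W (Suc n)" for n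
      using K[OF C[of n]] part[OF C[of n]] unfolding Q_def by blast+
    have Q_link: "\<exists>c\<in>Q (Suc n). \<exists>z\<in>Q n. {c, z} \<in> edges G" for n
    proof -
      obtain c z where cz: "c \<in> Q (Suc n)" "z \<in> W (Suc n)" "z \<notin> W n" "{c, z} \<in> edges G"
        using attach[OF C[of "Suc n"]] unfolding Q(6) by blast
      have "c \<in> C n" using cz(1) Q(2) C_decr by blast
      then have "z \<in> C n" using component_leave[OF C _ cz(4)] cz(3) by blast
      then show ?thesis using cz Q(6)[of n] by blast
    qed
    define D where "D n = (\<Union>m\<in>{n..}. Q m)" for n
    have D_decr: "D (Suc n) \<subseteq> D n" for n unfolding D_def by (rule UN_mono) auto
    have D_decr': "D m \<subseteq> D n" if "n \<le> m" for n m by (rule lift_Suc_antimono_le[of D, OF D_decr that])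
    have QD: "Q m \<subseteq> D n" if "n \<le> m" for n m unfolding D_def using that by blast
    have D_ne: "D n \<noteq> {}" for n using QD[of n n] Q(3)[of n] by blast
    have D_conn: "connected_set (D n)" for n
    proof -
      obtain h where h: "h \<in> Q n" using Q(3) by blast
      have inQ: "reach G (- D n) x y" if "x \<in> Q m" "y \<in> Q m" "n \<le> m" for x y m
      proof -
        have "reach G (- Q m) x y" using Q(4)[of m] that by (simp add: connected_set_def)
        then show ?thesis by (rule reach_mono) (use QD[OF that(3)] in blast)
      qed
      have "\<forall>x\<in>Q m. reach G (- D n) h x" if "n \<le> m" for m
        using that
      proof (induction m rule: dec_induct)
        case base
        then show ?case using inQ[OF h] by blast
      next
        case (step m)
        obtain c z where cz: "c \<in> Q (Suc m)" "z \<in> Q m" "{c, z} \<in> edges G" using Q_link by blast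
        have cD: "c \<in> D n" using QD[of n "Suc m"] cz(1) step.hyps by auto
        have "reach G (- D n) h z" using step.IH cz(2) by blast
        then have "reach G (- D n) h c" by (rule reach_step) (use cz(3) cD in \<open>auto simp: insert_commute\<close>)
        then show ?case using reach_trans inQ[OF cz(1)] step.hyps by (meson le_SucI)
      qed
      then have "reach G (- D n) h x" if "x \<in> D n" for x using that unfolding D_def by blast
      moreover have "h \<in> D n" using QD[of n n] h by blast
      ultimately show ?thesis by (intro connected_set_hub)
    qed
    have D_escape: "\<exists>n. x \<notin> D n" for x
    proof (cases "x \<in> D 0")
      case True
      then obtain m where m: "x \<in> Q m" unfolding D_def by blast
      have "x \<notin> Q m'" if "Suc m \<le> m'" for m'
      proof
        assume "x \<in> Q m'"
        then have "x \<notin> W m'" using Q(2) component_sub[OF C] by blast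
        moreover have "x \<in> W m'" using m Q(6)[of m] W_mono'[OF that] by blast
        ultimately show False by blast
      qed
      then have "x \<notin> D (Suc m)" unfolding D_def by auto
      then show ?thesis by blast
    qed blast
    then have "(\<Inter>n. D n) = {}" by blast
    then obtain r where r: "r \<in> rays G" "\<And>n. ev r (D n)"
      using connected_sets_ray[of D, OF D_decr D_ne D_conn] by metis
    define E where "E = end_of r"
    have E: "E \<in> vertex_ends G" "r \<in> E" using end_of[OF r(1)] by (auto simp: E_def)
    obtain S where S: "finite S" "S \<subseteq> verts G" "end_component G S E \<inter> V (idx (C N)) = {}"
      using bspec[OF disp[of "idx (C N)", unfolded dispersed_def] E(1)] by metis
    obtain f where f: "\<And>x. x \<notin> D (f x)" using D_escape by metis
    define n where "n = Max (insert N (f ` S))"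
    have n: "N \<le> n" "\<And>x. x \<in> S \<Longrightarrow> f x \<le> n" using S(1) by (auto simp: n_def intro!: Max_ge)
    have DS: "D n \<inter> S = {}"
    proof (rule ccontr)
      assume "\<not> ?thesis"
      then obtain x where "x \<in> D n" "x \<in> S" by blast
      then show False using D_decr'[OF n(2)] f by blast
    qed
    note EC = end_component[OF E(1) S(1,2)]
    obtain k where k: "r k \<in> D n" "r k \<in> end_component G S E"
      using ev_meet[OF r(2) EC(2)[OF E(2)]] by blast
    have "D n \<subseteq> end_component G S E"
    proof
      fix x assume "x \<in> D n"
      then have "reach G (- D n) (r k) x" using D_conn[of n] k(1) by (simp add: connected_set_def)
      then have "reach G S (r k) x" by (rule reach_mono) (use DS in blast)
      then show "x \<in> end_component G S E" by (rule component_closed[OF EC(1) k(2)])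
    qed
    moreover have "Q n \<inter> V (idx (C N)) \<noteq> {}" using Q(5)[of n] N[OF n(1)] by simp
    ultimately show False using S(3) QD[of n n] by blast
  qed
  then have "(\<Union>n. W n) = verts G" using W_verts by blast
  then have "normal_partition W"
    unfolding normal_partition_def using W_0 W_mono K(1,3,4) part attach by auto
  then show ?thesis by (rule that)
qed

end

section \<open>Edge lengths from a normal partition\<close>

locale normally_partitioned_graph =
  fixes G :: "'a ugraph" and W :: "nat \<Rightarrow> 'a set"
  assumes conn: "connected_graph G"
    and part: "graph.normal_partition G W"

sublocale normally_partitioned_graph \<subseteq> graph
  by unfold_locales (rule connected_graph_simple[OF conn])

context normally_partitioned_graph
begin

lemma W_0: "W 0 = {}" and W_Suc: "W n \<subseteq> W (Suc n)" and W_UN: "(\<Union>n. W n) = verts G"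
  and part_finite: "C \<in> components_minus G (W n) \<Longrightarrow> finite (C \<inter> W (Suc n))"
  and part_nonempty: "C \<in> components_minus G (W n) \<Longrightarrow> C \<inter> W (Suc n) \<noteq> {}"
  and part_connected: "C \<in> components_minus G (W n) \<Longrightarrow> connected_set (C \<inter> W (Suc n))"
  and part_attached: "C \<in> components_minus G (W (Suc n)) \<Longrightarrow>
       \<exists>c\<in>C \<inter> W (Suc (Suc n)). \<exists>z\<in>W (Suc n) - W n. {c, z} \<in> edges G"
  using part unfolding normal_partition_def by auto

lemma W_mono: "m \<le> n \<Longrightarrow> W m \<subseteq> W n"
  by (rule lift_Suc_mono_le[of W, OF W_Suc])

definition comp :: "nat \<Rightarrow> 'a \<Rightarrow> 'a set" where
  "comp n v = {w. reach G (W n) v w}"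

lemma comp: "v \<in> verts G \<Longrightarrow> v \<notin> W n \<Longrightarrow> comp n v \<in> components_minus G (W n)"
  and comp_self: "v \<in> verts G \<Longrightarrow> v \<notin> W n \<Longrightarrow> v \<in> comp n v"
  by (auto simp: comp_def intro: component_of reach_refl)

lemma comp_eq: "C \<in> components_minus G (W n) \<Longrightarrow> v \<in> C \<Longrightarrow> comp n v = C"
  unfolding comp_def by (rule component_eq[symmetric])

lemma comp_eq_lower:
  assumes "C \<in> components_minus G (W n)" "u \<in> C" "v \<in> C" "i \<le> n" shows "comp i u = comp i v"
proof -
  obtain D where "D \<in> components_minus G (W i)" "C \<subseteq> D" by (rule component_superset[OF assms(1) W_mono[OF assms(4)]])
  then show ?thesis using comp_eq assms(2,3) by blast
qed

definition lev :: "'a \<Rightarrow> nat" where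
  "lev v = (LEAST n. v \<in> W (Suc n))"

lemma lev: assumes "v \<in> verts G" shows "v \<in> W (Suc (lev v))" "v \<notin> W (lev v)"
proof -
  obtain m where m: "v \<in> W m" using assms W_UN by blast
  then have "v \<in> W (Suc m)" using W_Suc by blast
  then show "v \<in> W (Suc (lev v))" unfolding lev_def by (rule LeastI)
  show "v \<notin> W (lev v)"
  proof (cases "lev v")
    case 0
    then show ?thesis by (simp add: W_0)
  next
    case (Suc k)
    then have "k < (LEAST n. v \<in> W (Suc n))" by (simp add: lev_def)
    from not_less_Least[OF this] show ?thesis using Suc by simp
  qed
qed

text \<open>A part is finite and connected, so there is a bound for the lengths of shortest walks in it.\<close>

definition hop_bound :: "nat \<Rightarrow> 'a set \<Rightarrow> nat" where
  "hop_bound n C = (SOME N. \<forall>x\<in>C \<inter> W (Suc n). \<forall>y\<in>C \<inter> W (Suc n). \<exists>k\<le>N.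
     ((\<lambda>x y. x \<in> C \<inter> W (Suc n) \<and> y \<in> C \<inter> W (Suc n) \<and> {x, y} \<in> edges G) ^^ k) x y)"

lemma hop_bound:
  assumes "C \<in> components_minus G (W n)" "x \<in> C \<inter> W (Suc n)" "y \<in> C \<inter> W (Suc n)"
  shows "\<exists>k\<le>hop_bound n C. ((\<lambda>x y. x \<in> C \<inter> W (Suc n) \<and> y \<in> C \<inter> W (Suc n) \<and> {x, y} \<in> edges G) ^^ k) x y"
proof -
  let ?K = "C \<inter> W (Suc n)"
  let ?E = "\<lambda>x y. x \<in> ?K \<and> y \<in> ?K \<and> {x, y} \<in> edges G"
  have "\<exists>k. (?E ^^ k) x y" if "x \<in> ?K" "y \<in> ?K" for x y
  proof -
    have "reach G (- ?K) x y" using part_connected[OF assms(1)] that by (simp only: connected_set_def)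
    then have "?E\<^sup>*\<^sup>* x y" by (simp add: reach_def)
    then show ?thesis by (rule rtranclp_imp_relpowp)
  qed
  note walk = this
  define f where "f x y = (SOME k. (?E ^^ k) x y)" for x y
  have f: "(?E ^^ f x y) x y" if "x \<in> ?K" "y \<in> ?K" for x y
    unfolding f_def by (rule someI_ex[OF walk[OF that]])
  let ?N = "Max ((\<lambda>(x, y). f x y) ` (?K \<times> ?K))"
  have fin: "finite ((\<lambda>(x, y). f x y) ` (?K \<times> ?K))" using part_finite[OF assms(1)] by blast
  have "\<forall>x\<in>?K. \<forall>y\<in>?K. \<exists>k\<le>?N. (?E ^^ k) x y"
  proof (intro ballI)
    fix x y assume xy: "x \<in> ?K" "y \<in> ?K"
    have "f x y \<le> ?N" by (rule Max_ge[OF fin]) (use xy in blast)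
    then show "\<exists>k\<le>?N. (?E ^^ k) x y" using f[OF xy] by blast
  qed
  then have "\<forall>x\<in>?K. \<forall>y\<in>?K. \<exists>k\<le>hop_bound n C. (?E ^^ k) x y"
    unfolding hop_bound_def by (rule someI)
  then show ?thesis using assms(2,3) by blast
qed

definition part_len :: "nat \<Rightarrow> 'a set \<Rightarrow> real" where
  "part_len n C = (1/2) ^ n / (1 + real (hop_bound n C))"

lemma part_len_pos: "0 < part_len n C"
  by (simp add: part_len_def add_pos_nonneg)

lemma part_len_le: "part_len n C \<le> (1/2) ^ n" 
  unfolding part_len_def by (simp add: divide_le_eq mult_le_cancel_left1)

lemma hop_bound_part_len: "real (hop_bound n C) * part_len n C \<le> (1/2) ^ n"
proof -
  have "real (hop_bound n C) / (1 + real (hop_bound n C)) \<le> 1" by simp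
  then have "(1/2) ^ n * (real (hop_bound n C) / (1 + real (hop_bound n C))) \<le> (1/2) ^ n * 1"
    by (intro mult_left_mono) auto
  then show ?thesis by (simp add: part_len_def mult.commute)
qed

text \<open>The length of an edge is determined by the lower one of the parts that it meets, or by the only one: it lies in a
  component above that part, whichever of its vertices is used to find this component.\<close>

definition part_edge_len :: "'a set \<Rightarrow> real" where
  "part_edge_len e = (let n = Min (lev ` e) in part_len n (comp n (SOME v. v \<in> e)))"

lemma part_edge_len_cases:
  assumes e: "{u, v} \<in> edges G"
  obtains n where "u \<notin> W n" "v \<notin> W n" "u \<in> W (Suc n) \<or> v \<in> W (Suc n)"
    "comp n u = comp n v" "part_edge_len {u, v} = part_len n (comp n u)"
proof -
  define n where "n = Min (lev ` {u, v})"
  have uv: "u \<in> verts G" "v \<in> verts G" using edge_vertsD[OF e] by auto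
  have n: "n \<le> lev u" "n \<le> lev v" "n = lev u \<or> n = lev v" by (auto simp: n_def min_def)
  have out: "u \<notin> W n" "v \<notin> W n" using lev(2)[OF uv(1)] lev(2)[OF uv(2)] W_mono[OF n(1)] W_mono[OF n(2)] by blast+
  have "u \<in> W (Suc n) \<or> v \<in> W (Suc n)" using n(3) lev(1)[OF uv(1)] lev(1)[OF uv(2)] by metis
  moreover have "v \<in> comp n u" unfolding comp_def using reach_edge[OF e out] by simp
  then have eq: "comp n u = comp n v" using comp_eq[OF comp[OF uv(1) out(1)]] by simp
  moreover have "(SOME w. w \<in> {u, v}) \<in> {u, v}" by (rule someI[of _ u]) simp
  then have "(SOME w. w \<in> {u, v}) = u \<or> (SOME w. w \<in> {u, v}) = v" by blast
  then have "comp n (SOME w. w \<in> {u, v}) = comp n u" using eq by metis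
  then have "part_edge_len {u, v} = part_len n (comp n u)" by (simp only: part_edge_len_def Let_def n_def[symmetric])
  ultimately show ?thesis using that out by blast
qed

lemma part_edge_len_pos: assumes "e \<in> edges G" shows "0 < part_edge_len e"
proof -
  obtain u v where uv: "e = {u, v}" using simple_graph_edgeE[OF simple assms] by metis
  then obtain n where "part_edge_len {u, v} = part_len n (comp n u)"
    using part_edge_len_cases[of u v] assms by metis
  then show ?thesis using part_len_pos uv by simp
qed

lemma part_edge_len_le:
  assumes e: "{u, v} \<in> edges G" and "u \<notin> W n" "v \<notin> W n" shows "part_edge_len {u, v} \<le> (1/2) ^ n"
proof -
  obtain m where m: "u \<in> W (Suc m) \<or> v \<in> W (Suc m)" "part_edge_len {u, v} = part_len m (comp m u)"
    using part_edge_len_cases[OF e] by metis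
  have "n \<le> m"
  proof (rule ccontr)
    assume "\<not> n \<le> m"
    then have "W (Suc m) \<subseteq> W n" by (intro W_mono) simp
    then show False using m(1) assms by blast
  qed
  then have "(1/2 :: real) ^ m \<le> (1/2) ^ n" by (intro power_decreasing) auto
  then show ?thesis using part_len_le[of m "comp m u"] m(2) by linarith
qed

lemma part_edge_len_le_1: "{u, v} \<in> edges G \<Longrightarrow> part_edge_len {u, v} \<le> 1"
  using part_edge_len_le[of u v 0] by (simp add: W_0)

lemma part_edge_len_eq:
  assumes e: "{u, v} \<in> edges G" and C: "C \<in> components_minus G (W n)" "u \<in> C" "v \<in> C" and u: "u \<in> W (Suc n)"
  shows "part_edge_len {u, v} = part_len n C"
proof -
  obtain m where m: "u \<notin> W m" "v \<notin> W m" "u \<in> W (Suc m) \<or> v \<in> W (Suc m)" "part_edge_len {u, v} = part_len m (comp m u)"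
    using part_edge_len_cases[OF e] by metis
  have out: "u \<notin> W n" "v \<notin> W n" using component_sub[OF C(1)] C by auto
  have "m = n"
  proof (rule antisym)
    show "m \<le> n"
    proof (rule ccontr)
      assume "\<not> m \<le> n"
      then have "W (Suc n) \<subseteq> W m" by (intro W_mono) simp
      then show False using m(1) u by blast
    qed
    show "n \<le> m"
    proof (rule ccontr)
      assume "\<not> n \<le> m"
      then have "W (Suc m) \<subseteq> W n" by (intro W_mono) simp
      then show False using m(3) out by blast
    qed
  qed
  then show ?thesis using m(4) comp_eq[OF C(1,2)] by simp
qed

text \<open>As there are only finitely many parts below a vertex, edge lengths at a vertex are bounded from below,
  and so are the lengths of the edges that leave a component.\<close>

definition low :: "nat \<Rightarrow> 'a \<Rightarrow> real" where
  "low n v = Min ((\<lambda>i. part_len i (comp i v)) ` {..n})"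

lemma low_pos: "0 < low n v"
  unfolding low_def by (subst Min_gr_iff) (auto simp: part_len_pos)

lemma low_cong: "C \<in> components_minus G (W n) \<Longrightarrow> u \<in> C \<Longrightarrow> v \<in> C \<Longrightarrow> low n u = low n v"
  unfolding low_def using comp_eq_lower[of C n u v] by (intro arg_cong[where f = Min] image_cong) auto

lemma low_le:
  assumes e: "{u, v} \<in> edges G" and v: "v \<in> W (Suc n)"
  shows "low n u \<le> part_edge_len {u, v}" "low n v \<le> part_edge_len {u, v}"
proof -
  obtain m where m: "u \<notin> W m" "v \<notin> W m" "comp m u = comp m v" "part_edge_len {u, v} = part_len m (comp m u)"
    using part_edge_len_cases[OF e] by metis
  have "m \<le> n"
  proof (rule ccontr)
    assume "\<not> m \<le> n"
    then have "W (Suc n) \<subseteq> W m" by (intro W_mono) simp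
    then show False using m(2) v by blast
  qed
  then have "low n w \<le> part_len m (comp m w)" for w unfolding low_def by (intro Min_le) auto
  from this[of u] this[of v] show "low n u \<le> part_edge_len {u, v}" "low n v \<le> part_edge_len {u, v}"
    using m(3,4) by simp_all
qed

definition low_at :: "'a set \<Rightarrow> real" where
  "low_at S = Min (insert 1 ((\<lambda>s. low (lev s) s) ` S))"

lemma low_at_pos: "finite S \<Longrightarrow> 0 < low_at S"
  unfolding low_at_def by (subst Min_gr_iff) (auto simp: low_pos)

lemma low_at_le:
  assumes "finite S" "{u, v} \<in> edges G" "v \<in> S" shows "low_at S \<le> part_edge_len {u, v}"
proof -
  have "low_at S \<le> low (lev v) v" unfolding low_at_def using assms by (intro Min_le) auto
  also have "\<dots> \<le> part_edge_len {u, v}"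
    by (rule low_le(2)[OF assms(2) lev(1)[OF edge_vertsD(2)[OF assms(2)]]])
  finally show ?thesis .
qed

end

sublocale normally_partitioned_graph \<subseteq> weighted_connected_graph G part_edge_len
  by unfold_locales (use conn part_edge_len_pos in auto)

context normally_partitioned_graph
begin

lemma L_part:
  assumes C: "C \<in> components_minus G (W n)" and xy: "x \<in> C \<inter> W (Suc n)" "y \<in> C \<inter> W (Suc n)"
  shows "L (vertex x) (vertex y) \<le> (1/2) ^ n"
proof -
  let ?K = "C \<inter> W (Suc n)"
  let ?E = "\<lambda>x y. x \<in> ?K \<and> y \<in> ?K \<and> {x, y} \<in> edges G"
  have K: "?K \<subseteq> verts G" using component_sub[OF C] by blast
  have "L (vertex x) (vertex z) \<le> real k * part_len n C" if "(?E ^^ k) x z" "z \<in> ?K" for k z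
    using that
  proof (induction k arbitrary: z)
    case 0
    then show ?case using L_refl[OF vertex_in_points, of x] xy(1) K by auto
  next
    case (Suc k)
    then obtain w where w: "(?E ^^ k) x w" "w \<in> ?K" "z \<in> ?K" "{w, z} \<in> edges G" by auto
    have "L (vertex x) (vertex z) \<le> L (vertex x) (vertex w) + L (vertex w) (vertex z)"
      using xy(1) w K by (intro L_triangle vertex_in_points) auto
    moreover have "L (vertex w) (vertex z) \<le> part_len n C"
      using L_edge[OF w(4)] part_edge_len_eq[OF w(4) C] w by simp
    ultimately show ?case using Suc.IH[OF w(1,2)] by (simp add: algebra_simps)
  qed note hops = this
  obtain k where k: "k \<le> hop_bound n C" "(?E ^^ k) x y" using hop_bound[OF C xy] by blast
  have "L (vertex x) (vertex y) \<le> real k * part_len n C" by (rule hops[OF k(2) xy(2)])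
  also have "\<dots> \<le> real (hop_bound n C) * part_len n C"
    using k(1) part_len_pos[of n C] by (intro mult_right_mono) auto
  also have "\<dots> \<le> (1/2) ^ n" by (rule hop_bound_part_len)
  finally show ?thesis .
qed

text \<open>If \<open>x\<close> is not in the part of \<open>C\<close>, then it is in a component \<open>D \<subseteq> C\<close> of \<open>G - W (n + 1)\<close>. The part of \<open>D\<close> is attached to
  the part of \<open>C\<close> by an edge of length at most \<open>(1/2)^n\<close>, and the part of \<open>C\<close> has diameter at most \<open>(1/2)^n\<close>. So the
  bound for \<open>D\<close> implies the bound for \<open>C\<close>, as \<open>4 * (1/2)^(n + 1) + 2 * (1/2)^n = 4 * (1/2)^n\<close>.\<close>

lemma L_to_part:
  assumes "C \<in> components_minus G (W n)" "x \<in> C" "y \<in> C \<inter> W (Suc n)" "lev x \<le> n + k"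
  shows "L (vertex x) (vertex y) \<le> 4 * (1/2) ^ n"
  using assms
proof (induction k arbitrary: n C y)
  case 0
  then have "x \<in> verts G" "x \<notin> W n" using component_sub by blast+
  have "W (Suc (lev x)) \<subseteq> W (Suc n)" using 0 by (intro W_mono) simp
  then have "x \<in> C \<inter> W (Suc n)" using lev(1)[OF \<open>x \<in> verts G\<close>] 0 by blast
  then have "L (vertex x) (vertex y) \<le> (1/2) ^ n" using L_part 0 by blast
  also have "\<dots> \<le> 4 * (1/2) ^ n" by simp
  finally show ?case .
next
  case (Suc k)
  note C = Suc.prems(1)
  have x: "x \<in> verts G" using component_sub[OF C] Suc.prems(2) by blast
  show ?case
  proof (cases "x \<in> W (Suc n)")
    case True
    then have "L (vertex x) (vertex y) \<le> (1/2) ^ n" using L_part[OF C] Suc.prems by blast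
    also have "\<dots> \<le> 4 * (1/2) ^ n" by simp
    finally show ?thesis .
  next
    case False
    define D where "D = comp (Suc n) x"
    have D: "D \<in> components_minus G (W (Suc n))" "x \<in> D" using comp comp_self x False by (auto simp: D_def)
    obtain C' where C': "C' \<in> components_minus G (W n)" "D \<subseteq> C'" by (rule component_superset[OF D(1) W_Suc])
    have "C' = C" using component_unique[OF C'(1) C] C'(2) D(2) Suc.prems(2) by blast
    then have DC: "D \<subseteq> C" using C' by simp
    obtain c z where cz: "c \<in> D \<inter> W (Suc (Suc n))" "z \<in> W (Suc n)" "z \<notin> W n" "{c, z} \<in> edges G"
      using part_attached[OF D(1)] by blast
    have "c \<in> C" using cz(1) DC by blast
    then have z: "z \<in> C \<inter> W (Suc n)" using component_leave[OF C _ cz(4)] cz(2,3) by blast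
    have "c \<notin> W n" using component_sub[OF C] \<open>c \<in> C\<close> by blast
    have 1: "L (vertex x) (vertex c) \<le> 4 * (1/2) ^ Suc n"
      by (rule Suc.IH[OF D cz(1)]) (use Suc.prems(4) in simp)
    have 2: "L (vertex c) (vertex z) \<le> (1/2) ^ n"
      using L_edge[OF cz(4)] part_edge_len_le[OF cz(4) \<open>c \<notin> W n\<close> cz(3)] by linarith
    have 3: "L (vertex z) (vertex y) \<le> (1/2) ^ n" by (rule L_part[OF C z Suc.prems(3)])
    have pts: "vertex c \<in> points G" "vertex z \<in> points G" "vertex y \<in> points G" "vertex x \<in> points G"
      using edge_vertsD[OF cz(4)] x Suc.prems(3) component_sub[OF C] by (auto intro: vertex_in_points)
    have "L (vertex x) (vertex y) \<le> 4 * (1/2) ^ Suc n + (1/2) ^ n + (1/2) ^ n"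
      using 1 2 3 L_triangle[OF pts(4,1,3)] L_triangle[OF pts(1,2,3)] by linarith
    then show ?thesis by simp
  qed
qed

text \<open>From any vertex of \<open>C\<close> one can pass from part to part down to the part in \<open>C\<close>, in steps that are bounded by a geometric
  series.\<close>

lemma L_component:
  assumes C: "C \<in> components_minus G (W n)" and xy: "x \<in> C" "y \<in> C"
  shows "L (vertex x) (vertex y) \<le> 8 * (1/2) ^ n"
proof -
  obtain a where a: "a \<in> C \<inter> W (Suc n)" using part_nonempty[OF C] by blast
  have "L (vertex x) (vertex a) \<le> 4 * (1/2) ^ n" by (rule L_to_part[OF C xy(1) a, of "lev x"]) simp
  moreover have "L (vertex y) (vertex a) \<le> 4 * (1/2) ^ n" by (rule L_to_part[OF C xy(2) a, of "lev y"]) simp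
  moreover have "L (vertex x) (vertex y) \<le> L (vertex x) (vertex a) + L (vertex a) (vertex y)"
    using xy a component_sub[OF C] by (intro L_triangle vertex_in_points) auto
  ultimately show ?thesis using L_sym[of "vertex a" "vertex y"] by linarith
qed

lemma L_near_component:
  assumes C: "C \<in> components_minus G (W n)" and p: "p \<in> points G" "mass C p > 0"
  obtains c where "c \<in> C" "L p (vertex c) \<le> max ((1/2) ^ n) (1 - mass C p)"
proof -
  have "\<exists>c\<in>C. L p (vertex c) \<le> max ((1/2) ^ n) (1 - mass C p)"
    using p(1)
  proof (cases rule: points_cases)
    case (1 v)
    then have "v \<in> C" using p(2) by (auto split: if_splits)
    then show ?thesis using L_refl[OF p(1)] 1 by (auto intro!: bexI[of _ v] simp: le_max_iff_disj)
  next
    case (2 u v t)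
    have one: "L (seg a b s) (vertex a) \<le> max ((1/2) ^ n) (1 - mass C (seg a b s))"
      if e: "{a, b} \<in> edges G" and s: "0 < s" "s < 1" and a: "a \<in> C" for a b s
    proof -
      have le: "L (seg a b s) (vertex a) \<le> part_edge_len {a, b} * s"
        using L_seg[OF e, of s 0] s by simp
      show ?thesis
      proof (cases "b \<in> C")
        case True
        then have "part_edge_len {a, b} \<le> (1/2) ^ n"
          using part_edge_len_le[OF e] component_sub[OF C] a by blast
        then have "part_edge_len {a, b} * s \<le> (1/2) ^ n * 1"
          using s by (intro mult_mono) auto
        then show ?thesis using le by simp
      next
        case False
        then have "mass C (seg a b s) = 1 - s" using a by (simp add: mass_seg edge_vertsD(3)[OF e])
        moreover have "part_edge_len {a, b} * s \<le> 1 * s"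
          using s part_edge_len_le_1[OF e] by (intro mult_right_mono) auto
        ultimately show ?thesis using le by simp
      qed
    qed
    have m: "mass C p = (1 - t) * of_bool (u \<in> C) + t * of_bool (v \<in> C)"
      unfolding 2(4) by (rule mass_seg[OF edge_vertsD(3)[OF 2(1)]])
    consider "u \<in> C" | "v \<in> C" using p(2) m by (cases "u \<in> C"; cases "v \<in> C") auto
    then show ?thesis
    proof cases
      case c: 1
      show ?thesis using one[OF 2(1-3) c] c unfolding 2(4)[symmetric] by blast
    next
      case c: 2
      have "{v, u} \<in> edges G" using 2(1) by (simp add: insert_commute)
      from one[OF this _ _ c, of "1 - t"] show ?thesis
        using c 2(2,3) unfolding seg_commute[of u v t, symmetric] 2(4)[symmetric] by auto
    qed
  qed
  then show ?thesis using that by blast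
qed

lemma L_ge_mass_component:
  assumes C: "C \<in> components_minus G S" "finite S" and xy: "x \<in> points G" "y \<in> points G"
  shows "low_at S * \<bar>mass C x - mass C y\<bar> \<le> L x y"
proof (rule L_ge_mass[OF _ _ xy])
  fix u v assume "{u, v} \<in> edges G" "u \<in> C" "v \<notin> C"
  then show "low_at S \<le> part_edge_len {u, v}" using component_leave[OF C(1)] low_at_le[OF C(2)] by blast
qed (use low_at_pos[OF C(2)] in simp)

lemma L_ge_coordinate:
  assumes xy: "x \<in> points G" "y \<in> points G" shows "low_at {u} * \<bar>x u - y u\<bar> \<le> L x y"
proof -
  have "low_at {u} * \<bar>mass {u} x - mass {u} y\<bar> \<le> L x y"
  proof (rule L_ge_mass[OF _ _ xy])
    fix a b assume e: "{a, b} \<in> edges G" "a \<in> {u}"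
    have "{b, a} \<in> edges G" using e(1) by (simp add: insert_commute)
    then show "low_at {u} \<le> part_edge_len {a, b}" using low_at_le[of "{u}" b a] e(2) by (simp add: insert_commute)
  qed (use low_at_pos[of "{u}"] in simp)
  then show ?thesis by (simp only: mass_singleton)
qed

end

section \<open>The completion of the length metric\<close>

context normally_partitioned_graph
begin

text \<open>A ray leaves the finite parts, one level after the other, and then stays in a component although \<open>W n\<close> may be infinite.\<close>

lemma ray_level_component:
  assumes r: "r \<in> rays G" shows "\<exists>C\<in>components_minus G (W n). ev r C"
proof (induction n)
  case 0
  then show ?case using ray_component[OF r, of "{}"] by (simp add: W_0)
next
  case (Suc n)
  then obtain C where C: "C \<in> components_minus G (W n)" "ev r C" by blast
  obtain N where N: "\<And>k. k \<ge> N \<Longrightarrow> r k \<in> C" using C(2) unfolding eventually_sequentially by blast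
  obtain N' where N': "\<And>k. k \<ge> N' \<Longrightarrow> r k \<notin> C \<inter> W (Suc n)"
    using ray_leaves_finite[OF r part_finite[OF C(1)]] by blast
  have out: "\<forall>k\<ge>max N N'. r k \<notin> W (Suc n)" using N N' by auto
  have "comp (Suc n) (r (max N N')) \<in> components_minus G (W (Suc n))"
    using out raysD(3)[OF r] by (intro comp) auto
  moreover have "ev r (comp (Suc n) (r (max N N')))"
    unfolding eventually_sequentially comp_def using ray_tail_reach[OF r out] by blast
  ultimately show ?case by blast
qed

text \<open>Edges between different parts join a part to one below it. So the edges that leave \<open>C\<close> end in
  the \<open>n\<close> parts below \<open>C\<close>, and the union of these is finite.\<close>

lemma component_finite_separator:
  assumes C: "C \<in> components_minus G (W n)"
  obtains S where "finite S" "S \<subseteq> verts G" "C \<in> components_minus G S"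
proof -
  obtain a where a: "a \<in> C" using component_nonempty[OF C] by blast
  have aG: "a \<in> verts G" "a \<notin> W n" using component_sub[OF C] a by auto
  define S where "S = (\<Union>i<n. comp i a \<inter> W (Suc i))"
  have a_out: "a \<notin> W i" if "i \<le> n" for i using W_mono[OF that] aG(2) by blast
  have D: "comp i a \<in> components_minus G (W i)" if "i \<le> n" for i by (rule comp[OF aG(1) a_out[OF that]])
  have "finite S" unfolding S_def using part_finite[OF D] by auto
  have SG: "S \<subseteq> verts G" unfolding S_def using W_UN by blast
  have SW: "S \<subseteq> W n" unfolding S_def using W_mono[of "Suc _" n] by (auto simp: Suc_le_eq)
  have "C \<in> components_minus G S"
  proof (rule componentI)
    show "C \<noteq> {}" using a by blast
    show "C \<subseteq> verts G - S" using component_sub[OF C] SW by blast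
    show "connected_set C" by (rule component_connected[OF C])
    fix u v assume uv: "u \<in> C" "{u, v} \<in> edges G" "v \<notin> C"
    have v: "v \<in> W n" by (rule component_leave[OF C uv])
    have vG: "v \<in> verts G" by (rule edge_vertsD(2)[OF uv(2)])
    define i where "i = lev v"
    have i: "v \<in> W (Suc i)" "v \<notin> W i" unfolding i_def by (rule lev[OF vG])+
    have "i < n"
    proof (rule ccontr)
      assume "\<not> i < n"
      then have "W n \<subseteq> W i" by (intro W_mono) simp
      then show False using v i(2) by blast
    qed
    have "u \<notin> W i" using component_sub[OF C] uv(1) W_mono[of i n] \<open>i < n\<close> by auto
    then have "v \<in> comp i u" unfolding comp_def using reach_edge[OF uv(2) _ i(2)] by simp
    also have "comp i u = comp i a" using comp_eq_lower[OF C uv(1) a] \<open>i < n\<close> by simp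
    finally show "v \<in> S" unfolding S_def using i(1) \<open>i < n\<close> by blast
  qed
  then show ?thesis using that \<open>finite S\<close> SG by blast
qed

lemma end_level_component:
  assumes \<omega>: "\<omega> \<in> vertex_ends G"
  obtains C S where "C \<in> components_minus G (W n)" "finite S" "S \<subseteq> verts G" "C \<in> components_minus G S"
    "end_component G S \<omega> = C" "\<And>r. r \<in> \<omega> \<Longrightarrow> ev r C"
proof -
  obtain r where r: "r \<in> \<omega>" using vertex_endsD(1)[OF \<omega>] by blast
  then obtain C where C: "C \<in> components_minus G (W n)" "ev r C"
    using ray_level_component vertex_endsD(2)[OF \<omega>] by blast
  obtain S where S: "finite S" "S \<subseteq> verts G" "C \<in> components_minus G S" by (rule component_finite_separator[OF C(1)])
  have eq: "end_component G S \<omega> = C" by (rule end_component_eq[OF \<omega> S r C(2)])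
  show ?thesis by (rule that[OF C(1) S eq]) (use end_component(2)[OF \<omega> S(1,2)] eq in blast)
qed

text \<open>A sequence of points for every point of \<open>MTOP(G)\<close>, which converges to it.\<close>

primrec approach :: "('a \<Rightarrow> real) + (nat \<Rightarrow> 'a) set \<Rightarrow> nat \<Rightarrow> 'a \<Rightarrow> real" where
  "approach (Inl x) = (\<lambda>n. x)"
| "approach (Inr \<omega>) = (\<lambda>n. vertex ((SOME r. r \<in> \<omega>) n))"

lemma approach_ray: "\<omega> \<in> vertex_ends G \<Longrightarrow> (SOME r. r \<in> \<omega>) \<in> \<omega>"
  using vertex_endsD(1)[of \<omega>] by (simp add: some_in_eq)

lemma approach_in_points: assumes "a \<in> topspace (MTOP G)" shows "approach a n \<in> points G"
proof -
  consider x where "x \<in> points G" "a = Inl x" | \<omega> where "\<omega> \<in> vertex_ends G" "a = Inr \<omega>"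
    using assms by (auto simp: topspace_MTOP)
  then show ?thesis
  proof cases
    case 2
    have "(SOME r. r \<in> \<omega>) \<in> rays G" using approach_ray[OF 2(1)] vertex_endsD(2)[OF 2(1)] by blast
    from raysD(3)[OF this] show ?thesis using 2(2) by (simp add: vertex_in_points)
  qed simp
qed

definition L_Cauchy :: "(nat \<Rightarrow> 'a \<Rightarrow> real) \<Rightarrow> bool" where
  "L_Cauchy p \<longleftrightarrow> (\<forall>n. p n \<in> points G) \<and> (\<forall>\<epsilon>>0. \<exists>N. \<forall>m\<ge>N. \<forall>n\<ge>N. L (p m) (p n) < \<epsilon>)"

lemma ex_power_half_less: "0 < (\<epsilon>::real) \<Longrightarrow> 0 < c \<Longrightarrow> \<exists>n. c * (1/2) ^ n < \<epsilon>"
proof -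
  assume "0 < \<epsilon>" "0 < c"
  then obtain n where "(1/2 :: real) ^ n < \<epsilon> / c" using real_arch_pow_inv[of "\<epsilon> / c" "1/2"] by auto
  then show ?thesis using \<open>0 < c\<close> by (intro exI[of _ n]) (simp add: field_simps)
qed

lemma ray_L_Cauchy:
  assumes r: "r \<in> rays G" shows "L_Cauchy (\<lambda>n. vertex (r n))"
  unfolding L_Cauchy_def
proof (intro conjI allI impI)
  show "vertex (r n) \<in> points G" for n using raysD(3)[OF r] by (rule vertex_in_points)
  fix \<epsilon> :: real assume "\<epsilon> > 0"
  then obtain n where n: "8 * (1/2) ^ n < \<epsilon>" using ex_power_half_less[of \<epsilon> 8] by auto
  obtain C where C: "C \<in> components_minus G (W n)" "ev r C" using ray_level_component[OF r] by blast
  obtain N where N: "\<And>k. k \<ge> N \<Longrightarrow> r k \<in> C" using C(2) unfolding eventually_sequentially by blast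
  have "L (vertex (r k)) (vertex (r l)) < \<epsilon>" if "k \<ge> N" "l \<ge> N" for k l
    using L_component[OF C(1) N[OF that(1)] N[OF that(2)]] n by linarith
  then show "\<exists>N. \<forall>k\<ge>N. \<forall>l\<ge>N. L (vertex (r k)) (vertex (r l)) < \<epsilon>" by blast
qed

lemma approach_L_Cauchy: assumes "a \<in> topspace (MTOP G)" shows "L_Cauchy (approach a)"
proof -
  consider x where "x \<in> points G" "a = Inl x" | \<omega> where "\<omega> \<in> vertex_ends G" "a = Inr \<omega>"
    using assms by (auto simp: topspace_MTOP)
  then show ?thesis
  proof cases
    case 1
    then show ?thesis by (auto simp: L_Cauchy_def L_refl)
  next
    case 2
    have "(SOME r. r \<in> \<omega>) \<in> rays G" using approach_ray[OF 2(1)] vertex_endsD(2)[OF 2(1)] by blast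
    from ray_L_Cauchy[OF this] show ?thesis using 2(2) by simp
  qed
qed

lemma approach_end_mass:
  assumes \<omega>: "\<omega> \<in> vertex_ends G" and S: "finite S" "S \<subseteq> verts G" and C: "C \<in> components_minus G S"
  shows "(\<lambda>n. mass C (approach (Inr \<omega>) n)) \<longlonglongrightarrow> of_bool (end_component G S \<omega> = C)"
proof -
  let ?D = "end_component G S \<omega>"
  note D = end_component[OF \<omega> S]
  have "ev (SOME r. r \<in> \<omega>) ?D" by (rule D(2)[OF approach_ray[OF \<omega>]])
  then have "\<forall>\<^sub>F n in sequentially. mass C (approach (Inr \<omega>) n) = of_bool (?D = C)"
  proof (rule eventually_mono)
    fix n assume n: "(SOME r. r \<in> \<omega>) n \<in> ?D"
    have "(SOME r. r \<in> \<omega>) n \<in> C \<longleftrightarrow> ?D = C" using n component_unique[OF D(1) C n] by blast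
    then show "mass C (approach (Inr \<omega>) n) = of_bool (?D = C)" by simp
  qed
  then show ?thesis by (rule tendsto_eventually)
qed

lemma approach_end_coordinate:
  assumes \<omega>: "\<omega> \<in> vertex_ends G" shows "(\<lambda>n. approach (Inr \<omega>) n u) \<longlonglongrightarrow> 0"
proof -
  have ray: "(SOME r. r \<in> \<omega>) \<in> rays G" using approach_ray[OF \<omega>] vertex_endsD(2)[OF \<omega>] by blast
  obtain N where "\<forall>n\<ge>N. (SOME r. r \<in> \<omega>) n \<notin> {u}" using ray_leaves_finite[OF ray, of "{u}"] by auto
  then have "\<forall>n\<ge>N. approach (Inr \<omega>) n u = 0" by (auto simp: vertex_def)
  then have "\<forall>\<^sub>F n in sequentially. approach (Inr \<omega>) n u = 0" unfolding eventually_sequentially by blast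
  then show ?thesis by (rule tendsto_eventually)
qed

lemma L_Cauchy_coordinate:
  assumes "L_Cauchy p" shows "convergent (\<lambda>n. p n u)"
proof -
  have \<delta>: "0 < low_at {u}" by (rule low_at_pos) simp
  have "Cauchy (\<lambda>n. p n u)"
  proof (rule metric_CauchyI)
    fix \<epsilon> :: real assume "\<epsilon> > 0"
    then obtain N where N: "\<And>m n. m \<ge> N \<Longrightarrow> n \<ge> N \<Longrightarrow> L (p m) (p n) < low_at {u} * \<epsilon>"
      using assms \<delta> unfolding L_Cauchy_def by (meson mult_pos_pos)
    have "dist (p m u) (p n u) < \<epsilon>" if "m \<ge> N" "n \<ge> N" for m n
    proof -
      have "low_at {u} * \<bar>p m u - p n u\<bar> \<le> L (p m) (p n)"
        by (rule L_ge_coordinate) (use assms in \<open>auto simp: L_Cauchy_def\<close>)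
      then have "low_at {u} * \<bar>p m u - p n u\<bar> < low_at {u} * \<epsilon>" using N[OF that] by linarith
      then show ?thesis using \<delta> by (simp add: dist_real_def)
    qed
    then show "\<exists>N. \<forall>m\<ge>N. \<forall>n\<ge>N. dist (p m u) (p n u) < \<epsilon>" by blast
  qed
  then show ?thesis by (simp add: Cauchy_convergent)
qed

text \<open>A point with a positive coordinate at \<open>u\<close> is determined by this coordinate and the edge at \<open>u\<close> that contains it.
  If the coordinate tends to 1, then the edge does not matter; otherwise it is eventually constant, as points in the
  middle of different edges at \<open>u\<close> are far apart.\<close>

lemma L_Cauchy_converges_in_star:
  assumes p: "L_Cauchy p" and lim: "(\<lambda>n. p n u) \<longlonglongrightarrow> c" and c: "c > 0"
  obtains x where "x \<in> points G" "(\<lambda>n. L (p n) x) \<longlonglongrightarrow> 0"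
proof -
  have pts: "p n \<in> points G" for n using p by (simp add: L_Cauchy_def)
  have "\<forall>\<^sub>F n in sequentially. p n u > 0" by (rule order_tendstoD(1)[OF lim c])
  then obtain N where N: "\<And>n. n \<ge> N \<Longrightarrow> p n u > 0" unfolding eventually_sequentially by blast
  have u: "u \<in> verts G" using points_at(1)[OF pts N[of N]] by simp
  have le1: "p n u \<le> 1" for n using mass_bounds(2)[OF pts[of n], of "{u}"] by (simp only: mass_singleton)
  have "c \<le> 1" by (rule LIMSEQ_le_const2[OF lim]) (use le1 in blast)
  have near_vertex: "L (p n) (vertex u) \<le> 1 - p n u" if n: "n \<ge> N" for n
  proof -
    consider "p n = vertex u" | w where "{u, w} \<in> edges G" "p n = seg u w (1 - p n u)"
      using points_at(2)[OF pts N[OF n]] by blast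
    then show ?thesis
    proof cases
      case 1
      then show ?thesis using L_refl[OF pts[of n]] le1[of n] by simp
    next
      case 2
      have "L (seg u w (1 - p n u)) (seg u w 0) \<le> part_edge_len {u, w} * \<bar>1 - p n u - 0\<bar>"
        by (rule L_seg[OF 2(1)]) (use le1[of n] N[OF n] in auto)
      also have "\<dots> \<le> 1 * (1 - p n u)"
        using mult_right_mono[OF part_edge_len_le_1[OF 2(1)], of "1 - p n u"] le1[of n] by simp
      finally show ?thesis using 2(2) by simp
    qed
  qed
  show ?thesis
  proof (cases "c = 1")
    case True
    have "(\<lambda>n. 1 - p n u) \<longlonglongrightarrow> 0" using tendsto_diff[OF tendsto_const lim, of 1] True by simp
    moreover have "\<forall>\<^sub>F n in sequentially. norm (L (p n) (vertex u)) \<le> 1 - p n u"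
      unfolding eventually_sequentially using near_vertex L_nonneg by (metis abs_of_nonneg real_norm_def)
    ultimately have "(\<lambda>n. L (p n) (vertex u)) \<longlonglongrightarrow> 0" by (rule Lim_null_comparison[rotated])
    then show ?thesis using that vertex_in_points[OF u] by blast
  next
    case False
    then have c1: "c < 1" using \<open>c \<le> 1\<close> by simp
    \<comment> \<open>From some point on, both coordinates of \<open>p n\<close> are larger than \<open>\<eta>\<close>.\<close>
    define \<eta> where "\<eta> = min c (1 - c) / 2"
    have \<eta>: "0 < \<eta>" "\<eta> < c" "\<eta> < 1 - c" using c c1 by (auto simp: \<eta>_def min_def)
    define \<delta> where "\<delta> = low_at {u}"
    have \<delta>: "0 < \<delta>" by (simp add: \<delta>_def low_at_pos)
    have "\<forall>\<^sub>F n in sequentially. \<eta> < p n u \<and> p n u < 1 - \<eta>"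
      by (intro eventually_conj order_tendstoD[OF lim]) (use \<eta> in auto)
    then obtain N1 where N1: "\<And>n. n \<ge> N1 \<Longrightarrow> \<eta> < p n u \<and> p n u < 1 - \<eta>" unfolding eventually_sequentially by blast
    obtain N2 where N2: "\<And>m n. m \<ge> N2 \<Longrightarrow> n \<ge> N2 \<Longrightarrow> L (p m) (p n) < \<delta> * \<eta>"
      using p mult_pos_pos[OF \<delta> \<eta>(1)] unfolding L_Cauchy_def by meson
    define N3 where "N3 = max N1 N2"
    have on_edge: "\<exists>w. {u, w} \<in> edges G \<and> p n = seg u w (1 - p n u)" if n: "n \<ge> N3" for n
    proof -
      have b: "\<eta> < p n u" "p n u < 1 - \<eta>" using N1 n by (auto simp: N3_def)
      then have "p n u > 0" "p n \<noteq> vertex u" using \<eta>(1) by (auto simp: vertex_def)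
      then show ?thesis using points_at(2)[OF pts] by blast
    qed
    then obtain w where w: "{u, w} \<in> edges G" "p N3 = seg u w (1 - p N3 u)" by blast
    have uw: "u \<noteq> w" by (rule edge_vertsD(3)[OF w(1)])
    \<comment> \<open>Two points in the middle of different edges at \<open>u\<close> are at a distance that is bounded from below.\<close>
    have same: "p n = seg u w (1 - p n u)" if n: "n \<ge> N3" for n
    proof -
      obtain w' where w': "{u, w'} \<in> edges G" "p n = seg u w' (1 - p n u)" using on_edge[OF n] by blast
      have "w' = w"
      proof (rule ccontr)
        assume "w' \<noteq> w"
        have "p n w = seg u w' (1 - p n u) w" using w'(2) by (rule fun_cong)
        then have 0: "p n w = 0" using \<open>w' \<noteq> w\<close> uw by (simp add: seg_apply)
        have "p N3 w = seg u w (1 - p N3 u) w" using w(2) by (rule fun_cong)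
        then have 1: "p N3 w = 1 - p N3 u" using uw by (simp add: seg_apply)
        have b: "\<eta> < p N3 u" "p N3 u < 1 - \<eta>" "\<eta> < p n u" using N1 n by (auto simp: N3_def)
        have "{w, u} \<in> edges G" using w(1) by (simp add: insert_commute)
        then have le: "\<delta> \<le> part_edge_len {u, w}"
          unfolding \<delta>_def using low_at_le[of "{u}" w u] by (simp add: insert_commute)
        have "\<bar>min (\<delta> * p N3 u) (\<delta> * p N3 w) - min (\<delta> * p n u) (\<delta> * p n w)\<bar> \<le> L (p N3) (p n)"
          by (rule L_ge_edge_bump[OF w(1) _ le _ le pts pts]) (use \<delta> in auto)
        moreover have "L (p N3) (p n) < \<delta> * \<eta>" by (rule N2) (use n in \<open>auto simp: N3_def\<close>)
        moreover have "\<delta> * \<eta> \<le> min (\<delta> * p N3 u) (\<delta> * p N3 w)" using b 1 \<delta> by simp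
        moreover have "min (\<delta> * p n u) (\<delta> * p n w) = 0" using 0 b(3) \<eta>(1) \<delta> by simp
        ultimately show False by linarith
      qed
      then show ?thesis using w' by simp
    qed
    let ?x = "seg u w (1 - c)"
    have x: "?x \<in> points G" by (rule seg_in_points[OF w(1)]) (use c c1 in auto)
    have near: "norm (L (p n) ?x) \<le> part_edge_len {u, w} * \<bar>p n u - c\<bar>" if "n \<ge> N3" for n
    proof -
      have "L (seg u w (1 - p n u)) ?x \<le> part_edge_len {u, w} * \<bar>1 - p n u - (1 - c)\<bar>"
        by (rule L_seg[OF w(1)]) (use c c1 le1[of n] N1[of n] that \<eta> in \<open>auto simp: N3_def\<close>)
      moreover have "\<bar>1 - p n u - (1 - c)\<bar> = \<bar>p n u - c\<bar>" by linarith
      ultimately show ?thesis using same[OF that] L_nonneg[of "p n" ?x] by simp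
    qed
    have "(\<lambda>n. part_edge_len {u, w} * \<bar>p n u - c\<bar>) \<longlonglongrightarrow> part_edge_len {u, w} * \<bar>c - c\<bar>"
      by (intro tendsto_intros lim)
    then have lim0: "(\<lambda>n. part_edge_len {u, w} * \<bar>p n u - c\<bar>) \<longlonglongrightarrow> 0" by simp
    have "\<forall>\<^sub>F n in sequentially. norm (L (p n) ?x) \<le> part_edge_len {u, w} * \<bar>p n u - c\<bar>"
      unfolding eventually_sequentially using near by blast
    from Lim_null_comparison[OF this lim0] show ?thesis using that x by blast
  qed
qed

lemma verts_component: "verts G \<in> components_minus G (W 0)"
proof -
  obtain v where v: "v \<in> verts G" using conn by (auto simp: connected_graph_def)
  have "verts G = {w. reach G {} v w}"
    using conn v reachD(2) by (auto simp: connected_graph_def)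
  then show ?thesis using component_of[OF v, of "{}"] by (simp add: W_0)
qed

text \<open>If all coordinates tend to 0, then the sequence runs away from each of the finite parts. As the components
  of \<open>G - W (n + 1)\<close> inside a component of \<open>G - W n\<close> are far apart from each other, it settles in one of them.\<close>

lemma L_Cauchy_next_component:
  assumes p: "L_Cauchy p" and null: "\<And>u. (\<lambda>k. p k u) \<longlonglongrightarrow> 0"
    and C: "C \<in> components_minus G (W n)" "(\<lambda>k. mass C (p k)) \<longlonglongrightarrow> 1"
  obtains D where "D \<in> components_minus G (W (Suc n))" "D \<subseteq> C" "(\<lambda>k. mass D (p k)) \<longlonglongrightarrow> 1"
proof -
  have pts: "p n \<in> points G" for n using p by (simp add: L_Cauchy_def)
  define K where "K = C \<inter> W (Suc n)"
  have K: "finite K" unfolding K_def by (rule part_finite[OF C(1)])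
  have "(\<lambda>k. \<Sum>u\<in>K. p k u) \<longlonglongrightarrow> (\<Sum>u\<in>K. 0)" by (rule tendsto_sum) (rule null)
  then have "(\<lambda>k. mass K (p k)) \<longlonglongrightarrow> 0" by (simp add: mass_finite[OF K])
  then have "(\<lambda>k. mass C (p k) - mass K (p k)) \<longlonglongrightarrow> 1 - 0" by (rule tendsto_diff[OF C(2)])
  moreover have "mass C (p k) - mass K (p k) = mass (C - K) (p k)" for k
    by (rule mass_Diff[symmetric, OF pts]) (simp add: K_def)
  ultimately have CK: "(\<lambda>k. mass (C - K) (p k)) \<longlonglongrightarrow> 1" by simp
  have D_mass: "mass D x = mass (C - K) x"
    if D: "D \<in> components_minus G (W (Suc n))" "D \<subseteq> C - K" and x: "x \<in> points G" "mass D x > 0" for D x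
    using x(1)
  proof (cases rule: points_cases)
    case (1 v)
    then have "v \<in> D" using x(2) by (auto split: if_splits)
    then show ?thesis using 1 D(2) by auto
  next
    case (2 a b t)
    have ab: "a \<noteq> b" by (rule edge_vertsD(3)[OF 2(1)])
    have step: "z \<in> D \<longleftrightarrow> z \<in> C - K" if "y \<in> D" "{y, z} \<in> edges G" for y z
      using component_leave[OF D(1) that] D(2) by (auto simp: K_def)
    have "a \<in> D \<or> b \<in> D" using x(2) unfolding 2(4) mass_seg[OF ab] by (cases "a \<in> D"; cases "b \<in> D") auto
    then have "(a \<in> D \<longleftrightarrow> a \<in> C - K) \<and> (b \<in> D \<longleftrightarrow> b \<in> C - K)"
      using step[of a b] step[of b a] 2(1) D(2) by (auto simp: insert_commute)
    then show ?thesis unfolding 2(4) mass_seg[OF ab] by simp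
  qed
  obtain u0 where u0: "u0 \<in> C" using component_nonempty[OF C(1)] by blast
  \<comment> \<open>This bound holds for the edges that leave any of the components of \<open>G - W (n + 1)\<close> inside \<open>C\<close>.\<close>
  define \<delta> where "\<delta> = low n u0"
  have \<delta>: "0 < \<delta>" by (simp add: \<delta>_def low_pos)
  have "\<forall>\<^sub>F k in sequentially. mass (C - K) (p k) > 1/2" by (rule order_tendstoD(1)[OF CK]) simp
  then obtain N1 where N1: "\<And>k. k \<ge> N1 \<Longrightarrow> mass (C - K) (p k) > 1/2" unfolding eventually_sequentially by blast
  have "0 < \<delta> * (1/4)" using \<delta> by simp
  then obtain N2 where N2: "\<And>k l. k \<ge> N2 \<Longrightarrow> l \<ge> N2 \<Longrightarrow> L (p k) (p l) < \<delta> * (1/4)"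
    using p unfolding L_Cauchy_def by meson
  define N where "N = max N1 N2"
  have "mass (C - K) (p N) > 0" using N1[of N] by (simp add: N_def)
  then obtain a where a: "a \<in> C - K" "p N a \<noteq> 0" using mass_posD by blast
  have aG: "a \<in> verts G" "a \<notin> W (Suc n)" using a component_sub[OF C(1)] by (auto simp: K_def)
  define D where "D = comp (Suc n) a"
  have D: "D \<in> components_minus G (W (Suc n))" "a \<in> D" using comp comp_self aG by (auto simp: D_def)
  have DC: "D \<subseteq> C"
  proof -
    obtain D' where D': "D' \<in> components_minus G (W n)" "D \<subseteq> D'" by (rule component_superset[OF D(1) W_Suc])
    have "D' = C" by (rule component_unique[OF D'(1) C(1), of a]) (use a D(2) D'(2) in auto)
    then show ?thesis using D' by simp
  qed
  have DCK: "D \<subseteq> C - K" using DC component_sub[OF D(1)] by (auto simp: K_def)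
  have leave: "\<delta> \<le> part_edge_len {u, v}" if "{u, v} \<in> edges G" "u \<in> D" "v \<notin> D" for u v
  proof -
    have "v \<in> W (Suc n)" by (rule component_leave[OF D(1) that(2,1,3)])
    from low_le(1)[OF that(1) this] show ?thesis
      using low_cong[OF C(1), of u u0] u0 that(2) DC by (auto simp: \<delta>_def)
  qed
  have "mass D (p N) > 0"
    using mass_ge[OF pts[of N] D(2)] a(2) points_nonneg[OF pts[of N], of a] by linarith
  then have mN: "mass D (p N) > 1/2" using D_mass[OF D(1) DCK pts] N1[of N] by (simp add: N_def)
  have "mass D (p l) = mass (C - K) (p l)" if "l \<ge> N" for l
  proof -
    have "\<delta> * \<bar>mass D (p N) - mass D (p l)\<bar> \<le> L (p N) (p l)"
      by (rule L_ge_mass[OF leave _ pts pts]) (use \<delta> in auto)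
    also have "\<dots> < \<delta> * (1/4)" by (rule N2) (use that in \<open>auto simp: N_def\<close>)
    finally have "\<bar>mass D (p N) - mass D (p l)\<bar> < 1/4" using \<delta> by (simp only: mult_less_cancel_left_pos)
    then have "mass D (p l) > 0" using mN by linarith
    then show ?thesis by (rule D_mass[OF D(1) DCK pts])
  qed
  then have "\<forall>\<^sub>F l in sequentially. mass (C - K) (p l) = mass D (p l)"
    unfolding eventually_sequentially by metis
  then have "(\<lambda>k. mass D (p k)) \<longlonglongrightarrow> 1" by (rule Lim_transform_eventually[OF CK])
  then show ?thesis using that D(1) DC by blast
qed

lemma L_Cauchy_converges_to_end:
  assumes p: "L_Cauchy p" and null: "\<And>u. (\<lambda>k. p k u) \<longlonglongrightarrow> 0"
  obtains \<omega> where "\<omega> \<in> vertex_ends G" "\<And>r. r \<in> \<omega> \<Longrightarrow> (\<lambda>k. L (p k) (vertex (r k))) \<longlonglongrightarrow> 0"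
proof -
  have pts: "p n \<in> points G" for n using p by (simp add: L_Cauchy_def)
  have "\<exists>C. \<forall>n. (C n \<in> components_minus G (W n) \<and> (\<lambda>k. mass (C n) (p k)) \<longlonglongrightarrow> 1) \<and> C (Suc n) \<subseteq> C n"
  proof (rule dependent_nat_choice)
    have "(\<lambda>k. mass (verts G) (p k)) \<longlonglongrightarrow> 1" by (simp add: mass_verts[OF pts])
    then show "\<exists>C. C \<in> components_minus G (W 0) \<and> (\<lambda>k. mass C (p k)) \<longlonglongrightarrow> 1" using verts_component by blast
    fix C n assume "C \<in> components_minus G (W n) \<and> (\<lambda>k. mass C (p k)) \<longlonglongrightarrow> 1"
    then obtain D where "D \<in> components_minus G (W (Suc n))" "D \<subseteq> C" "(\<lambda>k. mass D (p k)) \<longlonglongrightarrow> 1"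
      using L_Cauchy_next_component[OF p null, of C n] by metis
    then show "\<exists>D. (D \<in> components_minus G (W (Suc n)) \<and> (\<lambda>k. mass D (p k)) \<longlonglongrightarrow> 1) \<and> D \<subseteq> C" by blast
  qed
  then obtain C where C: "\<And>n. C n \<in> components_minus G (W n)" "\<And>n. (\<lambda>k. mass (C n) (p k)) \<longlonglongrightarrow> 1"
    "\<And>n. C (Suc n) \<subseteq> C n" by metis
  have "v \<notin> (\<Inter>n. C n)" for v
  proof
    assume v: "v \<in> (\<Inter>n. C n)"
    then have "v \<in> C 0" by blast
    then have "v \<in> verts G" using component_sub[OF C(1)] by blast
    then obtain n where "v \<in> W n" using W_UN by blast
    then show False using v component_sub[OF C(1)[of n]] by blast
  qed
  then have empty: "(\<Inter>n. C n) = {}" by blast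
  obtain r where r: "r \<in> rays G" "\<And>n. ev r (C n)"
    using connected_sets_ray[of C, OF C(3) component_nonempty[OF C(1)] component_connected[OF C(1)] empty] by metis
  note E = end_of[OF r(1)]
  have "(\<lambda>k. L (p k) (vertex (q k))) \<longlonglongrightarrow> 0" if q: "q \<in> end_of r" for q
  proof (rule LIMSEQ_I)
    fix \<epsilon> :: real assume "\<epsilon> > 0"
    then obtain n where n: "9 * (1/2) ^ n < \<epsilon>" using ex_power_half_less[of \<epsilon> 9] by auto
    obtain C' where C': "C' \<in> components_minus G (W n)" "\<And>q. q \<in> end_of r \<Longrightarrow> ev q C'"
      using end_level_component[where n = n, OF E(1)] by metis
    have "C' = C n" by (rule ev_component_unique[OF C'(1) C(1) C'(2)[OF E(2)] r(2)])
    then have "ev q (C n)" using C'(2)[OF q] by simp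
    then obtain N1 where N1: "\<And>k. k \<ge> N1 \<Longrightarrow> q k \<in> C n" unfolding eventually_sequentially by blast
    have "\<forall>\<^sub>F k in sequentially. mass (C n) (p k) > max 0 (1 - (1/2) ^ n)"
      by (rule order_tendstoD(1)[OF C(2)]) simp
    then obtain N2 where N2: "\<And>k. k \<ge> N2 \<Longrightarrow> mass (C n) (p k) > max 0 (1 - (1/2) ^ n)" unfolding eventually_sequentially by blast
    have "norm (L (p k) (vertex (q k)) - 0) < \<epsilon>" if k: "k \<ge> max N1 N2" for k
    proof -
      have m: "mass (C n) (p k) > max 0 (1 - (1/2) ^ n)" using N2 k by simp
      then have "mass (C n) (p k) > 0" by simp
      then obtain c where c: "c \<in> C n" "L (p k) (vertex c) \<le> max ((1/2) ^ n) (1 - mass (C n) (p k))"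
        by (rule L_near_component[OF C(1) pts])
      have "q k \<in> C n" using N1 k by simp
      then have "L (vertex c) (vertex (q k)) \<le> 8 * (1/2) ^ n" by (rule L_component[OF C(1) c(1)])
      moreover have "L (p k) (vertex (q k)) \<le> L (p k) (vertex c) + L (vertex c) (vertex (q k))"
        using c(1) \<open>q k \<in> C n\<close> component_sub[OF C(1)[of n]] by (intro L_triangle pts vertex_in_points) auto
      moreover have "L (p k) (vertex c) \<le> (1/2) ^ n" using c(2) m by simp
      ultimately show ?thesis using n L_nonneg[of "p k" "vertex (q k)"] by simp
    qed
    then show "\<exists>N. \<forall>k\<ge>N. norm (L (p k) (vertex (q k)) - 0) < \<epsilon>" by blast
  qed
  then show ?thesis using that E(1) by blast
qed

lemma L_Cauchy_converges:
  assumes p: "L_Cauchy p"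
  obtains a where "a \<in> topspace (MTOP G)" "(\<lambda>n. L (p n) (approach a n)) \<longlonglongrightarrow> 0"
proof -
  have pts: "p n \<in> points G" for n using p by (simp add: L_Cauchy_def)
  obtain c where c: "\<And>u. (\<lambda>n. p n u) \<longlonglongrightarrow> c u"
    using L_Cauchy_coordinate[OF p] unfolding convergent_def by metis
  have c_nonneg: "0 \<le> c u" for u by (rule LIMSEQ_le_const[OF c]) (use points_nonneg[OF pts] in blast)
  show ?thesis
  proof (cases "\<exists>u. c u > 0")
    case True
    then obtain u where "c u > 0" by blast
    then obtain x where "x \<in> points G" "(\<lambda>n. L (p n) x) \<longlonglongrightarrow> 0"
      by (rule L_Cauchy_converges_in_star[OF p c])
    then show ?thesis using that[of "Inl x"] by (simp add: topspace_MTOP)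
  next
    case False
    have "c u = 0" for u using False c_nonneg[of u] by (auto simp: order_le_less)
    then have "(\<lambda>n. p n u) \<longlonglongrightarrow> 0" for u using c[of u] by simp
    then obtain \<omega> where \<omega>: "\<omega> \<in> vertex_ends G" "\<And>r. r \<in> \<omega> \<Longrightarrow> (\<lambda>k. L (p k) (vertex (r k))) \<longlonglongrightarrow> 0"
      using L_Cauchy_converges_to_end[OF p] by metis
    then show ?thesis using that[of "Inr \<omega>"] approach_ray[OF \<omega>(1)] by (simp add: topspace_MTOP)
  qed
qed

end

section \<open>The homeomorphism\<close>

context normally_partitioned_graph
begin

interpretation Q: Metric_space "quotient_points G part_edge_len" "quotient_dist G part_edge_len"
  by (rule Metric_space_quotient)

lemma MCauchy_class_iff: "Q.MCauchy (\<lambda>n. ident `` {p n}) \<longleftrightarrow> L_Cauchy p" if pts: "\<And>n. p n \<in> points G"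
  unfolding Q.MCauchy_def L_Cauchy_def using pts
  by (auto simp: quotient_dist_class quotient_points_def intro: quotientI)

lemma MCauchy_classE:
  assumes "Q.MCauchy s" obtains p where "L_Cauchy p" "s = (\<lambda>n. ident `` {p n})"
proof -
  have "\<exists>x. x \<in> points G \<and> s n = ident `` {x}" for n
    using quotient_pointsE[OF Q.MCauchy_in[OF assms, of n]] by metis
  then obtain p where p: "\<And>n. p n \<in> points G" "\<And>n. s n = ident `` {p n}" by metis
  then have "s = (\<lambda>n. ident `` {p n})" by auto
  then show ?thesis using that assms MCauchy_class_iff[OF p(1)] by simp
qed

definition approach_class :: "('a \<Rightarrow> real) + (nat \<Rightarrow> 'a) set \<Rightarrow> nat \<Rightarrow> ('a \<Rightarrow> real) set" where
  "approach_class a = (\<lambda>n. ident `` {approach a n})"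

definition \<rho> where
  "\<rho> a b = completion_dist (quotient_points G part_edge_len) (quotient_dist G part_edge_len)
     (Q.cauchy_class (approach_class a)) (Q.cauchy_class (approach_class b))"

lemma approach_class_MCauchy: "a \<in> topspace (MTOP G) \<Longrightarrow> Q.MCauchy (approach_class a)"
  unfolding approach_class_def
  using MCauchy_class_iff[OF approach_in_points] approach_L_Cauchy by simp

lemma \<rho>_tendsto:
  assumes "a \<in> topspace (MTOP G)" "b \<in> topspace (MTOP G)"
  shows "(\<lambda>n. L (approach a n) (approach b n)) \<longlonglongrightarrow> \<rho> a b"
  using Q.completion_dist_tendsto[OF approach_class_MCauchy[OF assms(1)] approach_class_MCauchy[OF assms(2)]]
    approach_in_points[OF assms(1)] approach_in_points[OF assms(2)]
  by (simp add: \<rho>_def approach_class_def quotient_dist_class)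

text \<open>Lower bounds by contractions pass to the limit.\<close>

lemma \<rho>_ge:
  assumes f: "\<And>x y. x \<in> points G \<Longrightarrow> y \<in> points G \<Longrightarrow> \<delta> * \<bar>f x - f y\<bar> \<le> L x y"
    and a: "a \<in> topspace (MTOP G)" "(\<lambda>n. f (approach a n)) \<longlonglongrightarrow> \<alpha>"
    and b: "b \<in> topspace (MTOP G)" "(\<lambda>n. f (approach b n)) \<longlonglongrightarrow> \<beta>"
  shows "\<delta> * \<bar>\<alpha> - \<beta>\<bar> \<le> \<rho> a b"
proof (rule LIMSEQ_le[OF _ \<rho>_tendsto[OF a(1) b(1)]])
  show "(\<lambda>n. \<delta> * \<bar>f (approach a n) - f (approach b n)\<bar>) \<longlonglongrightarrow> \<delta> * \<bar>\<alpha> - \<beta>\<bar>"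
    by (intro tendsto_intros a(2) b(2))
  show "\<exists>N. \<forall>n\<ge>N. \<delta> * \<bar>f (approach a n) - f (approach b n)\<bar> \<le> L (approach a n) (approach b n)"
    using f[OF approach_in_points[OF a(1)] approach_in_points[OF b(1)]] by blast
qed

lemma \<rho>_le:
  assumes "a \<in> topspace (MTOP G)" "b \<in> topspace (MTOP G)"
    and "\<forall>\<^sub>F n in sequentially. L (approach a n) (approach b n) \<le> c"
  shows "\<rho> a b \<le> c"
  by (rule tendsto_upperbound[OF \<rho>_tendsto[OF assms(1,2)] assms(3)]) simp

text \<open>Coordinates and masses of components extend continuously to the ends. This makes the sets
  that generate the topology of \<open>MTOP(G)\<close> open for the metric.\<close>

definition coord :: "'a \<Rightarrow> ('a \<Rightarrow> real) + (nat \<Rightarrow> 'a) set \<Rightarrow> real" where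
  "coord u a = (case a of Inl x \<Rightarrow> x u | Inr \<omega> \<Rightarrow> 0)"

definition end_mass :: "'a set \<Rightarrow> 'a set \<Rightarrow> ('a \<Rightarrow> real) + (nat \<Rightarrow> 'a) set \<Rightarrow> real" where
  "end_mass S C a = (case a of Inl x \<Rightarrow> mass C x | Inr \<omega> \<Rightarrow> of_bool (end_component G S \<omega> = C))"

lemma \<rho>_ge_coord:
  assumes "a \<in> topspace (MTOP G)" "b \<in> topspace (MTOP G)"
  shows "low_at {u} * \<bar>coord u a - coord u b\<bar> \<le> \<rho> a b"
proof -
  have lim: "(\<lambda>n. approach c n u) \<longlonglongrightarrow> coord u c" if c: "c \<in> topspace (MTOP G)" for c
  proof -
    consider x where "c = Inl x" | \<omega> where "\<omega> \<in> vertex_ends G" "c = Inr \<omega>"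
      using c by (auto simp: topspace_MTOP)
    then show ?thesis
    proof cases
      case 2
      show ?thesis using approach_end_coordinate[OF 2(1), of u] unfolding 2(2) coord_def by simp
    qed (simp add: coord_def)
  qed
  show ?thesis
    by (rule \<rho>_ge[where f = "\<lambda>x. x u", OF L_ge_coordinate assms(1) lim[OF assms(1)] assms(2) lim[OF assms(2)]])
qed

lemma \<rho>_ge_end_mass:
  assumes S: "finite S" "S \<subseteq> verts G" "C \<in> components_minus G S"
    and ab: "a \<in> topspace (MTOP G)" "b \<in> topspace (MTOP G)"
  shows "low_at S * \<bar>end_mass S C a - end_mass S C b\<bar> \<le> \<rho> a b"
proof -
  have lim: "(\<lambda>n. mass C (approach c n)) \<longlonglongrightarrow> end_mass S C c" if c: "c \<in> topspace (MTOP G)" for c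
  proof -
    consider x where "c = Inl x" | \<omega> where "\<omega> \<in> vertex_ends G" "c = Inr \<omega>"
      using c by (auto simp: topspace_MTOP)
    then show ?thesis
    proof cases
      case 2
      show ?thesis using approach_end_mass[OF 2(1) S] unfolding 2(2) end_mass_def by simp
    qed (simp add: end_mass_def)
  qed
  show ?thesis
    by (rule \<rho>_ge[where f = "mass C", OF L_ge_mass_component[OF S(3,1)] ab(1) lim[OF ab(1)] ab(2) lim[OF ab(2)]])
qed

lemma \<rho>_zero:
  assumes ab: "a \<in> topspace (MTOP G)" "b \<in> topspace (MTOP G)" and zero: "\<rho> a b = 0"
  shows "a = b"
proof -
  have coord: "coord u a = coord u b" for u
    using \<rho>_ge_coord[OF ab, of u] low_at_pos[of "{u}"] unfolding zero by (simp add: mult_le_0_iff)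
  have nz: "\<exists>u. coord u (Inl x) \<noteq> 0" if "x \<in> points G" for x
    using points_ex_pos[OF that] by (simp add: coord_def) (metis less_irrefl)
  consider x y where "x \<in> points G" "y \<in> points G" "a = Inl x" "b = Inl y"
    | x \<omega> where "x \<in> points G" "a = Inl x" "b = Inr \<omega>" | x \<omega> where "x \<in> points G" "b = Inl x" "a = Inr \<omega>"
    | \<omega> \<omega>' where "\<omega> \<in> vertex_ends G" "\<omega>' \<in> vertex_ends G" "a = Inr \<omega>" "b = Inr \<omega>'"
    using ab by (auto simp: topspace_MTOP)
  then show ?thesis
  proof cases
    case 1
    then show ?thesis using coord by (auto simp: coord_def)
  next
    case 2
    then show ?thesis using nz[OF 2(1)] coord by (auto simp: coord_def)
  next
    case 3
    then show ?thesis using nz[OF 3(1)] coord by (auto simp: coord_def)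
  next
    case 4
    have "\<omega> = \<omega>'"
    proof (rule vertex_ends_eqI[OF 4(1,2)])
      fix S assume S: "finite S" "S \<subseteq> verts G"
      have "end_mass S (end_component G S \<omega>) a = end_mass S (end_component G S \<omega>) b"
        using \<rho>_ge_end_mass[OF S end_component(1)[OF 4(1) S] ab] low_at_pos[OF S(1)]
        unfolding zero by (simp add: mult_le_0_iff)
      then show "end_component G S \<omega> = end_component G S \<omega>'"
        unfolding 4(3,4) by (auto simp: end_mass_def split: if_splits)
    qed
    then show ?thesis using 4 by simp
  qed
qed

lemma MTOP_base_\<rho>_open:
  assumes B: "B \<in> MTOP_base" and a: "a \<in> B" "a \<in> topspace (MTOP G)"
  shows "\<exists>r>0. \<forall>b\<in>topspace (MTOP G). \<rho> a b < r \<longrightarrow> b \<in> B"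
proof -
  have cont: "\<bar>coord u a - coord u b\<bar> < \<epsilon>" if "b \<in> topspace (MTOP G)" "\<rho> a b < low_at {u} * \<epsilon>" for u b \<epsilon>
  proof -
    have "low_at {u} * \<bar>coord u a - coord u b\<bar> < low_at {u} * \<epsilon>"
      using \<rho>_ge_coord[OF a(2) that(1), of u] that(2) by linarith
    then show ?thesis using low_at_pos[of "{u}"] by (simp only: mult_less_cancel_left_pos finite.intros)
  qed
  from B show ?thesis
  proof (cases rule: MTOP_base_cases)
    case (edge u v T)
    note eq = open_edge_part_eq[OF edge(1,3)]
    obtain x where x: "x \<in> points G" "x u > 0" "x v > 0" "x v \<in> T" "a = Inl x"
      using a(1) unfolding edge(4) eq by blast
    obtain \<eta> where \<eta>: "\<eta> > 0" "ball (x v) \<eta> \<subseteq> T" using edge(2) x(4) open_contains_ball by blast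
    define r where "r = min (low_at {u} * x u) (low_at {v} * min (x v) \<eta>)"
    have "b \<in> B" if b: "b \<in> topspace (MTOP G)" "\<rho> a b < r" for b
    proof -
      have "\<bar>coord u a - coord u b\<bar> < x u" by (rule cont[OF b(1)]) (use b(2) in \<open>simp add: r_def\<close>)
      then have bu: "coord u b > 0" unfolding x(5) by (simp add: coord_def)
      then obtain y where y: "y \<in> points G" "b = Inl y"
        using b(1) by (auto simp: topspace_MTOP coord_def)
      have "\<bar>coord v a - coord v b\<bar> < min (x v) \<eta>" by (rule cont[OF b(1)]) (use b(2) in \<open>simp add: r_def\<close>)
      then have near: "\<bar>x v - y v\<bar> < x v" "\<bar>x v - y v\<bar> < \<eta>" unfolding x(5) y(2) by (simp_all add: coord_def)
      then have "y v \<in> T" using \<eta>(2) by (auto simp: subset_eq dist_real_def)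
      moreover have "y u > 0" using bu y(2) by (simp add: coord_def)
      ultimately have "y \<in> seg u v ` T" unfolding eq using y(1) near(1) by simp
      then show ?thesis unfolding edge(4) y(2) by blast
    qed
    moreover have "r > 0" using x \<eta> low_at_pos[of "{u}"] low_at_pos[of "{v}"] by (simp add: r_def)
    ultimately show ?thesis by blast
  next
    case (star v \<epsilon>)
    note eq = open_star_eq[OF star(1-3)]
    obtain x where x: "x \<in> points G" "x v > 1 - \<epsilon>" "a = Inl x" using a(1) unfolding star(4) eq by blast
    define r where "r = low_at {v} * (x v - (1 - \<epsilon>))"
    have "b \<in> B" if b: "b \<in> topspace (MTOP G)" "\<rho> a b < r" for b
    proof -
      have "\<bar>coord v a - coord v b\<bar> < x v - (1 - \<epsilon>)" by (rule cont[OF b(1)]) (use b(2) in \<open>simp add: r_def\<close>)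
      then have bv: "coord v b > 1 - \<epsilon>" unfolding x(3) by (simp add: coord_def)
      then obtain y where y: "y \<in> points G" "b = Inl y"
        using b(1) star(3) by (auto simp: topspace_MTOP coord_def)
      then have "y \<in> open_star G v \<epsilon>" unfolding eq using bv by (simp add: coord_def)
      then show ?thesis unfolding star(4) y(2) by blast
    qed
    moreover have "r > 0" using x low_at_pos[of "{v}"] by (simp add: r_def)
    ultimately show ?thesis by blast
  next
    case (vend S \<omega> \<epsilon>)
    note eq = end_nbhd_eq[OF vend(1-4)]
    define C where "C = end_component G S \<omega>"
    have C: "C \<in> components_minus G S" unfolding C_def by (rule end_component(1)[OF vend(3,1,2)])
    define \<theta> where "\<theta> = max 0 (1 - \<epsilon>)"
    have mem: "b \<in> B \<longleftrightarrow> end_mass S C b > \<theta>" if b: "b \<in> topspace (MTOP G)" for b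
    proof -
      have "\<theta> < 1" using vend(4) by (simp add: \<theta>_def)
      consider y where "y \<in> points G" "b = Inl y" | \<omega>' where "\<omega>' \<in> vertex_ends G" "b = Inr \<omega>'"
        using b by (auto simp: topspace_MTOP)
      then show ?thesis
      proof cases
        case 1
        then show ?thesis unfolding vend(5) eq C_def[symmetric] \<theta>_def[symmetric] by (auto simp: end_mass_def)
      next
        case 2
        have "0 \<le> \<theta>" by (simp add: \<theta>_def)
        then show ?thesis using 2 \<open>\<theta> < 1\<close> unfolding vend(5) eq C_def[symmetric] \<theta>_def[symmetric]
          by (auto simp: end_mass_def)
      qed
    qed
    define r where "r = low_at S * (end_mass S C a - \<theta>)"
    have "r > 0" using mem[OF a(2)] a(1) low_at_pos[OF vend(1)] by (simp add: r_def)
    moreover have "b \<in> B" if b: "b \<in> topspace (MTOP G)" "\<rho> a b < r" for b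
    proof -
      have "low_at S * \<bar>end_mass S C a - end_mass S C b\<bar> < low_at S * (end_mass S C a - \<theta>)"
        using \<rho>_ge_end_mass[OF vend(1,2) C a(2) b(1)] b(2) by (simp add: r_def)
      then have "\<bar>end_mass S C a - end_mass S C b\<bar> < end_mass S C a - \<theta>"
        using low_at_pos[OF vend(1)] by (simp only: mult_less_cancel_left_pos)
      then have "end_mass S C b > \<theta>" by linarith
      then show ?thesis using mem[OF b(1)] by simp
    qed
    ultimately show ?thesis by blast
  qed
qed

lemma MTOP_open_imp_\<rho>_open:
  assumes "openin (MTOP G) U" "a \<in> U"
  shows "\<exists>r>0. \<forall>b\<in>topspace (MTOP G). \<rho> a b < r \<longrightarrow> b \<in> U"
proof -
  have top: "a \<in> topspace (MTOP G)" using openin_subset[OF assms(1)] assms(2) by blast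
  show ?thesis using assms[unfolded openin_MTOP_iff]
  proof induction
    case (Int A B)
    then obtain r s where "r > 0" "s > 0" "\<forall>b\<in>topspace (MTOP G). \<rho> a b < r \<longrightarrow> b \<in> A"
      "\<forall>b\<in>topspace (MTOP G). \<rho> a b < s \<longrightarrow> b \<in> B" by blast
    then show ?case by (intro exI[of _ "min r s"]) auto
  next
    case (UN K)
    then obtain k where k: "k \<in> K" "a \<in> k" by blast
    from UN.IH[OF k] show ?case using k(1) by blast
  next
    case (Basis B)
    then show ?case using MTOP_base_\<rho>_open top by blast
  qed simp
qed

text \<open>Edges have length at most 1, so that stars of small radius and short pieces of edges are small. For an end, take
  its component of \<open>G - W n\<close> for large \<open>n\<close>, separated by finitely many vertices: its points are at distance at most
  \<open>(1/2)^n\<close> from a vertex of the component, and its vertices at distance at most \<open>8 * (1/2)^n\<close> from each other.\<close>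

lemma small_MTOP_nbhd:
  assumes a: "a \<in> topspace (MTOP G)" and r: "(r::real) > 0"
  obtains B where "openin (MTOP G) B" "a \<in> B" "\<And>b. b \<in> B \<Longrightarrow> \<rho> a b < r"
proof -
  have "\<exists>B. openin (MTOP G) B \<and> a \<in> B \<and> (\<forall>b\<in>B. \<rho> a b < r)"
  proof -
    have \<rho>_points: "\<rho> (Inl x) (Inl y) \<le> L x y" if "x \<in> points G" "y \<in> points G" for x y
      by (rule \<rho>_le) (use that in \<open>simp_all add: topspace_MTOP\<close>)
    consider x where "x \<in> points G" "a = Inl x" | \<omega> where "\<omega> \<in> vertex_ends G" "a = Inr \<omega>"
      using a by (auto simp: topspace_MTOP)
    then show ?thesis
    proof cases
      case x: 1
      from x(1) show ?thesis
      proof (cases rule: points_cases)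
        case (1 v)
        define \<epsilon> where "\<epsilon> = min (r/2) (1/2)"
        have \<epsilon>: "0 < \<epsilon>" "\<epsilon> < 1" "\<epsilon> < r" using r by (auto simp: \<epsilon>_def min_def)
        have "\<rho> a b < r" if b: "b \<in> Inl ` open_star G v \<epsilon>" for b
        proof -
          obtain y where y: "y \<in> open_star G v \<epsilon>" "b = Inl y" using b by blast
          have yG: "y \<in> points G" using y(1) open_star_eq[OF 1(1) \<epsilon>(1,2)] by blast
          have "L x y \<le> \<epsilon>"
          proof -
            consider "y = vertex v" | w t where "y = seg v w t" "{v, w} \<in> edges G" "0 \<le> t" "t < \<epsilon>"
              using y(1) unfolding open_star_def by blast
            then show ?thesis
            proof cases
              case c: 1
              then show ?thesis using 1 L_refl[OF x(1)] \<epsilon>(1) by simp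
            next
              case 2
              have "L (seg v w 0) (seg v w t) \<le> part_edge_len {v, w} * \<bar>0 - t\<bar>"
                by (rule L_seg[OF 2(2)]) (use 2 \<epsilon> in auto)
              also have "\<dots> \<le> 1 * t" using mult_right_mono[OF part_edge_len_le_1[OF 2(2)], of t] 2(3) by simp
              finally show ?thesis using 1 2 by simp
            qed
          qed
          then show ?thesis using \<rho>_points[OF x(1) yG] \<epsilon>(3) unfolding x(2) y(2) by linarith
        qed
        moreover have "a \<in> Inl ` open_star G v \<epsilon>" using x(2) 1(2) by (simp add: open_star_def)
        ultimately show ?thesis using openin_MTOP_star[OF 1(1) \<epsilon>(1,2)] by blast
      next
        case (2 u v t)
        define T where "T = {0<..<1} \<inter> ball t r"
        have T: "open T" "T \<subseteq> {0<..<1}" "t \<in> T" using 2 r by (auto simp: T_def)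
        have "\<rho> a b < r" if b: "b \<in> Inl ` seg u v ` T" for b
        proof -
          obtain s where s: "s \<in> T" "b = Inl (seg u v s)" using b by blast
          have sG: "seg u v s \<in> points G" by (rule seg_in_points[OF 2(1)]) (use s(1) T(2) in auto)
          have "L x (seg u v s) \<le> part_edge_len {u, v} * \<bar>t - s\<bar>"
            unfolding 2(4) by (rule L_seg[OF 2(1)]) (use 2 s(1) T(2) in auto)
          also have "\<dots> \<le> 1 * \<bar>t - s\<bar>" by (intro mult_right_mono part_edge_len_le_1[OF 2(1)]) simp
          also have "\<dots> < r" using s(1) by (simp add: T_def dist_real_def)
          finally show ?thesis using \<rho>_points[OF x(1) sG] unfolding x(2) s(2) by linarith
        qed
        moreover have "a \<in> Inl ` seg u v ` T" using x(2) 2(4) T(3) by blast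
        ultimately show ?thesis using openin_MTOP_edge[OF 2(1) T(1,2)] by blast
      qed
    next
      case w: 2
      obtain n where n: "9 * (1/2) ^ n < r" using ex_power_half_less[OF r, of 9] by auto
      obtain C S where CS: "C \<in> components_minus G (W n)" "finite S" "S \<subseteq> verts G"
        "end_component G S \<omega> = C" "\<And>q. q \<in> \<omega> \<Longrightarrow> ev q C"
        using end_level_component[where n = n, OF w(1)] by metis
      have pos: "(0::real) < (1/2) ^ n" by simp
      note eq = end_nbhd_eq[OF CS(2,3) w(1) pos]
      define B where "B = end_nbhd G S \<omega> ((1/2) ^ n)"
      have B: "openin (MTOP G) B" "a \<in> B"
        unfolding B_def w(2) using openin_MTOP_end end_in_nbhd CS(2,3) w(1) pos by blast+
      have evC: "ev (SOME q. q \<in> \<omega>) C" by (rule CS(5)[OF approach_ray[OF w(1)]])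
      have "\<rho> a b < r" if b: "b \<in> B" for b
      proof -
        have bT: "b \<in> topspace (MTOP G)" using openin_subset[OF B(1)] b by blast
        consider y where "y \<in> points G" "mass C y > max 0 (1 - (1/2) ^ n)" "b = Inl y"
          | \<omega>' where "\<omega>' \<in> vertex_ends G" "end_component G S \<omega>' = C" "b = Inr \<omega>'"
          using b unfolding B_def eq CS(4) by auto
        then have "\<rho> a b \<le> 9 * (1/2) ^ n"
        proof cases
          case 1
          have "mass C y > 0" using 1(2) by simp
          then obtain c where c: "c \<in> C" "L y (vertex c) \<le> max ((1/2) ^ n) (1 - mass C y)"
            by (rule L_near_component[OF CS(1) 1(1)])
          have yc: "L (vertex c) y \<le> (1/2) ^ n" using c(2) 1(2) L_sym[of y "vertex c"] by simp
          have le: "L (approach a k) (approach b k) \<le> 9 * (1/2) ^ n" if k: "(SOME q. q \<in> \<omega>) k \<in> C" for k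
          proof -
            have "L (vertex ((SOME q. q \<in> \<omega>) k)) (vertex c) \<le> 8 * (1/2) ^ n" by (rule L_component[OF CS(1) k c(1)])
            moreover have "L (vertex ((SOME q. q \<in> \<omega>) k)) y \<le> L (vertex ((SOME q. q \<in> \<omega>) k)) (vertex c) + L (vertex c) y"
              using k c(1) component_sub[OF CS(1)] 1(1) by (intro L_triangle vertex_in_points) auto
            ultimately show ?thesis using yc unfolding w(2) 1(3) by simp
          qed
          show ?thesis by (rule \<rho>_le[OF a bT eventually_mono[OF evC le]])
        next
          case 2
          have Cc: "C \<in> components_minus G S" using end_component(1)[OF w(1) CS(2,3)] CS(4) by simp
          have evC': "ev (SOME q. q \<in> \<omega>') C"
            using end_component(2)[OF 2(1) CS(2,3) approach_ray[OF 2(1)]] 2(2) by simp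
          have le: "L (approach a k) (approach b k) \<le> 9 * (1/2) ^ n"
            if k: "(SOME q. q \<in> \<omega>) k \<in> C \<and> (SOME q. q \<in> \<omega>') k \<in> C" for k
          proof -
            have "L (vertex ((SOME q. q \<in> \<omega>) k)) (vertex ((SOME q. q \<in> \<omega>') k)) \<le> 8 * (1/2) ^ n"
              using k by (intro L_component[OF CS(1)]) auto
            then show ?thesis unfolding w(2) 2(3) approach.simps by (rule order_trans) simp
          qed
          show ?thesis by (rule \<rho>_le[OF a bT eventually_mono[OF eventually_conj[OF evC evC'] le]])
        qed
        then show ?thesis using n by linarith
      qed
      then show ?thesis using B by blast
    qed
  qed
  then show ?thesis using that by blast
qed

lemma openin_MTOP_iff_\<rho>:
  assumes U: "U \<subseteq> topspace (MTOP G)"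
  shows "openin (MTOP G) U \<longleftrightarrow> (\<forall>a\<in>U. \<exists>r>0. \<forall>b\<in>topspace (MTOP G). \<rho> a b < r \<longrightarrow> b \<in> U)"
proof
  assume R: "\<forall>a\<in>U. \<exists>r>0. \<forall>b\<in>topspace (MTOP G). \<rho> a b < r \<longrightarrow> b \<in> U"
  show "openin (MTOP G) U"
  proof (subst openin_subopen, rule ballI)
    fix a assume aU: "a \<in> U"
    then obtain r where r: "r > 0" "\<And>b. b \<in> topspace (MTOP G) \<Longrightarrow> \<rho> a b < r \<Longrightarrow> b \<in> U" using R by blast
    have a: "a \<in> topspace (MTOP G)" using aU U by blast
    obtain B where B: "openin (MTOP G) B" "a \<in> B" "\<And>b. b \<in> B \<Longrightarrow> \<rho> a b < r" using small_MTOP_nbhd[OF a r(1)] by metis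
    have "B \<subseteq> U" using r(2) B(3) openin_subset[OF B(1)] by blast
    then show "\<exists>T. openin (MTOP G) T \<and> a \<in> T \<and> T \<subseteq> U" using B(1,2) by blast
  qed
qed (use MTOP_open_imp_\<rho>_open in blast)

text \<open>Every point of \<open>MTOP(G)\<close> is the limit of one class of Cauchy sequences, every class has such a limit, and the topology
  of \<open>MTOP(G)\<close> is induced by the distances of the classes.\<close>

theorem length_space_homeomorphic_MTOP:
  "\<exists>h. homeomorphic_map (length_space G part_edge_len) (MTOP G) h \<and>
      (\<forall>x\<in>points G. h (length_space_embed G part_edge_len x) = Inl x)"
proof -
  obtain h where h: "homeomorphic_map (length_space G part_edge_len) (MTOP G) h"
    "\<And>a. a \<in> topspace (MTOP G) \<Longrightarrow> h (Q.cauchy_class (approach_class a)) = a"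
    unfolding length_space_def
  proof (rule Q.homeomorphic_completion[of "MTOP G" approach_class])
    show "Q.MCauchy (approach_class a)" if "a \<in> topspace (MTOP G)" for a by (rule approach_class_MCauchy[OF that])
    show "\<exists>a\<in>topspace (MTOP G). (\<lambda>n. quotient_dist G part_edge_len (s n) (approach_class a n)) \<longlonglongrightarrow> 0"
      if s: "Q.MCauchy s" for s
    proof -
      obtain p where p: "L_Cauchy p" "s = (\<lambda>n. ident `` {p n})" by (rule MCauchy_classE[OF s])
      obtain a where a: "a \<in> topspace (MTOP G)" "(\<lambda>n. L (p n) (approach a n)) \<longlonglongrightarrow> 0" by (rule L_Cauchy_converges[OF p(1)])
      have "quotient_dist G part_edge_len (s n) (approach_class a n) = L (p n) (approach a n)" for n
        unfolding p(2) approach_class_def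
        by (rule quotient_dist_class[OF _ approach_in_points[OF a(1)]]) (use p(1) in \<open>simp add: L_Cauchy_def\<close>)
      then have "(\<lambda>n. quotient_dist G part_edge_len (s n) (approach_class a n)) \<longlonglongrightarrow> 0" using a(2) by simp
      then show ?thesis using a(1) by blast
    qed
    show "a = b" if ab: "a \<in> topspace (MTOP G)" "b \<in> topspace (MTOP G)"
      and lim: "(\<lambda>n. quotient_dist G part_edge_len (approach_class a n) (approach_class b n)) \<longlonglongrightarrow> 0" for a b
    proof (rule \<rho>_zero[OF ab])
      have "quotient_dist G part_edge_len (approach_class a n) (approach_class b n) = L (approach a n) (approach b n)" for n
        unfolding approach_class_def
        by (rule quotient_dist_class[OF approach_in_points[OF ab(1)] approach_in_points[OF ab(2)]])
      then have "(\<lambda>n. L (approach a n) (approach b n)) \<longlonglongrightarrow> 0" using lim by simp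
      from LIMSEQ_unique[OF \<rho>_tendsto[OF ab] this] show "\<rho> a b = 0" .
    qed
  next
    fix U assume "U \<subseteq> topspace (MTOP G)"
    from openin_MTOP_iff_\<rho>[OF this] show "openin (MTOP G) U \<longleftrightarrow>
       (\<forall>a\<in>U. \<exists>r>0. \<forall>b\<in>topspace (MTOP G). completion_dist (quotient_points G part_edge_len) (quotient_dist G part_edge_len)
         (Q.cauchy_class (approach_class a)) (Q.cauchy_class (approach_class b)) < r \<longrightarrow> b \<in> U)"
      unfolding \<rho>_def .
  qed blast
  have "h (length_space_embed G part_edge_len x) = Inl x" if "x \<in> points G" for x
    using h(2)[of "Inl x"] that by (simp add: topspace_MTOP length_space_embed_def completion_embed_def approach_class_def)
  then show ?thesis using h(1) by blast
qed

end

section \<open>The characterization\<close>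

theorem theorem3p7:
  fixes G :: "'a ugraph"
  assumes "connected_graph G"
  shows "(\<exists>len :: 'a set \<Rightarrow> real. (\<forall>e\<in>edges G. 0 < len e) \<and>
            (\<exists>h. homeomorphic_map (length_space G len) (MTOP G) h \<and>
                 (\<forall>x\<in>points G. h (length_space_embed G len x) = Inl x)))
         \<longleftrightarrow> metrizable_space (MTOP G)"
proof
  assume "\<exists>len :: 'a set \<Rightarrow> real. (\<forall>e\<in>edges G. 0 < len e) \<and>
            (\<exists>h. homeomorphic_map (length_space G len) (MTOP G) h \<and>
                 (\<forall>x\<in>points G. h (length_space_embed G len x) = Inl x))"
  then obtain len h where len: "\<And>e. e \<in> edges G \<Longrightarrow> 0 < len e"
    and h: "homeomorphic_map (length_space G len) (MTOP G) h" by blast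
  interpret weighted_connected_graph G len by unfold_locales (use assms len in auto)
  have "length_space G len homeomorphic_space MTOP G" using h by (rule homeomorphic_map_imp_homeomorphic_space)
  then show "metrizable_space (MTOP G)" using metrizable_length_space homeomorphic_metrizable_space by blast
next
  assume M: "metrizable_space (MTOP G)"
  interpret graph G by unfold_locales (rule connected_graph_simple[OF assms])
  obtain V :: "nat \<Rightarrow> 'a set" where V: "\<And>n. dispersed (V n)" "(\<Union>n. V n) = verts G"
    using metrizable_imp_countably_dispersed[OF M] by metis
  obtain W where W: "normal_partition W" using normal_partition_exists[of V, OF V] by metis
  interpret normally_partitioned_graph G W by unfold_locales (rule assms, rule W)
  show "\<exists>len :: 'a set \<Rightarrow> real. (\<forall>e\<in>edges G. 0 < len e) \<and>
            (\<exists>h. homeomorphic_map (length_space G len) (MTOP G) h \<and>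
                 (\<forall>x\<in>points G. h (length_space_embed G len x) = Inl x))"
    using part_edge_len_pos length_space_homeomorphic_MTOP by blast
qed

end
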